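(* Let $\alpha_1,\alpha_2,\gamma_1,\gamma_2,\Gamma$ be real constants with $\Gamma>0$, $\alpha_1\neq 0$ and $\frac{2\alpha_2}{3\alpha_1}\notin\mathbf{Z}$. For any $s\ge 1$ there exists $u_0\in H^s(\mathbf{T})$ such that for no $T>0$ does the Cauchy problem $$\partial_t u=\alpha_1\partial_x^3u+i\alpha_2\partial_x^2u+i\gamma_1|u|^2u+\gamma_2\partial_x(|u|^2u)-i\Gamma u\,\partial_x(|u|^2),\quad x\in\mathbf{T},\qquad u(0,\cdot)=u_0,$$ have a solution $u\in C([0,T];H^s(\mathbf{T}))$ on $[0,T]$, and for no $T>0$ does it have a solution $u\in C([-T,0];H^s(\mathbf{T}))$ on $[-T,0]$.
   Context: Notation: $\mathbf{T}=\mathbf{R}/2\pi\mathbf{Z}$; functions are complex-valued; $\hat f(k)=\frac1{\sqrt{2\pi}}\int_{\mathbf{T}}e^{-ikx}f(x)\,dx$ for $k\in\mathbf{Z}$; $\langle\xi\rangle=1+|\xi|$; $\|f\|_{H^s}=\|\langle k\rangle^s\hat f(k)\|_{\ell^2(\mathbf{Z})}$. Notion of solution: Let $T>0$, $s\ge0$, $u_0\in H^s(\mathbf{T})$. A function $u$ is a solution of the Cauchy problem on $[0,T)$ if $u\in L^\infty_{loc}([0,T);H^s(\mathbf{T}))\cap L^3_{loc}([0,T)\times\mathbf{T})$, $\partial_x(|u|^2)\in L^1_{loc}([0,T);H^{-s}(\mathbf{T}))$, and for every $\phi\in C_0^\infty([0,T)\times\mathbf{T})$, $$-\int_0^T\!\!\int_{\mathbf{T}}u\,\partial_t\phi\,dx\,dt-\int_{\mathbf{T}}u_0\phi(0,\cdot)\,dx=\int_0^T\!\!\int_{\mathbf{T}}\big[u(-\alpha_1\partial_x^3\phi+i\alpha_2\partial_x^2\phi)+|u|^2u(i\gamma_1\phi-\gamma_2\partial_x\phi)\big]dx\,dt-i\Gamma\int_0^T\langle\partial_x(|u|^2)(t),u(t)\phi(t)\rangle_{H^{-s},H^s}\,dt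 .$$ A function $u$ is a solution on the closed interval $[0,T]$ if $u\in C([0,T];H^{s}(\mathbf{T}))$ for some $s>1/2$ and $u|_{[0,T)}$ is a solution on $[0,T)$, that is, $u|_{[0,T)}\in L^\infty_{loc}([0,T);H^s(\mathbf{T}))\cap L^3_{loc}([0,T)\times\mathbf{T})$, $\partial_x(|u|^2)\in L^1_{loc}([0,T);H^{-s}(\mathbf{T}))$, and the displayed integral identity holds for every $\phi\in C_0^\infty([0,T)\times\mathbf{T})$. Solutions on $(-T,0]$ and $[-T,0]$ are defined in a similar manner (with test functions in $C_0^\infty((-T,0]\times\mathbf{T})$, time integrals over $(-T,0)$, and the term $-\int_{\mathbf{T}}u_0\phi(0,\cdot)\,dx$ replaced by $+\int_{\mathbf{T}}u_0\phi(0,\cdot)\,dx$). *)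

theory Defs
  imports "HOL-Analysis.Analysis"
begin

(* A function on the torus T = R / 2 pi Z is a 2 pi-periodic function on the reals; integrals over
   T are Lebesgue integrals over one period. *)

definition torus_periodic :: "(real \<Rightarrow> complex) \<Rightarrow> bool" where
  "torus_periodic f \<longleftrightarrow> (\<forall>x. f (x + 2 * pi) = f x)"

definition torus_integral :: "(real \<Rightarrow> complex) \<Rightarrow> complex" where
  "torus_integral f = (LINT x:{0..2*pi}|lebesgue. f x)"

definition fourier :: "(real \<Rightarrow> complex) \<Rightarrow> int \<Rightarrow> complex" where
  "fourier f k = 1 / complex_of_real (sqrt (2 * pi)) *
     torus_integral (\<lambda>x. cis (- (of_int k * x)) * f x)"

definition jap :: "int \<Rightarrow> real" where
  "jap k = 1 + \<bar>of_int k\<bar>"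

text \<open>The weighted \<open>\<ell>\<^sup>2\<close> condition and norm on sequences of Fourier coefficients.\<close>

definition sobolev_summable :: "real \<Rightarrow> (int \<Rightarrow> complex) \<Rightarrow> bool" where
  "sobolev_summable s c \<longleftrightarrow> (\<lambda>k. (jap k powr s * cmod (c k))\<^sup>2) summable_on UNIV"

definition sobolev_norm :: "real \<Rightarrow> (int \<Rightarrow> complex) \<Rightarrow> real" where
  "sobolev_norm s c = sqrt (\<Sum>\<^sub>\<infinity>k. (jap k powr s * cmod (c k))\<^sup>2)"

(* The space H^s(T) for s \<ge> 0, whose elements are (represented by) functions. *)

definition Hs :: "real \<Rightarrow> (real \<Rightarrow> complex) set" where
  "Hs s = {f. torus_periodic f \<and> set_integrable lebesgue {0..2*pi} f \<and>
              sobolev_summable s (fourier f)}"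

section \<open>Periodic distributions\<close>

definition xderiv :: "(real \<Rightarrow> complex) \<Rightarrow> real \<Rightarrow> complex" where
  "xderiv \<psi> = (\<lambda>x. vector_derivative \<psi> (at x))"

definition smooth_torus :: "(real \<Rightarrow> complex) set" where
  "smooth_torus = {\<psi>. torus_periodic \<psi> \<and> (\<forall>n x. (xderiv ^^ n) \<psi> differentiable (at x))}"

type_synonym distr = "(real \<Rightarrow> complex) \<Rightarrow> complex"

(* Continuous linear functionals on C^\<infinity>(T); only the values on smooth_torus are relevant. *)

definition distribution :: "distr \<Rightarrow> bool" where
  "distribution F \<longleftrightarrow>
     (\<forall>\<psi>\<in>smooth_torus. \<forall>\<eta>\<in>smooth_torus. F (\<lambda>x. \<psi> x + \<eta> x) = F \<psi> + F \<eta>) \<and>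
     (\<forall>\<psi>\<in>smooth_torus. \<forall>c. F (\<lambda>x. c * \<psi> x) = c * F \<psi>) \<and>
     (\<exists>C N. \<forall>\<psi>\<in>smooth_torus.
        cmod (F \<psi>) \<le> C * (\<Sum>j\<le>N. SUP x\<in>{0..2*pi}. cmod ((xderiv ^^ j) \<psi> x)))"

definition distr_of :: "(real \<Rightarrow> complex) \<Rightarrow> distr" where
  "distr_of f = (\<lambda>\<psi>. torus_integral (\<lambda>x. f x * \<psi> x))"

definition distr_deriv :: "distr \<Rightarrow> distr" where
  "distr_deriv F = (\<lambda>\<psi>. - F (xderiv \<psi>))"

definition distr_fourier :: "distr \<Rightarrow> int \<Rightarrow> complex" where
  "distr_fourier F k = 1 / complex_of_real (sqrt (2 * pi)) * F (\<lambda>x. cis (- (of_int k * x)))"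

definition Hs_distr :: "real \<Rightarrow> distr set" where
  "Hs_distr \<sigma> = {F. distribution F \<and> sobolev_summable \<sigma> (distr_fourier F)}"

(* The bilinear pairing of H^{-s}(T) with H^s(T): by Parseval it is the continuous extension of
   F, \<psi> \<mapsto> F \<psi> (no complex conjugation) from smooth \<psi> to g in H^s(T). *)

definition pairing :: "distr \<Rightarrow> (real \<Rightarrow> complex) \<Rightarrow> complex" where
  "pairing F g = (\<Sum>\<^sub>\<infinity>k. distr_fourier F k * fourier g (- k))"

section \<open>Function spaces in space-time\<close>

(* J is a time interval, and "loc" refers to compact subsets of J.  Since H^s(T) is separable,
   strong measurability of an H^s-valued map is (Pettis) measurability of all its Fourier
   coefficients. *)

definition Linf_loc_Hs :: "real set \<Rightarrow> real \<Rightarrow> (real \<Rightarrow> real \<Rightarrow> complex) set" where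
  "Linf_loc_Hs J s = {u.
     (\<forall>k. set_borel_measurable lebesgue J (\<lambda>t. fourier (u t) k)) \<and>
     (\<forall>K. compact K \<and> K \<subseteq> J \<longrightarrow>
        (\<exists>C. AE t in lebesgue. t \<in> K \<longrightarrow> u t \<in> Hs s \<and> sobolev_norm s (fourier (u t)) \<le> C))}"

definition L1_loc_Hs_distr :: "real set \<Rightarrow> real \<Rightarrow> (real \<Rightarrow> distr) set" where
  "L1_loc_Hs_distr J \<sigma> = {v.
     (\<forall>k. set_borel_measurable lebesgue J (\<lambda>t. distr_fourier (v t) k)) \<and>
     (AE t in lebesgue. t \<in> J \<longrightarrow> v t \<in> Hs_distr \<sigma>) \<and>
     (\<forall>K. compact K \<and> K \<subseteq> J \<longrightarrow>
        set_integrable lebesgue K (\<lambda>t. sobolev_norm \<sigma> (distr_fourier (v t))))}"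

definition L3_loc :: "real set \<Rightarrow> (real \<Rightarrow> real \<Rightarrow> complex) set" where
  "L3_loc J = {u. \<forall>K. compact K \<and> K \<subseteq> J \<longrightarrow>
     set_borel_measurable lebesgue (K \<times> {0..2*pi}) (\<lambda>(t, x). u t x) \<and>
     set_integrable lebesgue (K \<times> {0..2*pi}) (\<lambda>(t, x). cmod (u t x) ^ 3)}"

definition C_Hs :: "real set \<Rightarrow> real \<Rightarrow> (real \<Rightarrow> real \<Rightarrow> complex) set" where
  "C_Hs J s = {u. (\<forall>t\<in>J. u t \<in> Hs s) \<and>
     (\<forall>t\<^sub>0\<in>J. ((\<lambda>t. sobolev_norm s (fourier (\<lambda>x. u t x - u t\<^sub>0 x))) \<longlongrightarrow> 0) (at t\<^sub>0 within J))}"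

section \<open>Test functions\<close>

definition tderiv :: "(real \<Rightarrow> real \<Rightarrow> complex) \<Rightarrow> real \<Rightarrow> real \<Rightarrow> complex" where
  "tderiv \<phi> = (\<lambda>t x. vector_derivative (\<lambda>\<tau>. \<phi> \<tau> x) (at t))"

primrec Ck :: "nat \<Rightarrow> (real \<Rightarrow> real \<Rightarrow> complex) \<Rightarrow> bool" where
  "Ck 0 \<phi> \<longleftrightarrow> continuous_on UNIV (\<lambda>(t, x). \<phi> t x)"
| "Ck (Suc n) \<phi> \<longleftrightarrow>
     continuous_on UNIV (\<lambda>(t, x). \<phi> t x) \<and>
     (\<forall>t x. (\<lambda>\<tau>. \<phi> \<tau> x) differentiable (at t) \<and> \<phi> t differentiable (at x)) \<and>
     Ck n (tderiv \<phi>) \<and> Ck n (\<lambda>t. xderiv (\<phi> t))"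

(* C_0^\<infinity>(J \<times> T) for a half-open interval J: smoothness up to the closed endpoint of J means that
   the function is the restriction to J of a smooth function on all of R \<times> T; the values outside J
   are irrelevant. *)

definition test_functions :: "real set \<Rightarrow> (real \<Rightarrow> real \<Rightarrow> complex) set" where
  "test_functions J = {\<phi>. (\<forall>n. Ck n \<phi>) \<and> (\<forall>t. torus_periodic (\<phi> t)) \<and>
     (\<exists>K. compact K \<and> K \<subseteq> J \<and> (\<forall>t\<in>J - K. \<forall>x. \<phi> t x = 0))}"

section \<open>Solutions of the Cauchy problem\<close>

definition dx_abs_sq :: "(real \<Rightarrow> complex) \<Rightarrow> distr" where
  "dx_abs_sq f = distr_deriv (distr_of (\<lambda>x. complex_of_real ((cmod (f x))\<^sup>2)))"

(* \<epsilon> is the sign of the initial term: -1 for J = [0,T) and +1 for J = (-T,0]. *)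

definition weak_identity ::
  "real \<Rightarrow> real \<Rightarrow> real \<Rightarrow> real \<Rightarrow> real \<Rightarrow> real set \<Rightarrow> complex \<Rightarrow>
   (real \<Rightarrow> complex) \<Rightarrow> (real \<Rightarrow> real \<Rightarrow> complex) \<Rightarrow> (real \<Rightarrow> real \<Rightarrow> complex) \<Rightarrow> bool" where
  "weak_identity \<alpha>1 \<alpha>2 \<gamma>1 \<gamma>2 \<Gamma> J \<epsilon> u0 u \<phi> \<longleftrightarrow>
     - (LINT t:J|lebesgue. torus_integral (\<lambda>x. u t x * tderiv \<phi> t x))
       + \<epsilon> * torus_integral (\<lambda>x. u0 x * \<phi> 0 x)
     = (LINT t:J|lebesgue. torus_integral (\<lambda>x.
           u t x * (- complex_of_real \<alpha>1 * (xderiv ^^ 3) (\<phi> t) x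
                    + \<i> * complex_of_real \<alpha>2 * (xderiv ^^ 2) (\<phi> t) x)
         + complex_of_real ((cmod (u t x))\<^sup>2) * u t x *
             (\<i> * complex_of_real \<gamma>1 * \<phi> t x - complex_of_real \<gamma>2 * xderiv (\<phi> t) x)))
       - \<i> * complex_of_real \<Gamma> *
         (LINT t:J|lebesgue. pairing (dx_abs_sq (u t)) (\<lambda>x. u t x * \<phi> t x))"

definition solution ::
  "real \<Rightarrow> real \<Rightarrow> real \<Rightarrow> real \<Rightarrow> real \<Rightarrow> real set \<Rightarrow> complex \<Rightarrow> real \<Rightarrow>
   (real \<Rightarrow> complex) \<Rightarrow> (real \<Rightarrow> real \<Rightarrow> complex) \<Rightarrow> bool" where
  "solution \<alpha>1 \<alpha>2 \<gamma>1 \<gamma>2 \<Gamma> J \<epsilon> s u0 u \<longleftrightarrow>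
     u0 \<in> Hs s \<and> u \<in> Linf_loc_Hs J s \<and> u \<in> L3_loc J \<and>
     (\<lambda>t. dx_abs_sq (u t)) \<in> L1_loc_Hs_distr J (- s) \<and>
     (\<forall>\<phi>\<in>test_functions J. weak_identity \<alpha>1 \<alpha>2 \<gamma>1 \<gamma>2 \<Gamma> J \<epsilon> u0 u \<phi>)"

definition solution_forward where
  "solution_forward \<alpha>1 \<alpha>2 \<gamma>1 \<gamma>2 \<Gamma> T u0 u \<longleftrightarrow>
     (\<exists>s>1/2. u \<in> C_Hs {0..T} s \<and> solution \<alpha>1 \<alpha>2 \<gamma>1 \<gamma>2 \<Gamma> {0..<T} (- 1) s u0 u)"

definition solution_backward where
  "solution_backward \<alpha>1 \<alpha>2 \<gamma>1 \<gamma>2 \<Gamma> T u0 u \<longleftrightarrow>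
     (\<exists>s>1/2. u \<in> C_Hs {-T..0} s \<and> solution \<alpha>1 \<alpha>2 \<gamma>1 \<gamma>2 \<Gamma> {-T<..0} 1 s u0 u)"

end

theory Submission
  imports Defs
begin

text \<open>
  With \<open>a k\<close> the Fourier coefficients of \<open>u\<close>, the equation is a cubic system whose sum over
  \<open>k1 - k2 + k3 = k\<close> we parametrize by \<open>k1 = k + m\<close>, \<open>k3 = k + n\<close>, \<open>k2 = k + m + n\<close>.  The phase
  mismatch is \<open>m n (3 \<alpha>1 (k1 + k3) + 2 \<alpha>2)\<close>, which by the hypothesis on \<open>2 \<alpha>2 / (3 \<alpha>1)\<close> vanishes
  only for \<open>m = 0\<close> or \<open>n = 0\<close>.  These resonant terms sum to \<open>\<lambda> (a k)\<close> with
  \<open>Re \<lambda> = \<Gamma> (k M - P) / (2 \<pi>)\<close>, where \<open>M = \<Sum> |a j|\<^sup>2\<close> and \<open>P = \<Sum> j |a j|\<^sup>2\<close>: an elliptic term, growing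
  forward in time for \<open>k > 0\<close> and backward for \<open>k < 0\<close>.  Solving for \<open>a k\<close> backward from a later time by
  Duhamel's formula, every contribution carries the factor \<open>exp (- c k t)\<close>.  Nonresonant terms with two
  frequencies below \<open>k\<^bsup>1/4\<^esup>\<close> oscillate at rate at least \<open>k\<^sup>2\<close> and are integrated by parts in
  time; all others are small by regularity.  Hence \<open>a k (0)\<close> is \<open>O(k\<^bsup>- s - 1/16\<^esup>)\<close>, which
  lacunary data in \<open>H\<^sup>s\<close> violate at both positive and negative frequencies.  Backward solutions reduce
  to forward ones by \<open>(t, x) \<mapsto> (- t, - x)\<close>, which preserves the form of the equation and \<open>\<Gamma>\<close>.
\<close>

section \<open>Trilinear estimates\<close>

text \<open>The obstacle is the derivative in the nonlinearity: at frequency \<open>k\<close> the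
  cubic sum is only O(\<open>jap k powr (1-s)\<close>), one power worse than the solution itself.
  The damping pays for exactly this power, since the time integral of exp(- c k t) is O(1/k); any
  gain beyond \<open>jap k powr (-s)\<close> has to come from elsewhere. With a frequency threshold
  \<open>L\<close>, terms with two frequencies of size at least \<open>L\<close> gain
  \<open>L powr (-(1/4))\<close> through the weight in \<open>wt\<close>, while one integration by
  parts leaves each of the O(L^2) other nonresonant terms at size \<open>jap k powr (-s-1)\<close>.
  The choice L = \<open>jap k powr (1/4)\<close> yields gains k^(-1/16) and k^(-1/2). No
  conservation law enters: continuity keeps the mass positive for a short time, and an arbitrarily
  short interval suffices because exp(- c k T) decays in \<open>k\<close> for fixed
  \<open>T\<close>. For s \<ge> 1 the cubic sums converge absolutely, so the weak formulation yields
  a genuine differential equation for each coefficient.\<close>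

lemma jap_ge_1 [simp]: "1 \<le> jap k"
  by (simp add: jap_def)

lemma jap_not_less_1 [simp]: "\<not> jap k < 1"
  by (simp add: not_less)

lemma jap_pos [simp]: "0 < jap k"
  by (simp add: jap_def add_pos_nonneg)

lemma jap_neq_0 [simp]: "jap k \<noteq> 0"
  by (metis jap_pos less_irrefl)

lemma jap_nonneg [simp]: "0 \<le> jap k"
  by (simp add: jap_def)

lemma jap_minus [simp]: "jap (- k) = jap k"
  by (simp add: jap_def)

text \<open>The exponent 1/4 is a reserve that becomes smallness at high frequency;
  \<open>wt a\<close> remains summable for coefficients of an H^s function with s \<ge> 1, because s
  - 1/4 > 1/2.\<close>

definition wt :: "(int \<Rightarrow> complex) \<Rightarrow> int \<Rightarrow> real" where
  "wt a j = jap j powr (1/4) * cmod (a j)"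

lemma wt_nonneg [simp]: "0 \<le> wt a j"
  by (simp add: wt_def)

lemma norm_le_wt: "cmod (a j) \<le> wt a j"
proof -
  have "1 * cmod (a j) \<le> jap j powr (1/4) * cmod (a j)"
    by (intro mult_right_mono) (auto simp: ge_one_powr_ge_zero)
  then show ?thesis by (simp add: wt_def)
qed

lemma norm_le_wt_high:
  assumes "0 < L" "L \<le> jap j"
  shows "cmod (a j) \<le> L powr (-(1/4)) * wt a j"
proof -
  have "L powr (1/4) * cmod (a j) \<le> wt a j"
    unfolding wt_def using assms by (intro mult_right_mono powr_mono2) auto
  then show ?thesis
    using assms by (simp add: powr_minus field_simps)
qed

text \<open>Chosen for its complement: there, any two of the three frequencies include one of size
  at least \<open>L\<close>. So a high frequency is left over even after the largest one has been
  spent on the derivative.\<close>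

definition low_pairs :: "real \<Rightarrow> int \<Rightarrow> (int \<times> int) set" where
  "low_pairs L k = {(m, n). (jap (k+m) < L \<and> jap (k+m+n) < L) \<or>
     (jap (k+m+n) < L \<and> jap (k+n) < L) \<or> (jap (k+m) < L \<and> jap (k+n) < L)}"

definition pairwt :: "(int \<Rightarrow> complex) \<Rightarrow> int \<Rightarrow> int \<times> int \<Rightarrow> real" where
  "pairwt a k = (\<lambda>(m, n). wt a (k+m) * wt a (k+m+n) + wt a (k+m+n) * wt a (k+n) + wt a (k+m) * wt a (k+n))"

text \<open>The frequency \<open>x\<close> absorbs the derivative factor \<open>c\<close> and
  supplies the decay in \<open>k\<close>: for s \<ge> 1 the function \<open>jap x powr (1-s)\<close>
  is nonincreasing in \<open>jap x\<close>, which is at least \<open>jap k / 3\<close>. Whichever of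
  \<open>y\<close> and \<open>z\<close> is high supplies the negative power of
  \<open>L\<close>.\<close>

lemma trilinear_max:
  assumes B: "\<And>k. jap k powr s * cmod (a k) \<le> B" and s: "s \<ge> 1" and L: "L > 0"
    and x: "jap k \<le> 3 * jap x" and c: "0 \<le> c" "c \<le> 5 * jap x"
    and yz: "L \<le> jap y \<or> L \<le> jap z"
  shows "c * (cmod (a x) * (cmod (a y) * cmod (a z)))
    \<le> (5 * 3 powr (s-1) * B * jap k powr (1-s) * L powr (-(1/4))) * (wt a y * wt a z)"
proof -
  have "c * cmod (a x) \<le> 5 * jap x * cmod (a x)"
    using c by (intro mult_right_mono) auto
  also have "jap x * cmod (a x) = jap x powr (1-s) * (jap x powr s * cmod (a x))"
    by (simp add: powr_add[symmetric] mult.assoc[symmetric])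
  then have "5 * jap x * cmod (a x) = 5 * (jap x powr (1-s) * (jap x powr s * cmod (a x)))" by simp
  also have "\<dots> \<le> 5 * (jap x powr (1-s) * B)"
    using B[of x] by (intro mult_left_mono) auto
  also have "jap x powr (1-s) \<le> (jap k / 3) powr (1-s)"
    using x s by (intro powr_mono2') auto
  also have "(jap k / 3) powr (1-s) = 3 powr (s-1) * jap k powr (1-s)"
    by (simp add: powr_divide powr_diff field_simps)
  finally have 1: "c * cmod (a x) \<le> 5 * (3 powr (s-1) * jap k powr (1-s) * B)"
    using B[of 0] by (simp add: mult_right_mono order_trans[OF _ B[of 0]])
  have 2: "cmod (a y) * cmod (a z) \<le> L powr (-(1/4)) * (wt a y * wt a z)"
    using yz
  proof
    assume "L \<le> jap y"
    then have "cmod (a y) * cmod (a z) \<le> (L powr (-(1/4)) * wt a y) * wt a z"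
      using L by (intro mult_mono norm_le_wt_high norm_le_wt) auto
    then show ?thesis by (simp add: mult_ac)
  next
    assume "L \<le> jap z"
    then have "cmod (a y) * cmod (a z) \<le> wt a y * (L powr (-(1/4)) * wt a z)"
      using L by (intro mult_mono norm_le_wt_high norm_le_wt) auto
    then show ?thesis by (simp add: mult_ac)
  qed
  have "(c * cmod (a x)) * (cmod (a y) * cmod (a z)) \<le>
     (5 * (3 powr (s-1) * jap k powr (1-s) * B)) * (L powr (-(1/4)) * (wt a y * wt a z))"
    using c order_trans[OF _ B[of 0]] by (intro mult_mono[OF 1 2]) auto
  then show ?thesis by (simp add: mult_ac)
qed

text \<open>Since k = (k+m) - (k+m+n) + (k+n), and \<open>n\<close> is a difference of two of these
  frequencies, the largest weight \<open>M\<close> bounds \<open>jap k\<close> by 3 M and |n| by 2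
  M. This is the origin of the factor 5.\<close>

lemma trilinear_pointwise:
  assumes B: "\<And>k. jap k powr s * cmod (a k) \<le> B" and s: "s \<ge> 1" and L: "L > 0"
    and p: "(m, n) \<notin> low_pairs L k"
  shows "(jap k + \<bar>real_of_int n\<bar>) * (cmod (a (k+m)) * (cmod (a (k+m+n)) * cmod (a (k+n))))
    \<le> (5 * 3 powr (s-1) * B * jap k powr (1-s) * L powr (-(1/4))) * pairwt a k (m, n)" 
    (is "?c * _ \<le> ?D * _")
proof -
  let ?x = "k+m" and ?y = "k+m+n" and ?z = "k+n"
  have B0: "0 \<le> B" by (rule order_trans[OF _ B[of 0]]) auto
  have D: "0 \<le> ?D" using B0 by simp
  define M where "M = max (jap ?x) (max (jap ?y) (jap ?z))"
  have k: "jap k \<le> 3 * M" and n: "\<bar>real_of_int n\<bar> \<le> 2 * M"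
  proof -
    have M: "1 + \<bar>real_of_int k + real_of_int m\<bar> \<le> M" "1 + \<bar>real_of_int k + real_of_int m + real_of_int n\<bar> \<le> M"
      "1 + \<bar>real_of_int k + real_of_int n\<bar> \<le> M"
      by (auto simp: M_def jap_def)
    show "jap k \<le> 3 * M" "\<bar>real_of_int n\<bar> \<le> 2 * M"
      using M unfolding jap_def by linarith+
  qed
  have c: "0 \<le> ?c" "?c \<le> 5 * M"
    using k n by (auto intro!: add_nonneg_nonneg order_less_imp_le[OF jap_pos])
  have two: "(L \<le> jap ?x \<and> L \<le> jap ?y) \<or> (L \<le> jap ?y \<and> L \<le> jap ?z) \<or> (L \<le> jap ?x \<and> L \<le> jap ?z)"
    using p unfolding low_pairs_def by auto
  note * = trilinear_max[OF B s L, of k _ ?c]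
  consider "M = jap ?x" | "M = jap ?y" | "M = jap ?z" unfolding M_def by linarith
  then show ?thesis
  proof cases
    case 1
    have "?c * (cmod (a ?x) * (cmod (a ?y) * cmod (a ?z))) \<le> ?D * (wt a ?y * wt a ?z)"
      using k c two unfolding 1 by (intro *) auto
    also have "\<dots> \<le> ?D * pairwt a k (m, n)"
      using D by (intro mult_left_mono) (auto simp: pairwt_def)
    finally show ?thesis .
  next
    case 2
    have "?c * (cmod (a ?y) * (cmod (a ?x) * cmod (a ?z))) \<le> ?D * (wt a ?x * wt a ?z)"
      using k c two unfolding 2 by (intro *) auto
    also have "\<dots> \<le> ?D * pairwt a k (m, n)"
      using D by (intro mult_left_mono) (auto simp: pairwt_def)
    finally show ?thesis by (simp add: mult_ac)
  next
    case 3
    have "?c * (cmod (a ?z) * (cmod (a ?x) * cmod (a ?y))) \<le> ?D * (wt a ?x * wt a ?y)"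
      using k c two unfolding 3 by (intro *) auto
    also have "\<dots> \<le> ?D * pairwt a k (m, n)"
      using D by (intro mult_left_mono) (auto simp: pairwt_def)
    finally show ?thesis by (simp add: mult_ac)
  qed
qed

section \<open>Counting the pairs with two low frequencies\<close>

lemma finite_jap_less: "finite {j. jap j < L}"
proof (rule finite_subset)
  show "{j. jap j < L} \<subseteq> {-\<lceil>L\<rceil>..\<lceil>L\<rceil>}"
    unfolding jap_def by (auto; linarith)
qed auto

lemma card_jap_less:
  assumes "L \<ge> 1" shows "real (card {j. jap j < L}) \<le> 2 * L"
proof -
  have "{j. jap j < L} \<subseteq> {- \<lfloor>L - 1\<rfloor>..\<lfloor>L - 1\<rfloor>}"
    unfolding jap_def by (auto; linarith)
  then have "card {j. jap j < L} \<le> card {- \<lfloor>L - 1\<rfloor>..\<lfloor>L - 1\<rfloor>}"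
    by (intro card_mono) auto
  also have "\<dots> = nat (2 * \<lfloor>L - 1\<rfloor> + 1)" by simp
  finally have "real (card {j. jap j < L}) \<le> real (nat (2 * \<lfloor>L - 1\<rfloor> + 1))" by simp
  also have "\<dots> = of_int (2 * \<lfloor>L - 1\<rfloor> + 1)"
    using assms by simp
  also have "\<dots> \<le> 2 * L" by simp linarith
  finally show ?thesis .
qed

text \<open>Once \<open>k\<close> is fixed, any two of the three frequencies determine
  \<open>(m, n)\<close>, so each of the three alternatives is covered by the image of a square of
  low frequencies.\<close>

lemma low_pairs_subset:
  "low_pairs L k \<subseteq> (\<lambda>(x, y). (x - k, y - x)) ` ({j. jap j < L} \<times> {j. jap j < L})
     \<union> (\<lambda>(y, z). (y - z, z - k)) ` ({j. jap j < L} \<times> {j. jap j < L})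
     \<union> (\<lambda>(x, z). (x - k, z - k)) ` ({j. jap j < L} \<times> {j. jap j < L})" (is "_ \<subseteq> ?f ` _ \<union> ?g ` _ \<union> ?h ` _")
proof
  fix p assume p: "p \<in> low_pairs L k"
  obtain m n where mn: "p = (m, n)" by force
  have "p = ?f (k+m, k+m+n)" "p = ?g (k+m+n, k+n)" "p = ?h (k+m, k+n)"
    by (auto simp: mn)
  then show "p \<in> ?f ` ({j. jap j < L} \<times> {j. jap j < L}) \<union> ?g ` ({j. jap j < L} \<times> {j. jap j < L}) \<union> ?h ` ({j. jap j < L} \<times> {j. jap j < L})"
    using p unfolding low_pairs_def mn by blast
qed

lemma finite_low_pairs [simp]: "finite (low_pairs L k)"
  by (rule finite_subset[OF low_pairs_subset]) (auto intro!: finite_imageI finite_jap_less)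

lemma card_low_pairs:
  assumes "L \<ge> 1" shows "real (card (low_pairs L k)) \<le> 12 * L\<^sup>2"
proof -
  let ?J = "{j. jap j < L}"
  let ?c = "card (?J \<times> ?J)"
  have fin: "finite (?J \<times> ?J)" by (auto intro!: finite_jap_less)
  have "card (low_pairs L k) \<le> card ((\<lambda>(x, y). (x - k, y - x)) ` (?J \<times> ?J)
     \<union> (\<lambda>(y, z). (y - z, z - k)) ` (?J \<times> ?J) \<union> (\<lambda>(x, z). (x - k, z - k)) ` (?J \<times> ?J))"
    using fin by (intro card_mono low_pairs_subset) auto
  also have "\<dots> \<le> (card ((\<lambda>(x, y). (x - k, y - x)) ` (?J \<times> ?J)) + card ((\<lambda>(y, z). (y - z, z - k)) ` (?J \<times> ?J)))
     + card ((\<lambda>(x, z). (x - k, z - k)) ` (?J \<times> ?J))"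
    by (intro order_trans[OF card_Un_le] add_mono card_Un_le order_refl)
  also have "\<dots> \<le> ?c + ?c + ?c"
    using fin by (intro add_mono card_image_le)
  finally have "real (card (low_pairs L k)) \<le> 3 * real ?c" by linarith
  also have "real ?c = real (card ?J) * real (card ?J)" by (simp add: card_cartesian_product)
  also have "\<dots> \<le> (2 * L) * (2 * L)"
    using card_jap_less[OF assms] assms by (intro mult_mono) auto
  finally show ?thesis by (simp add: power2_eq_square)
qed

text \<open>Any two of the three frequencies may replace \<open>(m, n)\<close> as independent
  summation variables; \<open>h\<close> stands for such a change of variables.\<close>

lemma has_sum_product_reindex:
  fixes f :: "int \<Rightarrow> real"
  assumes f: "f summable_on UNIV" and f0: "\<And>x. 0 \<le> f x"
    and h: "bij h"
  shows "((\<lambda>p. f (fst (h p)) * f (snd (h p))) has_sum (infsum f UNIV)\<^sup>2) (UNIV :: (int \<times> int) set)"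
proof -
  have "(f has_sum infsum f UNIV) UNIV" using f by simp
  then have "((\<lambda>y. f x * f y) has_sum f x * infsum f UNIV) UNIV" for x
    by (intro has_sum_cmult_right)
  moreover have "((\<lambda>x. f x * infsum f UNIV) has_sum infsum f UNIV * infsum f UNIV) UNIV"
    using f by (intro has_sum_cmult_left) simp
  moreover have "(\<lambda>(x, y). f x * f y) summable_on Sigma UNIV (\<lambda>_. UNIV)"
    by (rule summable_on_SigmaI[where g = "\<lambda>x. f x * infsum f UNIV"])
       (use calculation in \<open>auto intro!: f0 mult_nonneg_nonneg has_sum_imp_summable\<close>)
  ultimately have "((\<lambda>(x, y). f x * f y) has_sum infsum f UNIV * infsum f UNIV) (Sigma UNIV (\<lambda>_. UNIV))"
    by (intro has_sum_SigmaI) auto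
  then have "((\<lambda>(x, y). f x * f y) has_sum (infsum f UNIV)\<^sup>2) UNIV"
    by (simp add: power2_eq_square)
  then have "((\<lambda>p. (\<lambda>(x, y). f x * f y) (h p)) has_sum (infsum f UNIV)\<^sup>2) UNIV"
    using h by (subst has_sum_reindex_bij_betw) 
  then show ?thesis by (simp add: case_prod_unfold)
qed

lemma pairwt_has_sum:
  assumes "wt a summable_on UNIV"
  shows "(pairwt a k has_sum 3 * (infsum (wt a) UNIV)\<^sup>2) UNIV"
proof -
  have b1: "bij (\<lambda>p::int\<times>int. (k + fst p, k + fst p + snd p))"
    by (rule bij_betw_byWitness[where f'="\<lambda>p. (fst p - k, snd p - fst p)"]) auto
  have b2: "bij (\<lambda>p::int\<times>int. (k + fst p + snd p, k + snd p))"
    by (rule bij_betw_byWitness[where f'="\<lambda>p. (fst p - snd p, snd p - k)"]) auto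
  have b3: "bij (\<lambda>p::int\<times>int. (k + fst p, k + snd p))"
    by (rule bij_betw_byWitness[where f'="\<lambda>p. (fst p - k, snd p - k)"]) auto
  note h = has_sum_product_reindex[OF assms wt_nonneg]
  show ?thesis
    using has_sum_add[OF has_sum_add[OF h[OF b1] h[OF b2]] h[OF b3]]
    by (simp add: pairwt_def case_prod_unfold)
qed

text \<open>This is the form in which an H^s bound enters the estimates: the pointwise decay is
  applied to the factor of largest frequency, the summable weight to the other two.\<close>

definition decaying :: "real \<Rightarrow> real \<Rightarrow> (int \<Rightarrow> complex) \<Rightarrow> bool" where
  "decaying s B a \<longleftrightarrow> (\<forall>k. jap k powr s * cmod (a k) \<le> B) \<and>
     wt a summable_on UNIV \<and> infsum (wt a) UNIV \<le> B"

lemma decayingD: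
  assumes "decaying s B a"
  shows "jap k powr s * cmod (a k) \<le> B" "wt a summable_on UNIV" "infsum (wt a) UNIV \<le> B" "0 \<le> B"
proof -
  show "jap k powr s * cmod (a k) \<le> B" "wt a summable_on UNIV" and B: "infsum (wt a) UNIV \<le> B"
    using assms unfolding decaying_def by auto
  show "0 \<le> B" by (rule order_trans[OF infsum_nonneg B]) auto
qed

text \<open>In the pairing of \<open>k+m\<close> with \<open>k+m+n\<close> the factor |u|^2 carries
  frequency - n, so - i G times i (- n) is the real number - G n. The other two cubic terms
  contribute the imaginary part.\<close>

definition raman_coeff :: "real \<Rightarrow> real \<Rightarrow> real \<Rightarrow> int \<Rightarrow> int \<Rightarrow> complex" where
  "raman_coeff g1 g2 G k n = Complex (- G * of_int n) (g1 + g2 * of_int k)"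

definition raman_term :: "real \<Rightarrow> real \<Rightarrow> real \<Rightarrow> (int \<Rightarrow> complex) \<Rightarrow> int \<Rightarrow> int \<times> int \<Rightarrow> complex" where
  "raman_term g1 g2 G a k = (\<lambda>(m, n). raman_coeff g1 g2 G k n * (a (k+m) * cnj (a (k+m+n)) * a (k+n)))"

lemma norm_raman_coeff:
  "cmod (raman_coeff g1 g2 G k n) \<le> (\<bar>g1\<bar> + \<bar>g2\<bar> + \<bar>G\<bar>) * (jap k + \<bar>real_of_int n\<bar>)"
proof -
  have "cmod (raman_coeff g1 g2 G k n) \<le> \<bar>- G * of_int n\<bar> + \<bar>g1 + g2 * of_int k\<bar>"
    unfolding raman_coeff_def by (metis complex.sel cmod_le)
  also have "\<dots> \<le> \<bar>G\<bar> * \<bar>of_int n\<bar> + (\<bar>g1\<bar> * 1 + \<bar>g2\<bar> * \<bar>of_int k\<bar>)"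
    using abs_triangle_ineq[of g1 "g2 * of_int k"] by (simp add: abs_mult)
  also have "\<dots> \<le> \<bar>G\<bar> * (jap k + \<bar>real_of_int n\<bar>) + (\<bar>g1\<bar> * (jap k + \<bar>real_of_int n\<bar>) + \<bar>g2\<bar> * (jap k + \<bar>real_of_int n\<bar>))"
    by (intro add_mono mult_left_mono) (auto simp: jap_def)
  finally show ?thesis by (simp add: algebra_simps)
qed

text \<open>The factors are the bound for the coefficient, the constant of the pointwise trilinear
  estimate, and the bound for the sum of the three pair weights.\<close>

definition raman_const :: "real \<Rightarrow> real \<Rightarrow> real \<Rightarrow> real \<Rightarrow> real \<Rightarrow> real" where
  "raman_const g1 g2 G s B = (\<bar>g1\<bar> + \<bar>g2\<bar> + \<bar>G\<bar>) * (5 * 3 powr (s-1) * B) * (3 * B\<^sup>2)"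

lemma raman_const_nonneg: "0 \<le> B \<Longrightarrow> 0 \<le> raman_const g1 g2 G s B"
  by (simp add: raman_const_def)

lemma norm_raman_term:
  assumes a: "decaying s B a" and s: "s \<ge> 1" and L: "L > 0" and p: "p \<notin> low_pairs L k"
  shows "cmod (raman_term g1 g2 G a k p) \<le>
    (\<bar>g1\<bar> + \<bar>g2\<bar> + \<bar>G\<bar>) * (5 * 3 powr (s-1) * B * jap k powr (1-s) * L powr (-(1/4))) * pairwt a k p"
proof -
  obtain m n where mn: "p = (m, n)" by force
  have "cmod (raman_term g1 g2 G a k p) = cmod (raman_coeff g1 g2 G k n) *
      (cmod (a (k+m)) * (cmod (a (k+m+n)) * cmod (a (k+n))))"
    by (simp add: raman_term_def mn norm_mult)
  also have "\<dots> \<le> ((\<bar>g1\<bar> + \<bar>g2\<bar> + \<bar>G\<bar>) * (jap k + \<bar>real_of_int n\<bar>)) *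
      (cmod (a (k+m)) * (cmod (a (k+m+n)) * cmod (a (k+n))))"
    by (intro mult_right_mono norm_raman_coeff) auto
  also have "\<dots> = (\<bar>g1\<bar> + \<bar>g2\<bar> + \<bar>G\<bar>) * ((jap k + \<bar>real_of_int n\<bar>) *
      (cmod (a (k+m)) * (cmod (a (k+m+n)) * cmod (a (k+n)))))" by (simp add: mult.assoc)
  also have "\<dots> \<le> (\<bar>g1\<bar> + \<bar>g2\<bar> + \<bar>G\<bar>) * ((5 * 3 powr (s-1) * B * jap k powr (1-s) * L powr (-(1/4))) * pairwt a k p)"
    unfolding mn using p decayingD[OF a] s L
    by (intro mult_left_mono trilinear_pointwise) (auto simp: mn)
  finally show ?thesis by (simp add: mult.assoc)
qed

text \<open>At \<open>L\<close> = 1 no frequency is low, so every estimate off the low pairs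
  specializes to an estimate of the whole sum.\<close>

lemma low_pairs_1 [simp]: "low_pairs 1 k = {}"
  by (auto simp: low_pairs_def)

lemma raman_term_abs_summable:
  assumes a: "decaying s B a" and s: "s \<ge> 1"
  shows "(\<lambda>p. cmod (raman_term g1 g2 G a k p)) summable_on S"
proof (rule Infinite_Sum.abs_summable_on_comparison_test')
  show "(\<lambda>p. (\<bar>g1\<bar> + \<bar>g2\<bar> + \<bar>G\<bar>) * (5 * 3 powr (s-1) * B * jap k powr (1-s) * 1 powr (-(1/4))) * pairwt a k p) summable_on S"
    by (rule summable_on_subset_banach[OF summable_on_cmult_right[OF has_sum_imp_summable[OF pairwt_has_sum[OF decayingD(2)[OF a]]]]]) simp
  show "cmod (raman_term g1 g2 G a k p) \<le> (\<bar>g1\<bar> + \<bar>g2\<bar> + \<bar>G\<bar>) * (5 * 3 powr (s-1) * B * jap k powr (1-s) * 1 powr (-(1/4))) * pairwt a k p" for p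
    by (rule norm_raman_term[OF a s]) auto
qed

lemma raman_term_summable:
  assumes a: "decaying s B a" and s: "s \<ge> 1"
  shows "raman_term g1 g2 G a k summable_on S"
  using raman_term_abs_summable[OF assms] by (rule abs_summable_summable)

lemma raman_tail:
  assumes a: "decaying s B a" and s: "s \<ge> 1" and L: "L > 0" and S: "S \<inter> low_pairs L k = {}"
  shows "cmod (infsum (raman_term g1 g2 G a k) S) \<le> raman_const g1 g2 G s B * jap k powr (1-s) * L powr (-(1/4))"
proof -
  let ?D = "(\<bar>g1\<bar> + \<bar>g2\<bar> + \<bar>G\<bar>) * (5 * 3 powr (s-1) * B * jap k powr (1-s) * L powr (-(1/4)))"
  note B0 = decayingD(4)[OF a] note ps = pairwt_has_sum[OF decayingD(2)[OF a], of k]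
  have su: "pairwt a k summable_on S"
    by (rule summable_on_subset_banach[OF has_sum_imp_summable[OF ps]]) simp
  have "cmod (infsum (raman_term g1 g2 G a k) S) \<le> infsum (\<lambda>p. cmod (raman_term g1 g2 G a k p)) S"
    by (rule norm_infsum_bound[OF raman_term_abs_summable[OF a s]])
  also have "\<dots> \<le> infsum (\<lambda>p. ?D * pairwt a k p) S"
    using S by (intro infsum_mono raman_term_abs_summable[OF a s] norm_raman_term[OF a s L] summable_on_cmult_right su) auto
  also have "\<dots> = ?D * infsum (pairwt a k) S"
    by (rule infsum_cmult_right) (use su in simp)
  also have "\<dots> \<le> ?D * infsum (pairwt a k) UNIV"
    using B0 su has_sum_imp_summable[OF ps]
    by (intro mult_left_mono infsum_mono2) (auto simp: pairwt_def)
  also have "\<dots> = ?D * (3 * (infsum (wt a) UNIV)\<^sup>2)" by (simp add: infsumI[OF ps])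
  also have "\<dots> \<le> ?D * (3 * B\<^sup>2)"
    using B0 decayingD(3)[OF a] by (intro mult_left_mono power_mono infsum_nonneg) auto
  finally show ?thesis by (simp add: raman_const_def mult_ac)
qed

lemma raman_sum_bound:
  assumes a: "decaying s B a" and s: "s \<ge> 1"
  shows "cmod (infsum (raman_term g1 g2 G a k) S) \<le> raman_const g1 g2 G s B * jap k powr (1-s)"
  using raman_tail[OF assms, of 1 S k g1 g2 G] by simp

section \<open>Continuity in time of infinite sums\<close>

lemma tendsto_powr_neg_quarter: "((\<lambda>L. c * L powr (-(1/4))) \<longlongrightarrow> 0) (at_top :: real filter)"
  by (rule tendsto_mult_right_zero, rule tendsto_neg_powr) (auto intro: filterlim_ident)

text \<open>The tail bound does not depend on \<open>t\<close>, so the finite sums over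
  \<open>S \<inter> F L\<close> converge uniformly as \<open>L\<close> tends to infinity, and
  continuity passes to the limit.\<close>

lemma continuous_on_infsum_tail:
  fixes f :: "'t::topological_space \<Rightarrow> 'i \<Rightarrow> 'b::banach"
  assumes su: "\<And>t. t \<in> X \<Longrightarrow> f t summable_on S"
    and fin: "\<And>L. finite (F L)"
    and tail: "\<And>t L. t \<in> X \<Longrightarrow> L > 0 \<Longrightarrow> norm (infsum (f t) (S - F L)) \<le> c * L powr (-(1/4))"
    and cont: "\<And>p. continuous_on X (\<lambda>t. f t p)"
  shows "continuous_on X (\<lambda>t. infsum (f t) S)"
proof (rule uniform_limit_theorem)
  show "uniform_limit X (\<lambda>L t. sum (f t) (S \<inter> F L)) (\<lambda>t. infsum (f t) S) (at_top :: real filter)"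
    unfolding uniform_limit_iff
  proof (intro allI impI)
    fix e :: real assume "e > 0"
    then have "\<forall>\<^sub>F L in at_top. c * L powr (-(1/4)) < e"
      using tendsto_powr_neg_quarter by (rule order_tendstoD(2)[rotated])
    moreover have "\<forall>\<^sub>F L in at_top. (0::real) < L" by (rule eventually_gt_at_top)
    ultimately show "\<forall>\<^sub>F L in at_top. \<forall>t\<in>X. dist (sum (f t) (S \<inter> F L)) (infsum (f t) S) < e"
    proof eventually_elim
      case (elim L)
      show ?case
      proof
        fix t assume t: "t \<in> X"
        have "infsum (f t) ((S \<inter> F L) \<union> (S - F L)) = infsum (f t) (S \<inter> F L) + infsum (f t) (S - F L)"
          using fin[of L] by (intro infsum_Un_disjoint summable_on_subset_banach[OF su[OF t]]) auto
        moreover have "(S \<inter> F L) \<union> (S - F L) = S" by auto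
        ultimately have "infsum (f t) S - sum (f t) (S \<inter> F L) = infsum (f t) (S - F L)"
          using fin[of L] by simp
        then show "dist (sum (f t) (S \<inter> F L)) (infsum (f t) S) < e"
          using tail[OF t, of L] elim by (simp add: dist_norm norm_minus_commute)
      qed
    qed
  qed
  show "\<forall>\<^sub>F L in at_top. continuous_on X (\<lambda>t. sum (f t) (S \<inter> F L))"
    by (intro always_eventually allI continuous_on_sum cont)
qed simp

lemma continuous_on_raman_sum:
  assumes a: "\<And>t. t \<in> X \<Longrightarrow> decaying s B (a t)" and s: "s \<ge> 1"
    and cont: "\<And>k. continuous_on X (\<lambda>t. a t k)"
  shows "continuous_on X (\<lambda>t. infsum (raman_term g1 g2 G (a t) k) S)"
proof (rule continuous_on_infsum_tail[where F = "\<lambda>L. low_pairs L k"])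
  show "cmod (infsum (raman_term g1 g2 G (a t) k) (S - low_pairs L k)) \<le>
    (raman_const g1 g2 G s B * jap k powr (1-s)) * L powr (-(1/4))" if "t \<in> X" "L > 0" for t L
    using that by (intro raman_tail a s) auto
  show "continuous_on X (\<lambda>t. raman_term g1 g2 G (a t) k p)" for p
    by (cases p) (auto simp: raman_term_def intro!: continuous_intros cont)
qed (use raman_term_summable[OF a s] in auto)

text \<open>One factor \<open>a j\<close> absorbs the weight \<open>w j\<close> because s \<ge> 1,
  the other yields the negative power of \<open>L\<close>. The weights of interest are 1 for the
  mass and \<open>j\<close> for the momentum.\<close>

lemma norm_quadratic_term:
  fixes w :: "int \<Rightarrow> real"
  assumes a: "decaying s B a" and s: "s \<ge> 1" and w: "\<And>j. \<bar>w j\<bar> \<le> jap j" and L: "L > 0" "L \<le> jap j"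
  shows "\<bar>w j * (cmod (a j))\<^sup>2\<bar> \<le> B * L powr (-(1/4)) * wt a j"
proof -
  have "jap j powr 1 \<le> jap j powr s" using s by (intro powr_mono) auto
  then have "jap j * cmod (a j) \<le> jap j powr s * cmod (a j)"
    by (intro mult_right_mono) auto
  also have "\<dots> \<le> B" by (rule decayingD[OF a])
  finally have 1: "jap j * cmod (a j) \<le> B" .
  have "\<bar>w j * (cmod (a j))\<^sup>2\<bar> = (\<bar>w j\<bar> * cmod (a j)) * cmod (a j)"
    by (simp add: abs_mult power2_eq_square)
  also have "\<dots> \<le> (jap j * cmod (a j)) * (L powr (-(1/4)) * wt a j)"
    using w L norm_le_wt_high[OF L] by (intro mult_mono) auto
  also have "\<dots> \<le> B * (L powr (-(1/4)) * wt a j)"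
    using 1 by (intro mult_right_mono) auto
  finally show ?thesis by simp
qed

lemma quadratic_sum:
  fixes w :: "int \<Rightarrow> real"
  assumes a: "decaying s B a" and s: "s \<ge> 1" and w: "\<And>j. \<bar>w j\<bar> \<le> jap j"
  shows quadratic_summable: "(\<lambda>j. w j * (cmod (a j))\<^sup>2) summable_on S"
    and quadratic_tail: "L > 0 \<Longrightarrow> \<bar>infsum (\<lambda>j. w j * (cmod (a j))\<^sup>2) (S - {j. jap j < L})\<bar> \<le> B\<^sup>2 * L powr (-(1/4))"
    and quadratic_bound: "\<bar>infsum (\<lambda>j. w j * (cmod (a j))\<^sup>2) S\<bar> \<le> B\<^sup>2"
proof -
  let ?f = "\<lambda>j. w j * (cmod (a j))\<^sup>2"
  note B0 = decayingD(4)[OF a]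
  have su: "wt a summable_on S'" for S' by (rule summable_on_subset_banach[OF decayingD(2)[OF a]]) simp
  have as: "(\<lambda>j. norm (?f j)) summable_on S'" for S'
  proof (rule Infinite_Sum.abs_summable_on_comparison_test')
    show "(\<lambda>j. B * 1 powr (-(1/4)) * wt a j) summable_on S'"
      by (intro summable_on_cmult_right su)
    show "norm (?f j) \<le> B * 1 powr (-(1/4)) * wt a j" for j
      using norm_quadratic_term[OF a s w, of 1 j] by simp
  qed
  then show "?f summable_on S" by (rule abs_summable_summable)
  show tail: "\<bar>infsum ?f (S - {j. jap j < L})\<bar> \<le> B\<^sup>2 * L powr (-(1/4))" if L: "L > 0" for L
  proof -
    let ?S = "S - {j. jap j < L}"
    have "norm (infsum ?f ?S) \<le> infsum (\<lambda>j. norm (?f j)) ?S" by (rule norm_infsum_bound[OF as])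
    also have "\<dots> \<le> infsum (\<lambda>j. B * L powr (-(1/4)) * wt a j) ?S"
      using norm_quadratic_term[OF a s w L] by (intro infsum_mono as summable_on_cmult_right su) auto
    also have "\<dots> = B * L powr (-(1/4)) * infsum (wt a) ?S"
      by (rule infsum_cmult_right) (use su in simp)
    also have "\<dots> \<le> B * L powr (-(1/4)) * infsum (wt a) UNIV"
      using B0 by (intro mult_left_mono infsum_mono2 su) auto
    also have "\<dots> \<le> B * L powr (-(1/4)) * B"
      using B0 decayingD(3)[OF a] by (intro mult_left_mono) auto
    finally show ?thesis by (simp add: power2_eq_square mult_ac)
  qed
  have "S - {j. jap j < 1} = S" by auto
  with tail[of 1] show "\<bar>infsum ?f S\<bar> \<le> B\<^sup>2" by simp
qed

lemma continuous_on_quadratic_sum: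
  fixes w :: "int \<Rightarrow> real"
  assumes a: "\<And>t. t \<in> X \<Longrightarrow> decaying s B (a t)" and s: "s \<ge> 1" and w: "\<And>j. \<bar>w j\<bar> \<le> jap j"
    and cont: "\<And>k. continuous_on X (\<lambda>t. a t k)"
  shows "continuous_on X (\<lambda>t. infsum (\<lambda>j. w j * (cmod (a t j))\<^sup>2) UNIV)"
proof (rule continuous_on_infsum_tail[where F = "\<lambda>L. {j. jap j < L}"])
  show "norm (infsum (\<lambda>j. w j * (cmod (a t j))\<^sup>2) (UNIV - {j. jap j < L})) \<le> B\<^sup>2 * L powr (-(1/4))"
    if "t \<in> X" "L > 0" for t L
    using quadratic_tail[OF a s w] that by simp
qed (use quadratic_summable[OF a s w] in \<open>auto intro!: finite_jap_less continuous_intros cont\<close>)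

section \<open>Mass, momentum and the resonant terms\<close>

definition mass :: "(int \<Rightarrow> complex) \<Rightarrow> real" where
  "mass a = infsum (\<lambda>j. (cmod (a j))\<^sup>2) UNIV"

definition momentum :: "(int \<Rightarrow> complex) \<Rightarrow> real" where
  "momentum a = infsum (\<lambda>j. of_int j * (cmod (a j))\<^sup>2) UNIV"

definition resonant_rate :: "real \<Rightarrow> real \<Rightarrow> real \<Rightarrow> (int \<Rightarrow> complex) \<Rightarrow> int \<Rightarrow> complex" where
  "resonant_rate g1 g2 G a k = Complex (G * (of_int k * mass a - momentum a))
     ((g1 + g2 * of_int k) * (2 * mass a - (cmod (a k))\<^sup>2))"

lemma
  assumes a: "decaying s B a" and s: "s \<ge> 1"
  shows mass_has_sum: "((\<lambda>j. (cmod (a j))\<^sup>2) has_sum mass a) UNIV"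
    and momentum_has_sum: "((\<lambda>j. of_int j * (cmod (a j))\<^sup>2) has_sum momentum a) UNIV"
    and mass_bound: "\<bar>mass a\<bar> \<le> B\<^sup>2" and momentum_bound: "\<bar>momentum a\<bar> \<le> B\<^sup>2"
  using quadratic_summable[OF a s, of "\<lambda>_. 1" UNIV] quadratic_bound[OF a s, of "\<lambda>_. 1" UNIV]
    quadratic_summable[OF a s, of of_int UNIV] quadratic_bound[OF a s, of of_int UNIV]
  by (auto simp: mass_def momentum_def jap_def)

text \<open>On the line n = 0 the coefficient is purely imaginary. On the line m = 0 its real part
  is - G n = G k - G (k + n), which sums against |a (k+n)|^2 to G (k M - P). The two lines share (0,
  0); the coefficient there is purely imaginary, so removing the double count changes only the
  imaginary part of the rate.\<close>

lemma resonant_sum: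
  assumes a: "decaying s B a" and s: "s \<ge> 1"
  shows "infsum (raman_term g1 g2 G a k) {(m, n). m = 0 \<or> n = 0} = resonant_rate g1 g2 G a k * a k"
proof -
  let ?g = "g1 + g2 * of_int k" and ?f = "raman_term g1 g2 G a k"
  have bij: "bij (\<lambda>j. k + j)" by (rule bij_betw_byWitness[where f'="\<lambda>j. j - k"]) auto
  have M: "((\<lambda>m. (cmod (a (k+m)))\<^sup>2) has_sum mass a) UNIV"
    using has_sum_reindex_bij_betw[OF bij, of "\<lambda>j. (cmod (a j))\<^sup>2"] mass_has_sum[OF a s] by simp
  have P: "((\<lambda>m. of_int (k+m) * (cmod (a (k+m)))\<^sup>2) has_sum momentum a) UNIV"
    using has_sum_reindex_bij_betw[OF bij, of "\<lambda>j. of_int j * (cmod (a j))\<^sup>2"] momentum_has_sum[OF a s] by simp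
  have sq: "(complex_of_real (cmod z))\<^sup>2 = z * cnj z" for z
    using complex_norm_square[of z] by simp
  have 1: "((\<lambda>m. (\<i> * ?g * a k) * complex_of_real ((cmod (a (k+m)))\<^sup>2)) has_sum (\<i> * ?g * a k) * of_real (mass a)) UNIV"
    by (intro has_sum_cmult_right has_sum_of_real M)
  have "?f \<circ> (\<lambda>m. (m, 0)) = (\<lambda>m. (\<i> * ?g * a k) * complex_of_real ((cmod (a (k+m)))\<^sup>2))"
    by (rule ext) (simp add: raman_term_def raman_coeff_def Complex_eq sq mult_ac)
  with 1 have row: "(?f has_sum (\<i> * ?g * a k) * of_real (mass a)) ((\<lambda>m. (m, 0)) ` UNIV)"
    by (subst has_sum_reindex) (simp_all add: inj_on_def)
  have 2: "((\<lambda>n. (of_real (G * of_int k) + \<i> * ?g) * a k * complex_of_real ((cmod (a (k+n)))\<^sup>2) + - ((of_real G * a k) * complex_of_real (of_int (k+n) * (cmod (a (k+n)))\<^sup>2)))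
     has_sum (of_real (G * of_int k) + \<i> * ?g) * a k * of_real (mass a) + - ((of_real G * a k) * of_real (momentum a))) UNIV"
    by (intro has_sum_add has_sum_uminusI has_sum_cmult_right has_sum_of_real M P)
  have "?f \<circ> (\<lambda>n. (0, n)) = (\<lambda>n. (of_real (G * of_int k) + \<i> * ?g) * a k * complex_of_real ((cmod (a (k+n)))\<^sup>2) + - ((of_real G * a k) * complex_of_real (of_int (k+n) * (cmod (a (k+n)))\<^sup>2)))"
    by (rule ext) (simp add: raman_term_def raman_coeff_def Complex_eq sq algebra_simps)
  with 2 have "(?f has_sum (of_real (G * of_int k) + \<i> * ?g) * a k * of_real (mass a) + - ((of_real G * a k) * of_real (momentum a))) ((\<lambda>n. (0, n)) ` UNIV)"
    by (subst has_sum_reindex) (simp_all add: inj_on_def)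
  moreover have "(?f has_sum (\<i> * ?g * a k) * of_real ((cmod (a k))\<^sup>2)) {(0, 0)}"
    by (rule has_sum_finiteI) (auto simp: raman_term_def raman_coeff_def Complex_eq sq mult_ac)
  ultimately have "(?f has_sum ((of_real (G * of_int k) + \<i> * ?g) * a k * of_real (mass a) + - ((of_real G * a k) * of_real (momentum a)))
      - (\<i> * ?g * a k) * of_real ((cmod (a k))\<^sup>2)) ((\<lambda>n. (0, n)) ` UNIV - {(0, 0)})"
    by (intro has_sum_Diff) auto
  then have "(?f has_sum (\<i> * ?g * a k) * of_real (mass a) + (((of_real (G * of_int k) + \<i> * ?g) * a k * of_real (mass a) + - ((of_real G * a k) * of_real (momentum a)))
      - (\<i> * ?g * a k) * of_real ((cmod (a k))\<^sup>2))) ((\<lambda>m. (m, 0)) ` UNIV \<union> ((\<lambda>n. (0, n)) ` UNIV - {(0, 0)}))"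
    using row by (intro has_sum_Un_disjoint) auto
  moreover have "(\<lambda>m. (m, 0)) ` UNIV \<union> ((\<lambda>n. (0, n)) ` UNIV - {(0, 0)}) = {(m::int, n::int). m = 0 \<or> n = 0}"
    by auto
  ultimately show ?thesis
    by (auto simp: resonant_rate_def Complex_eq sq algebra_simps dest!: infsumI)
qed

section \<open>Oscillatory integrals and resonances\<close>

text \<open>The bound is independent of \<open>T\<close>. With a rate \<open>c\<close> proportional
  to \<open>k\<close>, the quotient returns the power of \<open>k\<close> lost to the
  derivative.\<close>

lemma norm_integral_exp_decay:
  fixes f :: "real \<Rightarrow> 'a::euclidean_space"
  assumes "0 \<le> T" "c > 0" "f integrable_on {0..T}" "\<And>t. t \<in> {0..T} \<Longrightarrow> norm (f t) \<le> A * exp (- c * t)" "0 \<le> A"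
  shows "norm (integral {0..T} f) \<le> A / c"
proof -
  have "((\<lambda>t. A * exp (- c * t)) has_integral (- A / c * exp (- c * T) - (- A / c * exp (- c * 0)))) {0..T}"
    using assms(1,2)
    by (intro fundamental_theorem_of_calculus)
       (auto intro!: derivative_eq_intros simp flip: has_real_derivative_iff_has_vector_derivative)
  then have *: "((\<lambda>t. A * exp (- c * t)) has_integral (A / c - A / c * exp (- c * T))) {0..T}" by simp
  have "norm (integral {0..T} f) \<le> integral {0..T} (\<lambda>t. A * exp (- c * t))"
    using assms * by (intro integral_norm_bound_integral) auto
  also have "\<dots> = A / c - A / c * exp (- c * T)" using * by (rule integral_unique)
  also have "\<dots> \<le> A / c" using assms by simp
  finally show ?thesis .
qed

lemma has_vector_derivative_cis:
  "((\<lambda>t. cis (r * t)) has_vector_derivative (\<i> * of_real r * cis (r * t))) (at t within S)"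
  unfolding cis_conv_exp
  by (auto intro!: derivative_eq_intros has_vector_derivative_real_field simp: mult_ac)

text \<open>One integration by parts against a primitive of \<open>cis (r * t)\<close>: the two
  boundary terms give \<open>2 * A\<close>, and the exponential decay of \<open>h'\<close> bounds
  the remaining integral by \<open>A' / c\<close>, whatever the length of the interval.\<close>

lemma oscillatory_integral:
  fixes h h' :: "real \<Rightarrow> complex"
  assumes T: "0 \<le> T" and r: "r \<noteq> 0" and c: "c > 0"
    and h: "\<And>t. t \<in> {0..T} \<Longrightarrow> (h has_vector_derivative h' t) (at t within {0..T})"
    and cont: "continuous_on {0..T} h'"
    and A: "\<And>t. t \<in> {0..T} \<Longrightarrow> cmod (h t) \<le> A"
    and A': "\<And>t. t \<in> {0..T} \<Longrightarrow> cmod (h' t) \<le> A' * exp (- c * t)" "0 \<le> A'"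
  shows "cmod (integral {0..T} (\<lambda>t. cis (r * t) * h t)) \<le> (2 * A + A' / c) / \<bar>r\<bar>"
proof -
  have conth: "continuous_on {0..T} h"
    using h by (meson continuous_on_eq_continuous_within has_vector_derivative_continuous)
  have contc: "continuous_on {0..T} (\<lambda>t. cis (r * t))" by (intro continuous_intros)
  let ?F = "\<lambda>t. cis (r * t) * h t / (\<i> * of_real r)"
  let ?g = "\<lambda>t. cis (r * t) * h' t"
  have ig: "?g integrable_on {0..T}" by (intro integrable_continuous_interval continuous_intros contc cont)
  have ih: "(\<lambda>t. cis (r * t) * h t) integrable_on {0..T}" by (intro integrable_continuous_interval continuous_intros contc conth)
  have "((\<lambda>t. (cis (r * t) * h' t + \<i> * of_real r * cis (r * t) * h t) / (\<i> * of_real r)) has_integral (?F T - ?F 0)) {0..T}"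
    using T by (intro fundamental_theorem_of_calculus has_vector_derivative_divide has_vector_derivative_mult has_vector_derivative_cis h)
  then have 1: "integral {0..T} (\<lambda>t. (cis (r * t) * h' t + \<i> * of_real r * cis (r * t) * h t) / (\<i> * of_real r)) = ?F T - ?F 0"
    by (rule integral_unique)
  have "(\<lambda>t. (cis (r * t) * h' t + \<i> * of_real r * cis (r * t) * h t) / (\<i> * of_real r))
      = (\<lambda>t. ?g t / (\<i> * of_real r) + cis (r * t) * h t)"
    using r by (auto simp: field_simps)
  with 1 have "integral {0..T} (\<lambda>t. ?g t / (\<i> * of_real r) + cis (r * t) * h t) = ?F T - ?F 0" by simp
  then have "integral {0..T} ?g / (\<i> * of_real r) + integral {0..T} (\<lambda>t. cis (r * t) * h t) = ?F T - ?F 0"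
    using ih by (subst (asm) integral_add) (simp_all only: divide_inverse integrable_on_mult_left[OF ig] integral_mult_left)
  then have "integral {0..T} (\<lambda>t. cis (r * t) * h t) = ?F T - ?F 0 - integral {0..T} ?g / (\<i> * of_real r)"
    by (simp add: algebra_simps)
  also have "cmod \<dots> \<le> (cmod (?F T) + cmod (?F 0)) + cmod (integral {0..T} ?g / (\<i> * of_real r))"
    by (intro order_trans[OF norm_triangle_ineq4] add_mono norm_triangle_ineq4 order_refl)
  also have "\<dots> \<le> (A / \<bar>r\<bar> + A / \<bar>r\<bar>) + (A' / c) / \<bar>r\<bar>"
  proof (intro add_mono)
    show "cmod (?F T) \<le> A / \<bar>r\<bar>" "cmod (?F 0) \<le> A / \<bar>r\<bar>"
      using A[of T] A[of 0] T r by (auto simp: norm_divide norm_mult divide_right_mono)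
    have "cmod (integral {0..T} ?g) \<le> A' / c"
      by (rule norm_integral_exp_decay[OF T c ig]) (use A' in \<open>auto simp: norm_mult\<close>)
    then have "cmod (integral {0..T} ?g) / \<bar>r\<bar> \<le> (A' / c) / \<bar>r\<bar>" by (rule divide_right_mono) simp
    then show "cmod (integral {0..T} ?g / (\<i> * of_real r)) \<le> (A' / c) / \<bar>r\<bar>"
      by (simp add: norm_divide norm_mult)
  qed
  finally show ?thesis by (simp add: add_divide_distrib)
qed

section \<open>The dispersion relation and lower bounds for the phase mismatch\<close>

definition phase :: "real \<Rightarrow> real \<Rightarrow> int \<Rightarrow> real" where
  "phase \<alpha>1 \<alpha>2 k = \<alpha>1 * of_int k ^ 3 + \<alpha>2 * of_int k ^ 2"

lemma phase_resonance:
  "phase \<alpha>1 \<alpha>2 k - phase \<alpha>1 \<alpha>2 (k+m) + phase \<alpha>1 \<alpha>2 (k+m+n) - phase \<alpha>1 \<alpha>2 (k+n)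
    = of_int m * of_int n * (3 * \<alpha>1 * of_int (2*k+m+n) + 2 * \<alpha>2)"
  unfolding phase_def by (simp add: algebra_simps power3_eq_cube power2_eq_square)

text \<open>A number that is not an integer has positive distance \<open>d\<close> from the
  integers; multiplying by 3 |\<alpha>1| turns this distance for \<open>q\<close> into the
  gap.\<close>

lemma phase_gap:
  fixes \<alpha>1 \<alpha>2 :: real
  assumes "\<alpha>1 \<noteq> 0" "2 * \<alpha>2 / (3 * \<alpha>1) \<notin> \<int>"
  obtains c where "c > 0" "\<And>j::int. c \<le> \<bar>3 * \<alpha>1 * of_int j + 2 * \<alpha>2\<bar>"
proof -
  define q where "q = 2 * \<alpha>2 / (3 * \<alpha>1)"
  define d where "d = min (frac q) (1 - frac q)"
  have "frac q \<noteq> 0" using assms by (simp add: q_def)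
  then have "0 < frac q" "frac q < 1" using frac_lt_1[of q] frac_ge_0[of q] by linarith+
  then have d: "d > 0" by (simp add: d_def)
  have *: "d \<le> \<bar>of_int j + q\<bar>" for j :: int
  proof (cases "j + \<lfloor>q\<rfloor> \<ge> 0")
    case True
    then have "real_of_int (j + \<lfloor>q\<rfloor>) \<ge> 0" by linarith
    then show ?thesis unfolding d_def frac_def by simp
  next
    case False
    then have "real_of_int (j + \<lfloor>q\<rfloor>) \<le> -1" by linarith
    then show ?thesis unfolding d_def frac_def by simp
  qed
  have "3 * \<bar>\<alpha>1\<bar> * d \<le> \<bar>3 * \<alpha>1 * of_int j + 2 * \<alpha>2\<bar>" for j :: int
  proof -
    have "3 * \<alpha>1 * of_int j + 2 * \<alpha>2 = 3 * \<alpha>1 * (of_int j + q)"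
      using assms(1) by (simp add: q_def field_simps)
    then have "\<bar>3 * \<alpha>1 * of_int j + 2 * \<alpha>2\<bar> = 3 * \<bar>\<alpha>1\<bar> * \<bar>of_int j + q\<bar>" by (simp add: abs_mult)
    then show ?thesis using * by (simp add: mult_left_mono)
  qed
  then show ?thesis using d assms(1) by (intro that[of "3 * \<bar>\<alpha>1\<bar> * d"]) auto
qed

text \<open>If \<open>k+m+n\<close> is low, then 2k+m+n = k + (k+m+n) is comparable to
  \<open>k\<close>, and the other low frequency makes \<open>m\<close> or \<open>n\<close>
  comparable to \<open>k\<close>. If \<open>k+m\<close> and \<open>k+n\<close> are low, both
  \<open>m\<close> and \<open>n\<close> are comparable to \<open>k\<close>, but 2k+m+n is a sum of
  two low frequencies and may be small; only the gap \<open>c\<close> keeps the last factor away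
  from zero.\<close>

lemma phase_lower_bound:
  fixes \<alpha>1 \<alpha>2 :: real and k m n :: int
  assumes gap: "\<And>j::int. c \<le> \<bar>3 * \<alpha>1 * of_int j + 2 * \<alpha>2\<bar>" "c > 0"
    and L: "6 * L \<le> of_int k" "1 \<le> L" and k: "4 * \<bar>\<alpha>2\<bar> \<le> \<bar>\<alpha>1\<bar> * of_int k"
    and mn: "(m, n) \<in> low_pairs L k" "m \<noteq> 0" "n \<noteq> 0"
  shows "min (\<bar>\<alpha>1\<bar> / 2) (c / 4) * (of_int k)\<^sup>2 \<le> \<bar>of_int m * of_int n * (3 * \<alpha>1 * of_int (2*k+m+n) + 2 * \<alpha>2)\<bar>"
    (is "?d * _ \<le> \<bar>_ * _ * ?f\<bar>")
proof -
  let ?k = "real_of_int k"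
  have k0: "?k \<ge> 6" using L by linarith
  have mn1: "1 \<le> \<bar>real_of_int m\<bar>" "1 \<le> \<bar>real_of_int n\<bar>" using mn by linarith+
  have third: "\<bar>\<alpha>1\<bar> * ?k \<le> \<bar>?f\<bar>" if "jap (k+m+n) < L"
  proof -
    have 1: "?k / 2 \<le> real_of_int (2*k+m+n)"
      using that L unfolding jap_def by simp
    have "3 * (\<bar>\<alpha>1\<bar> * (?k / 2)) \<le> 3 * (\<bar>\<alpha>1\<bar> * real_of_int (2*k+m+n))"
      using 1 by (intro mult_left_mono) auto
    also have "\<dots> = \<bar>3 * \<alpha>1 * of_int (2*k+m+n)\<bar>"
      using 1 k0 by (simp only: abs_mult)
    also have "\<dots> \<le> \<bar>?f\<bar> + 2 * \<bar>\<alpha>2\<bar>" by linarith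
    finally show ?thesis using k by linarith
  qed
  have sq: "?d * ?k\<^sup>2 \<le> \<bar>\<alpha>1\<bar> / 2 * ?k\<^sup>2" "?d * ?k\<^sup>2 \<le> c / 4 * ?k\<^sup>2"
    by (intro mult_right_mono; simp)+
  consider "jap (k+m) < L" "jap (k+m+n) < L" | "jap (k+m+n) < L" "jap (k+n) < L" | "jap (k+m) < L" "jap (k+n) < L"
    using mn(1) by (auto simp: low_pairs_def)
  then show ?thesis
  proof cases
    case 1
    have "?k / 2 \<le> \<bar>real_of_int m\<bar>" using 1(1) L unfolding jap_def by simp
    then have "(?k / 2 * 1) * (\<bar>\<alpha>1\<bar> * ?k) \<le> (\<bar>of_int m\<bar> * \<bar>of_int n\<bar>) * \<bar>?f\<bar>"
      using mn1 k0 third[OF 1(2)] by (intro mult_mono) auto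
    with sq(1) show ?thesis by (simp add: abs_mult power2_eq_square mult_ac)
  next
    case 2
    have "?k / 2 \<le> \<bar>real_of_int n\<bar>" using 2(2) L unfolding jap_def by simp
    then have "(1 * (?k / 2)) * (\<bar>\<alpha>1\<bar> * ?k) \<le> (\<bar>of_int m\<bar> * \<bar>of_int n\<bar>) * \<bar>?f\<bar>"
      using mn1 k0 third[OF 2(1)] by (intro mult_mono) auto
    with sq(1) show ?thesis by (simp add: abs_mult power2_eq_square mult_ac)
  next
    case 3
    have "?k / 2 \<le> \<bar>real_of_int n\<bar>" "?k / 2 \<le> \<bar>real_of_int m\<bar>" using 3 L unfolding jap_def by (simp; linarith)+
    then have "((?k / 2) * (?k / 2)) * c \<le> (\<bar>of_int m\<bar> * \<bar>of_int n\<bar>) * \<bar>?f\<bar>"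
      using mn1 k0 gap(2) gap(1)[of "2*k+m+n"] by (intro mult_mono) auto
    with sq(2) show ?thesis by (simp add: abs_mult power2_eq_square mult_ac)
  qed
qed

text \<open>The three weights add up to at least \<open>jap k\<close>, and each of them is at most
  their product because all are at least 1.\<close>

lemma jap_product_lower: "jap k / 3 \<le> jap (k+m) * jap (k+m+n) * jap (k+n)"
proof -
  have "jap k \<le> jap (k+m) + jap (k+m+n) + jap (k+n)"
    unfolding jap_def by simp
  moreover have "jap x \<le> jap x * jap y * jap z \<and> jap y \<le> jap x * jap y * jap z \<and> jap z \<le> jap x * jap y * jap z" for x y z
  proof -
    have p: "1 \<le> jap u * jap w" for u w using mult_mono[of 1 "jap u" 1 "jap w"] by simp
    show ?thesis
      using mult_left_mono[OF p[of y z], of "jap x"] mult_left_mono[OF p[of x z], of "jap y"]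
        mult_left_mono[OF p[of x y], of "jap z"] by (auto simp: mult_ac less_imp_le)
  qed
  note this[of "k+m" "k+m+n" "k+n"]
  ultimately show ?thesis by linarith
qed

text \<open>The third frequency differs from \<open>k\<close> or \<open>- k\<close> by a combination
  of the two low ones, hence by less than 2 L.\<close>

lemma low_pairs_jap_upper:
  assumes L: "6 * L \<le> of_int k" "1 \<le> L" and mn: "(m, n) \<in> low_pairs L k"
  shows "jap (k+m) \<le> 2 * jap k" "jap (k+m+n) \<le> 2 * jap k" "jap (k+n) \<le> 2 * jap k"
  using mn L unfolding low_pairs_def jap_def by (simp_all; linarith)+

section \<open>Growth of the high Fourier modes\<close>

text \<open>Only forward time is modelled, with growth at positive frequencies; the other direction
  is brought to this form by reflection. The bounds \<open>B\<close> and \<open>M\<close> are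
  uniform in time, so that the constants below depend on neither \<open>t\<close> nor
  \<open>k\<close>.\<close>

locale raman_flow =
  fixes \<alpha>1 \<alpha>2 g1 g2 G s B T M :: real and a :: "real \<Rightarrow> int \<Rightarrow> complex"
  assumes G: "G > 0" and \<alpha>1: "\<alpha>1 \<noteq> 0" and nonresonant: "2 * \<alpha>2 / (3 * \<alpha>1) \<notin> \<int>"
    and s: "s \<ge> 1" and T: "T > 0" and M: "M > 0"
    and decaying: "\<And>t. t \<in> {0..T} \<Longrightarrow> decaying s B (a t)"
    and mass: "\<And>t. t \<in> {0..T} \<Longrightarrow> M \<le> mass (a t)"
    and flow: "\<And>t k. t \<in> {0..T} \<Longrightarrow> ((\<lambda>t. a t k) has_vector_derivative
      (- \<i> * of_real (phase \<alpha>1 \<alpha>2 k) * a t k + infsum (raman_term g1 g2 G (a t) k) UNIV)) (at t within {0..T})"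
begin

lemma B: "0 \<le> B"
  using decayingD(4)[OF decaying, of 0] T by simp

lemma continuous_a: "continuous_on {0..T} (\<lambda>t. a t k)"
  using flow by (meson continuous_on_eq_continuous_within has_vector_derivative_continuous)

lemma continuous_raman: "continuous_on {0..T} (\<lambda>t. infsum (raman_term g1 g2 G (a t) k) S)"
  by (rule continuous_on_raman_sum[OF decaying s continuous_a])

text \<open>The profile relative to the free evolution: its derivative contains only the
  nonlinearity, and the dispersion reappears as the oscillating phases of the cubic terms.\<close>

definition v :: "int \<Rightarrow> real \<Rightarrow> complex" where
  "v k t = cis (phase \<alpha>1 \<alpha>2 k * t) * a t k"

definition v' :: "int \<Rightarrow> real \<Rightarrow> complex" where
  "v' k t = cis (phase \<alpha>1 \<alpha>2 k * t) * infsum (raman_term g1 g2 G (a t) k) UNIV"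

lemma v_derivative: "t \<in> {0..T} \<Longrightarrow> (v k has_vector_derivative v' k t) (at t within {0..T})"
  unfolding v_def v'_def
  by (rule has_vector_derivative_eq_rhs[OF has_vector_derivative_mult[OF has_vector_derivative_cis flow]])
     (simp_all add: algebra_simps)

lemma continuous_v: "continuous_on {0..T} (v k)"
  using v_derivative by (meson continuous_on_eq_continuous_within has_vector_derivative_continuous)

lemma continuous_v': "continuous_on {0..T} (v' k)"
  unfolding v'_def by (intro continuous_intros continuous_raman)

abbreviation "R \<equiv> raman_const g1 g2 G s B"

lemma R: "0 \<le> R" using B by (rule raman_const_nonneg)

lemma norm_v:
  assumes "t \<in> {0..T}" shows "cmod (v k t) \<le> B * jap k powr (-s)"
proof -
  have "jap k powr s * cmod (a t k) \<le> B" by (rule decayingD[OF decaying[OF assms]])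
  then show ?thesis by (simp add: v_def norm_mult powr_minus field_simps)
qed

lemma norm_v':
  assumes "t \<in> {0..T}" shows "cmod (v' k t) \<le> R * jap k * jap k powr (-s)"
  using raman_sum_bound[OF decaying[OF assms] s, of g1 g2 G k UNIV]
  by (simp add: v'_def norm_mult powr_diff powr_minus field_simps)

definition w :: "int \<Rightarrow> int \<Rightarrow> int \<Rightarrow> real \<Rightarrow> complex" where
  "w x y z t = v x t * cnj (v y t) * v z t"

definition w' :: "int \<Rightarrow> int \<Rightarrow> int \<Rightarrow> real \<Rightarrow> complex" where
  "w' x y z t = v x t * cnj (v y t) * v' z t + (v x t * cnj (v' y t) + v' x t * cnj (v y t)) * v z t"

lemma has_vector_derivative_cnj:
  "(f has_vector_derivative f') F \<Longrightarrow> ((\<lambda>t. cnj (f t)) has_vector_derivative cnj f') F"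
  by (rule bounded_linear.has_vector_derivative[OF bounded_linear_cnj])

lemma w_derivative: "t \<in> {0..T} \<Longrightarrow> (w x y z has_vector_derivative w' x y z t) (at t within {0..T})"
  unfolding w_def w'_def by (intro has_vector_derivative_mult has_vector_derivative_cnj v_derivative)

lemma continuous_w: "continuous_on {0..T} (w x y z)" and continuous_w': "continuous_on {0..T} (w' x y z)"
  unfolding w_def w'_def by (intro continuous_intros continuous_v continuous_v')+

lemma norm_w:
  assumes t: "t \<in> {0..T}"
  shows "cmod (w x y z t) \<le> B ^ 3 * (jap x * jap y * jap z) powr (-s)"
proof -
  have "cmod (w x y z t) \<le> (B * jap x powr (-s)) * (B * jap y powr (-s)) * (B * jap z powr (-s))"
    unfolding w_def norm_mult complex_mod_cnj using B t by (intro mult_mono norm_v mult_nonneg_nonneg) auto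
  then show ?thesis by (simp add: powr_mult power3_eq_cube mult_ac)
qed

lemma norm_w':
  assumes t: "t \<in> {0..T}"
  shows "cmod (w' x y z t) \<le> B\<^sup>2 * R * (jap x + jap y + jap z) * (jap x * jap y * jap z) powr (-s)"
proof -
  let ?b = "\<lambda>x. B * jap x powr (-s)" and ?d = "\<lambda>x. R * jap x * jap x powr (-s)"
  have b: "0 \<le> ?b x" for x using B by simp
  have "cmod (v x t * cnj (v y t) * v' z t) \<le> ?b x * ?b y * ?d z"
    "cmod (v x t * cnj (v' y t) * v z t) \<le> ?b x * ?d y * ?b z"
    "cmod (v' x t * cnj (v y t) * v z t) \<le> ?d x * ?b y * ?b z"
    unfolding norm_mult complex_mod_cnj using B R t
    by (intro mult_mono norm_v norm_v' mult_nonneg_nonneg; simp)+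
  then have "cmod (w' x y z t) \<le> ?b x * ?b y * ?d z + (?b x * ?d y * ?b z + ?d x * ?b y * ?b z)"
    unfolding w'_def distrib_right by (intro norm_triangle_le add_mono)
  then show ?thesis by (simp add: powr_mult power2_eq_square algebra_simps)
qed

section \<open>The resonant rate and its integrating factor\<close>

abbreviation "lam k t \<equiv> resonant_rate g1 g2 G (a t) k"

definition Lam :: real where "Lam = 2 * B\<^sup>2 * (G + 2 * \<bar>g1\<bar> + 2 * \<bar>g2\<bar>)"

lemma Lam: "0 \<le> Lam" using G by (simp add: Lam_def)

lemma continuous_lam: "continuous_on {0..T} (lam k)"
proof -
  have "continuous_on {0..T} (\<lambda>t. mass (a t))"
    using continuous_on_quadratic_sum[OF decaying s _ continuous_a, of "\<lambda>_. 1"] by (simp add: mass_def)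
  moreover have "continuous_on {0..T} (\<lambda>t. momentum (a t))"
    using continuous_on_quadratic_sum[OF decaying s _ continuous_a, of of_int] by (simp add: momentum_def jap_def)
  ultimately show ?thesis
    unfolding resonant_rate_def Complex_eq by (intro continuous_intros continuous_a)
qed

lemma norm_lam:
  assumes t: "t \<in> {0..T}" shows "cmod (lam k t) \<le> Lam * jap k"
proof -
  note d = decaying[OF t]
  have m: "\<bar>mass (a t)\<bar> \<le> B\<^sup>2" and p: "\<bar>momentum (a t)\<bar> \<le> B\<^sup>2"
    using mass_bound[OF d s] momentum_bound[OF d s] by auto
  have "cmod (a t k) = cmod (v k t)" by (simp add: v_def norm_mult)
  also have "\<dots> \<le> B * jap k powr (-s)" by (rule norm_v[OF t])
  also have "\<dots> \<le> B * 1" using s B by (intro mult_left_mono) (auto simp: powr_minus inverse_le_1_iff ge_one_powr_ge_zero)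
  finally have ak: "(cmod (a t k))\<^sup>2 \<le> B\<^sup>2" by (simp add: power_mono)
  have k: "\<bar>real_of_int k\<bar> \<le> jap k" "1 \<le> jap k" by (auto simp: jap_def)
  have "cmod (lam k t) \<le> \<bar>G * (of_int k * mass (a t) - momentum (a t))\<bar>
     + \<bar>(g1 + g2 * of_int k) * (2 * mass (a t) - (cmod (a t k))\<^sup>2)\<bar>"
    using cmod_le[of "lam k t"] by (simp add: resonant_rate_def)
  also have "\<dots> \<le> G * (jap k * B\<^sup>2 + jap k * B\<^sup>2) + (\<bar>g1\<bar> + \<bar>g2\<bar>) * jap k * (4 * B\<^sup>2)"
  proof (rule add_mono)
    have "\<bar>of_int k * mass (a t) - momentum (a t)\<bar> \<le> \<bar>real_of_int k\<bar> * \<bar>mass (a t)\<bar> + 1 * \<bar>momentum (a t)\<bar>"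
      using abs_triangle_ineq4[of "of_int k * mass (a t)" "momentum (a t)"] by (simp add: abs_mult)
    also have "\<dots> \<le> jap k * B\<^sup>2 + jap k * B\<^sup>2" using m p k by (intro add_mono mult_mono) auto
    finally show "\<bar>G * (of_int k * mass (a t) - momentum (a t))\<bar> \<le> G * (jap k * B\<^sup>2 + jap k * B\<^sup>2)"
      using G by (simp add: abs_mult)
    have "\<bar>g1 + g2 * of_int k\<bar> \<le> \<bar>g1\<bar> * 1 + \<bar>g2\<bar> * \<bar>real_of_int k\<bar>"
      using abs_triangle_ineq[of g1 "g2 * of_int k"] by (simp add: abs_mult)
    also have "\<dots> \<le> \<bar>g1\<bar> * jap k + \<bar>g2\<bar> * jap k" using k by (intro add_mono mult_left_mono) auto
    finally have "\<bar>g1 + g2 * of_int k\<bar> \<le> (\<bar>g1\<bar> + \<bar>g2\<bar>) * jap k" by (simp add: algebra_simps)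
    moreover have "\<bar>2 * mass (a t) - (cmod (a t k))\<^sup>2\<bar> \<le> 4 * B\<^sup>2"
      using m ak zero_le_power2[of "cmod (a t k)"] by linarith
    ultimately show "\<bar>(g1 + g2 * of_int k) * (2 * mass (a t) - (cmod (a t k))\<^sup>2)\<bar> \<le> (\<bar>g1\<bar> + \<bar>g2\<bar>) * jap k * (4 * B\<^sup>2)"
      unfolding abs_mult by (intro mult_mono) auto
  qed
  also have "\<dots> = Lam * jap k" by (simp add: Lam_def algebra_simps)
  finally show ?thesis .
qed

text \<open>The whole complex rate is integrated: besides the damping, this removes exactly the
  rotation produced by its imaginary part, which may itself be of size \<open>k\<close>.\<close>

definition E :: "int \<Rightarrow> real \<Rightarrow> complex" where
  "E k t = exp (- integral {0..t} (lam k))"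

lemma E_derivative:
  assumes "t \<in> {0..T}" shows "(E k has_vector_derivative (- lam k t * E k t)) (at t within {0..T})"
proof -
  have "((\<lambda>t. integral {0..t} (lam k)) has_vector_derivative lam k t) (at t within {0..T})"
    by (rule integral_has_vector_derivative[OF continuous_lam assms])
  then have "((\<lambda>t. - integral {0..t} (lam k)) has_vector_derivative - lam k t) (at t within {0..T})"
    by (rule has_vector_derivative_minus)
  then have "(exp \<circ> (\<lambda>t. - integral {0..t} (lam k)) has_vector_derivative (- lam k t * exp (- integral {0..t} (lam k)))) (at t within {0..T})"
    by (rule field_vector_diff_chain_within) (rule has_field_derivative_at_within[OF DERIV_exp])
  then show ?thesis by (simp add: E_def[abs_def] o_def)
qed

lemma continuous_E: "continuous_on {0..T} (E k)"
  using E_derivative by (meson continuous_on_eq_continuous_within has_vector_derivative_continuous)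

lemma E_0 [simp]: "E k 0 = 1"
  by (simp add: E_def)

text \<open>The momentum is bounded by \<open>B\<^sup>2\<close>, so for k M \<ge> 2 B^2 it costs at
  most half of the growth rate due to the mass.\<close>

lemma Re_lam:
  assumes t: "t \<in> {0..T}" and k: "2 * B\<^sup>2 \<le> M * of_int k" "k > 0"
  shows "G * M / 2 * of_int k \<le> Re (lam k t)"
proof -
  have "M * of_int k \<le> mass (a t) * of_int k" using mass[OF t] k by (intro mult_right_mono) auto
  moreover have "\<bar>momentum (a t)\<bar> \<le> B\<^sup>2" by (rule momentum_bound[OF decaying[OF t] s])
  ultimately have "M / 2 * of_int k \<le> of_int k * mass (a t) - momentum (a t)"
    using k(1) by (simp add: mult.commute abs_le_iff)
  then have "G * (M / 2 * of_int k) \<le> G * (of_int k * mass (a t) - momentum (a t))"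
    using G by (intro mult_left_mono) auto
  then show ?thesis by (simp add: resonant_rate_def)
qed

lemma norm_E:
  assumes t: "t \<in> {0..T}" and k: "2 * B\<^sup>2 \<le> M * of_int k" "k > 0"
  shows "cmod (E k t) \<le> exp (- (G * M / 2 * of_int k) * t)"
proof -
  have c: "continuous_on {0..t} (lam k)" using t by (intro continuous_on_subset[OF continuous_lam]) auto
  then have i: "lam k integrable_on {0..t}" by (rule integrable_continuous_interval)
  have "integral {0..t} (\<lambda>_. G * M / 2 * of_int k) \<le> integral {0..t} (\<lambda>\<tau>. Re (lam k \<tau>))"
    using t Re_lam[OF _ k] by (intro integral_le integrable_continuous_interval continuous_intros c) auto
  also have "\<dots> = Re (integral {0..t} (lam k))"
    using integral_linear[OF i bounded_linear_Re] by (simp add: o_def)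
  finally show ?thesis using t by (simp add: E_def mult_ac)
qed

end

section \<open>Duhamel's formula and the gain of decay at the initial time\<close>

context raman_flow begin

definition nonres :: "(int \<times> int) set" where "nonres = - {(m, n). m = 0 \<or> n = 0}"

lemma raman_split:
  assumes t: "t \<in> {0..T}"
  shows "infsum (raman_term g1 g2 G (a t) k) UNIV = lam k t * a t k + infsum (raman_term g1 g2 G (a t) k) nonres"
proof -
  have "infsum (raman_term g1 g2 G (a t) k) ({(m, n). m = 0 \<or> n = 0} \<union> nonres)
    = infsum (raman_term g1 g2 G (a t) k) {(m, n). m = 0 \<or> n = 0} + infsum (raman_term g1 g2 G (a t) k) nonres"
    by (intro infsum_Un_disjoint raman_term_summable[OF decaying[OF t] s]) (auto simp: nonres_def)
  then show ?thesis by (simp add: resonant_sum[OF decaying[OF t] s] nonres_def)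
qed

lemma nonres_split:
  assumes t: "t \<in> {0..T}"
  shows "infsum (raman_term g1 g2 G (a t) k) nonres =
    (\<Sum>p\<in>nonres \<inter> low_pairs L k. raman_term g1 g2 G (a t) k p) + infsum (raman_term g1 g2 G (a t) k) (nonres - low_pairs L k)"
proof -
  have "infsum (raman_term g1 g2 G (a t) k) ((nonres \<inter> low_pairs L k) \<union> (nonres - low_pairs L k))
    = infsum (raman_term g1 g2 G (a t) k) (nonres \<inter> low_pairs L k) + infsum (raman_term g1 g2 G (a t) k) (nonres - low_pairs L k)"
    by (intro infsum_Un_disjoint raman_term_summable[OF decaying[OF t] s]) auto
  moreover have "(nonres \<inter> low_pairs L k) \<union> (nonres - low_pairs L k) = nonres" by auto
  ultimately show ?thesis by simp
qed

definition freq :: "int \<Rightarrow> int \<Rightarrow> int \<Rightarrow> real" where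
  "freq k m n = phase \<alpha>1 \<alpha>2 k - phase \<alpha>1 \<alpha>2 (k+m) + phase \<alpha>1 \<alpha>2 (k+m+n) - phase \<alpha>1 \<alpha>2 (k+n)"

lemma raman_term_w:
  "cis (phase \<alpha>1 \<alpha>2 k * t) * raman_term g1 g2 G (a t) k (m, n)
    = raman_coeff g1 g2 G k n * (cis (freq k m n * t) * w (k+m) (k+m+n) (k+n) t)"
proof -
  have "cis (freq k m n * t) * cis (phase \<alpha>1 \<alpha>2 (k+m) * t) * cis (- (phase \<alpha>1 \<alpha>2 (k+m+n) * t)) * cis (phase \<alpha>1 \<alpha>2 (k+n) * t)
     = cis (phase \<alpha>1 \<alpha>2 k * t)"
    unfolding cis_mult freq_def by (simp add: algebra_simps)
  from this[symmetric] show ?thesis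
    by (simp add: raman_term_def w_def v_def cis_cnj)
qed

text \<open>The finitely many nonresonant low pairs are integrated one by one, since each oscillates
  at its own rate \<open>freq k m n\<close>; the infinite remainder stays under a single integral
  and will be bounded in absolute value.\<close>

lemma duhamel:
  "E k T * v k T - v k 0 =
     (\<Sum>(m, n)\<in>nonres \<inter> low_pairs L k. raman_coeff g1 g2 G k n *
        integral {0..T} (\<lambda>t. cis (freq k m n * t) * (E k t * w (k+m) (k+m+n) (k+n) t)))
     + integral {0..T} (\<lambda>t. E k t * (cis (phase \<alpha>1 \<alpha>2 k * t) * infsum (raman_term g1 g2 G (a t) k) (nonres - low_pairs L k)))"
proof -
  let ?N = "nonres \<inter> low_pairs L k"
  let ?f = "\<lambda>(m, n) t. raman_coeff g1 g2 G k n * (cis (freq k m n * t) * (E k t * w (k+m) (k+m+n) (k+n) t))"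
  let ?g = "\<lambda>t. E k t * (cis (phase \<alpha>1 \<alpha>2 k * t) * infsum (raman_term g1 g2 G (a t) k) (nonres - low_pairs L k))"
  have f: "?f p integrable_on {0..T}" for p
    by (cases p) (auto intro!: integrable_continuous_interval continuous_intros continuous_E continuous_w)
  have g: "?g integrable_on {0..T}"
    by (intro integrable_continuous_interval continuous_intros continuous_E continuous_raman)
  have eq: "E k t * v' k t + - lam k t * E k t * v k t = (\<Sum>p\<in>?N. ?f p t) + ?g t" if t: "t \<in> {0..T}" for t
  proof -
    have "E k t * v' k t + - lam k t * E k t * v k t
      = E k t * (cis (phase \<alpha>1 \<alpha>2 k * t) * infsum (raman_term g1 g2 G (a t) k) nonres)"
      by (simp add: v'_def v_def raman_split[OF t] algebra_simps)
    also have "\<dots> = E k t * (\<Sum>p\<in>?N. cis (phase \<alpha>1 \<alpha>2 k * t) * raman_term g1 g2 G (a t) k p) + ?g t"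
      unfolding nonres_split[OF t, of k L] by (simp add: distrib_left sum_distrib_left)
    also have "E k t * (\<Sum>p\<in>?N. cis (phase \<alpha>1 \<alpha>2 k * t) * raman_term g1 g2 G (a t) k p) = (\<Sum>p\<in>?N. ?f p t)"
      unfolding sum_distrib_left
    proof (intro sum.cong refl)
      fix p show "E k t * (cis (phase \<alpha>1 \<alpha>2 k * t) * raman_term g1 g2 G (a t) k p) = ?f p t"
        by (cases p) (simp only: raman_term_w prod.case mult.left_commute[of "E k t"])
    qed
    finally show ?thesis .
  qed
  have "((\<lambda>t. E k t * v' k t + - lam k t * E k t * v k t) has_integral (E k T * v k T - E k 0 * v k 0)) {0..T}"
    using T by (intro fundamental_theorem_of_calculus has_vector_derivative_mult E_derivative v_derivative) auto
  from this[unfolded E_0 mult_1] have "((\<lambda>t. (\<Sum>p\<in>?N. ?f p t) + ?g t) has_integral (E k T * v k T - v k 0)) {0..T}"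
    by (rule has_integral_eq[rotated]) (use eq in auto)
  then have "E k T * v k T - v k 0 = integral {0..T} (\<lambda>t. (\<Sum>p\<in>?N. ?f p t) + ?g t)"
    by (simp add: integral_unique)
  also have "\<dots> = (\<Sum>p\<in>?N. integral {0..T} (?f p)) + integral {0..T} ?g"
    using f g by (subst integral_add) (auto intro!: integrable_sum simp: integral_sum)
  also have "(\<Sum>p\<in>?N. integral {0..T} (?f p)) = (\<Sum>(m, n)\<in>?N. raman_coeff g1 g2 G k n *
        integral {0..T} (\<lambda>t. cis (freq k m n * t) * (E k t * w (k+m) (k+m+n) (k+n) t)))"
    by (intro sum.cong refl) (auto simp: integral_mult_right)
  finally show ?thesis .
qed

text \<open>The constant produced by \<open>oscillatory_integral\<close> for a low pair: twice the
  bound of the amplitude, then the bound of its derivative divided by the rate G M k / 2. The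
  estimate \<open>jap k \<le> 2 * k\<close> turns the resulting factor 2 into 4.\<close>

definition Q :: real where
  "Q = 2 * (3 powr s * B ^ 3) + 4 * (6 * 3 powr s * B\<^sup>2 * R + Lam * (3 powr s * B ^ 3)) / (G * M)"

text \<open>Power count: differentiating the amplitude \<open>E * w\<close> costs one factor
  \<open>jap k\<close>, which the time integral of the damping returns; the phase mismatch of order
  k^2 then beats the coefficient of order \<open>k\<close> by one power.\<close>

lemma low_integral_bound:
  assumes t: "2 * B\<^sup>2 \<le> M * of_int k" "4 * \<bar>\<alpha>2\<bar> \<le> \<bar>\<alpha>1\<bar> * of_int k" "6 * L \<le> of_int k" "1 \<le> L"
    and gap: "\<And>j::int. c \<le> \<bar>3 * \<alpha>1 * of_int j + 2 * \<alpha>2\<bar>" "c > 0"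
    and mn: "(m, n) \<in> nonres \<inter> low_pairs L k"
  shows "cmod (raman_coeff g1 g2 G k n * integral {0..T} (\<lambda>t. cis (freq k m n * t) * (E k t * w (k+m) (k+m+n) (k+n) t)))
    \<le> 20 * (\<bar>g1\<bar> + \<bar>g2\<bar> + \<bar>G\<bar>) * Q / min (\<bar>\<alpha>1\<bar> / 2) (c / 4) * (jap k powr (-s) / jap k)"
proof -
  let ?x = "k+m" and ?y = "k+m+n" and ?z = "k+n" and ?k = "real_of_int k" and ?J = "jap k powr (-s)"
  let ?d = "min (\<bar>\<alpha>1\<bar> / 2) (c / 4)" and ?C = "\<bar>g1\<bar> + \<bar>g2\<bar> + \<bar>G\<bar>"
  let ?A = "3 powr s * B ^ 3 * ?J" and ?A' = "(6 * 3 powr s * B\<^sup>2 * R + Lam * (3 powr s * B ^ 3)) * jap k * ?J"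
  have k6: "?k \<ge> 6" using t by linarith
  have k0: "k > 0" using k6 by linarith
  have d: "?d > 0" using \<alpha>1 gap(2) by simp
  have low: "(m, n) \<in> low_pairs L k" "m \<noteq> 0" "n \<noteq> 0" using mn by (auto simp: nonres_def)
  note up = low_pairs_jap_upper[OF t(3,4) low(1)]
  have r: "?d * ?k\<^sup>2 \<le> \<bar>freq k m n\<bar>"
    unfolding freq_def phase_resonance by (rule phase_lower_bound[OF gap t(3,4,2) low])
  have rpos: "0 < \<bar>freq k m n\<bar>" by (rule less_le_trans[OF _ r]) (use d k0 in simp)
  define c' where "c' = G * M / 2 * ?k"
  have c': "c' > 0" using G M k0 by (simp add: c'_def)
  have prod: "(jap ?x * jap ?y * jap ?z) powr (-s) \<le> 3 powr s * ?J"
  proof -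
    have "(jap ?x * jap ?y * jap ?z) powr (-s) \<le> (jap k / 3) powr (-s)"
      using s by (intro powr_mono2' jap_product_lower) auto
    then show ?thesis by (simp add: powr_divide powr_minus field_simps)
  qed
  have W: "cmod (w ?x ?y ?z \<tau>) \<le> ?A" if "\<tau> \<in> {0..T}" for \<tau>
    using norm_w[OF that, of ?x ?y ?z] mult_left_mono[OF prod, of "B^3"] B by (simp add: mult_ac)
  have W': "cmod (w' ?x ?y ?z \<tau>) \<le> 6 * 3 powr s * B\<^sup>2 * R * jap k * ?J" if "\<tau> \<in> {0..T}" for \<tau>
  proof -
    have "cmod (w' ?x ?y ?z \<tau>) \<le> B\<^sup>2 * R * (jap ?x + jap ?y + jap ?z) * (jap ?x * jap ?y * jap ?z) powr (-s)"
      by (rule norm_w'[OF that])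
    also have "\<dots> \<le> B\<^sup>2 * R * (6 * jap k) * (3 powr s * ?J)"
      using up B R by (intro mult_mono prod mult_nonneg_nonneg) auto
    finally show ?thesis by (simp add: mult_ac)
  qed
  have A0: "0 \<le> ?A" "0 \<le> ?A'" using B R Lam by auto
  have E1: "cmod (E k \<tau>) \<le> exp (- c' * \<tau>)" if "\<tau> \<in> {0..T}" for \<tau>
    unfolding c'_def by (rule norm_E[OF that t(1) k0])
  let ?h = "\<lambda>t. E k t * w ?x ?y ?z t"
  let ?h' = "\<lambda>t. E k t * w' ?x ?y ?z t + - lam k t * E k t * w ?x ?y ?z t"
  have "cmod (integral {0..T} (\<lambda>t. cis (freq k m n * t) * ?h t)) \<le> (2 * ?A + ?A' / c') / \<bar>freq k m n\<bar>"
  proof (rule oscillatory_integral[where h' = ?h'])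
    show "0 \<le> T" "freq k m n \<noteq> 0" "c' > 0" "0 \<le> ?A'" using T rpos c' A0 by auto
    show "continuous_on {0..T} ?h'"
      by (intro continuous_intros continuous_E continuous_w continuous_w' continuous_lam)
    fix \<tau> assume \<tau>: "\<tau> \<in> {0..T}"
    show "(?h has_vector_derivative ?h' \<tau>) (at \<tau> within {0..T})"
      by (intro has_vector_derivative_mult E_derivative w_derivative \<tau>)
    have "exp (- c' * \<tau>) \<le> 1" using c' \<tau> by simp
    then have "cmod (E k \<tau>) * cmod (w ?x ?y ?z \<tau>) \<le> 1 * ?A"
      using order_trans[OF E1[OF \<tau>]] W[OF \<tau>] by (intro mult_mono) auto
    then show "cmod (?h \<tau>) \<le> ?A" by (simp add: norm_mult)
    have "cmod (?h' \<tau>) = cmod (E k \<tau>) * cmod (w' ?x ?y ?z \<tau> - lam k \<tau> * w ?x ?y ?z \<tau>)"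
      by (subst norm_mult[symmetric]) (simp add: algebra_simps)
    also have "\<dots> \<le> exp (- c' * \<tau>) * (6 * 3 powr s * B\<^sup>2 * R * jap k * ?J + Lam * jap k * ?A)"
    proof (rule mult_mono[OF E1[OF \<tau>]])
      have "cmod (w' ?x ?y ?z \<tau> - lam k \<tau> * w ?x ?y ?z \<tau>) \<le> cmod (w' ?x ?y ?z \<tau>) + cmod (lam k \<tau>) * cmod (w ?x ?y ?z \<tau>)"
        by (rule order_trans[OF norm_triangle_ineq4]) (simp add: norm_mult)
      also have "\<dots> \<le> 6 * 3 powr s * B\<^sup>2 * R * jap k * ?J + Lam * jap k * ?A"
        using A0 Lam by (intro add_mono mult_mono W'[OF \<tau>] W[OF \<tau>] norm_lam[OF \<tau>]) auto
      finally show "cmod (w' ?x ?y ?z \<tau> - lam k \<tau> * w ?x ?y ?z \<tau>) \<le> 6 * 3 powr s * B\<^sup>2 * R * jap k * ?J + Lam * jap k * ?A" .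
    qed auto
    also have "\<dots> = ?A' * exp (- c' * \<tau>)" by (simp add: algebra_simps)
    finally show "cmod (?h' \<tau>) \<le> ?A' * exp (- c' * \<tau>)" .
  qed
  also have "\<dots> \<le> (Q * ?J) / (?d * (jap k)\<^sup>2 / 4)"
  proof (rule frac_le)
    have jk: "jap k \<le> 2 * ?k" using k6 by (simp add: jap_def)
    have "?A' / c' \<le> (6 * 3 powr s * B\<^sup>2 * R + Lam * (3 powr s * B ^ 3)) * (2 * ?k) * ?J / c'"
      using jk B R Lam c' by (intro divide_right_mono mult_right_mono mult_left_mono) auto
    also have "\<dots> = 4 * (6 * 3 powr s * B\<^sup>2 * R + Lam * (3 powr s * B ^ 3)) / (G * M) * ?J"
      using G M k0 by (simp add: c'_def field_simps)
    finally show "2 * ?A + ?A' / c' \<le> Q * ?J" by (simp add: Q_def algebra_simps)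
    have "(jap k)\<^sup>2 \<le> (2 * ?k)\<^sup>2" using jk by (intro power_mono) auto
    then have "?d * ((jap k)\<^sup>2 / 4) \<le> ?d * ?k\<^sup>2" using d by (intro mult_left_mono) (auto simp: power_mult_distrib)
    with r show "?d * (jap k)\<^sup>2 / 4 \<le> \<bar>freq k m n\<bar>" by simp
    show "0 < ?d * (jap k)\<^sup>2 / 4" using d by simp
    show "0 \<le> Q * ?J" using B R Lam G M by (auto simp: Q_def intro!: mult_nonneg_nonneg add_nonneg_nonneg divide_nonneg_nonneg)
  qed
  finally have I: "cmod (integral {0..T} (\<lambda>t. cis (freq k m n * t) * ?h t)) \<le> (Q * ?J) / (?d * (jap k)\<^sup>2 / 4)" .
  have "\<bar>real_of_int n\<bar> \<le> jap ?x + jap ?y" unfolding jap_def by simp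
  then have "jap k + \<bar>real_of_int n\<bar> \<le> 5 * jap k" using up by linarith
  then have "cmod (raman_coeff g1 g2 G k n) \<le> ?C * (5 * jap k)"
    by (intro order_trans[OF norm_raman_coeff] mult_left_mono) auto
  then have "cmod (raman_coeff g1 g2 G k n) * cmod (integral {0..T} (\<lambda>t. cis (freq k m n * t) * ?h t))
     \<le> (?C * (5 * jap k)) * ((Q * ?J) / (?d * (jap k)\<^sup>2 / 4))"
    using I by (intro mult_mono) auto
  also have "\<dots> = 20 * ?C * Q / ?d * (?J / jap k)"
    by (simp add: power2_eq_square)
  finally show ?thesis by (simp add: norm_mult)
qed

text \<open>Absolute values suffice here: the damping returns the lost derivative and
  \<open>raman_tail\<close> supplies the negative power of \<open>L\<close>.\<close>

lemma tail_integral_bound: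
  assumes k: "2 * B\<^sup>2 \<le> M * of_int k" "1 \<le> k" and L: "L > 0"
  shows "cmod (integral {0..T} (\<lambda>t. E k t * (cis (phase \<alpha>1 \<alpha>2 k * t) * infsum (raman_term g1 g2 G (a t) k) (nonres - low_pairs L k))))
    \<le> 4 * R / (G * M) * (jap k powr (-s) * L powr (-(1/4)))"
proof -
  let ?k = "real_of_int k"
  define c' where "c' = G * M / 2 * ?k"
  have c': "c' > 0" using G M k by (simp add: c'_def)
  have "cmod (integral {0..T} (\<lambda>t. E k t * (cis (phase \<alpha>1 \<alpha>2 k * t) * infsum (raman_term g1 g2 G (a t) k) (nonres - low_pairs L k))))
    \<le> (R * jap k powr (1-s) * L powr (-(1/4))) / c'"
  proof (rule norm_integral_exp_decay)
    show "0 \<le> T" "c' > 0" "0 \<le> R * jap k powr (1-s) * L powr (-(1/4))" using T c' R by auto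
    show "(\<lambda>t. E k t * (cis (phase \<alpha>1 \<alpha>2 k * t) * infsum (raman_term g1 g2 G (a t) k) (nonres - low_pairs L k))) integrable_on {0..T}"
      by (intro integrable_continuous_interval continuous_intros continuous_E continuous_raman)
    fix \<tau> assume \<tau>: "\<tau> \<in> {0..T}"
    have "cmod (E k \<tau>) * cmod (infsum (raman_term g1 g2 G (a \<tau>) k) (nonres - low_pairs L k)) \<le>
      exp (- c' * \<tau>) * (R * jap k powr (1-s) * L powr (-(1/4)))"
      unfolding c'_def using L k by (intro mult_mono norm_E[OF \<tau> k(1)] raman_tail[OF decaying[OF \<tau>] s]) auto
    then show "cmod (E k \<tau> * (cis (phase \<alpha>1 \<alpha>2 k * \<tau>) * infsum (raman_term g1 g2 G (a \<tau>) k) (nonres - low_pairs L k)))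
       \<le> R * jap k powr (1-s) * L powr (-(1/4)) * exp (- c' * \<tau>)"
      by (simp add: norm_mult mult_ac)
  qed
  also have "\<dots> = R * (jap k powr (-s) * L powr (-(1/4))) * jap k / c'"
    by (simp add: powr_diff powr_minus field_simps)
  also have "\<dots> \<le> R * (jap k powr (-s) * L powr (-(1/4))) * (2 * ?k) / c'"
    using R c' k by (intro divide_right_mono mult_left_mono) (auto simp: jap_def)
  also have "\<dots> = 4 * R / (G * M) * (jap k powr (-s) * L powr (-(1/4)))"
    using G M k by (simp add: c'_def field_simps)
  finally show ?thesis .
qed

lemma E_T_bound:
  assumes k: "2 * B\<^sup>2 \<le> M * of_int k" "1 \<le> k"
  shows "cmod (E k T * v k T) \<le> 4 * B / (G * M * T) * (jap k powr (-s) / jap k)"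
proof -
  let ?k = "real_of_int k"
  let ?x = "G * M / 2 * ?k * T"
  have x: "?x > 0" using G M k T by simp
  \<comment> \<open>The exponential smallness at time \<open>T\<close> is weakened to a single
    negative power of \<open>k\<close>, which exceeds the required gain.\<close>
  have "exp (- ?x) \<le> 1 / ?x"
  proof -
    have "?x \<le> exp ?x" using exp_ge_add_one_self[of ?x] by linarith
    then show ?thesis using x by (simp add: exp_minus field_simps)
  qed
  also have "\<dots> = 2 / (G * M * T) * (1 / ?k)" by simp
  also have "\<dots> \<le> 2 / (G * M * T) * (2 / jap k)"
    using k G M T by (intro mult_left_mono) (auto simp: jap_def field_simps)
  finally have e: "exp (- (G * M / 2 * ?k) * T) \<le> 2 / (G * M * T) * (2 / jap k)" by simp
  have "cmod (E k T) * cmod (v k T) \<le> (2 / (G * M * T) * (2 / jap k)) * (B * jap k powr (-s))"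
    using T k G M by (intro mult_mono norm_v order_trans[OF norm_E[OF _ k(1)] e]) auto
  then show ?thesis by (simp add: norm_mult)
qed

theorem initial_gain:
  "\<exists>C k0. \<forall>k\<ge>k0. cmod (a 0 k) \<le> C * jap k powr (- s - 1/16)"
proof -
  obtain c where c: "c > 0" "\<And>j::int. c \<le> \<bar>3 * \<alpha>1 * of_int j + 2 * \<alpha>2\<bar>"
    using phase_gap[OF \<alpha>1 nonresonant] by blast
  let ?D = "20 * (\<bar>g1\<bar> + \<bar>g2\<bar> + \<bar>G\<bar>) * Q / min (\<bar>\<alpha>1\<bar> / 2) (c / 4)"
  let ?C = "4 * B / (G * M * T) + (12 * ?D + 4 * R / (G * M))"
  \<comment> \<open>The first two thresholds give \<open>k1\<close> and \<open>k2\<close>. The third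
    gives \<open>6 * L \<le> k\<close>: it makes \<open>jap k\<close> exceed 7^4 = 2401, hence L
    \<ge> 7 and 343 L \<le> L^4 = \<open>jap k\<close>.\<close>
  define k0 where "k0 = max (\<lceil>2 * B\<^sup>2 / M\<rceil>) (max \<lceil>4 * \<bar>\<alpha>2\<bar> / \<bar>\<alpha>1\<bar>\<rceil> 6000)"
  have D: "0 \<le> ?D"
    using B R Lam G M c by (auto simp: Q_def intro!: mult_nonneg_nonneg add_nonneg_nonneg divide_nonneg_nonneg)
  have "cmod (a 0 k) \<le> ?C * jap k powr (- s - 1/16)" if k: "k \<ge> k0" for k
  proof -
    let ?k = "real_of_int k"
    define L where "L = jap k powr (1/4)"
    have "\<lceil>2 * B\<^sup>2 / M\<rceil> \<le> k" "\<lceil>4 * \<bar>\<alpha>2\<bar> / \<bar>\<alpha>1\<bar>\<rceil> \<le> k" and k6: "6000 \<le> k" using k by (auto simp: k0_def)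
    then have "2 * B\<^sup>2 / M \<le> ?k" "4 * \<bar>\<alpha>2\<bar> / \<bar>\<alpha>1\<bar> \<le> ?k" by (auto simp: ceiling_le_iff)
    then have k1: "2 * B\<^sup>2 \<le> M * ?k" and k2: "4 * \<bar>\<alpha>2\<bar> \<le> \<bar>\<alpha>1\<bar> * ?k"
      using M \<alpha>1 by (auto simp: field_simps)
    have L1: "1 \<le> L" unfolding L_def by (rule ge_one_powr_ge_zero) auto
    have L6: "6 * L \<le> ?k"
    proof -
      have jk: "jap k \<ge> 2401" using k6 by (simp add: jap_def)
      have "7 = (2401::real) powr (1/4)"
        using powr_powr[of 7 4 "1/4"] by simp
      also have "\<dots> \<le> L" unfolding L_def using jk by (intro powr_mono2) auto
      finally have L7: "7 \<le> L" .
      have "jap k = L powr 4" by (simp add: L_def powr_powr)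
      also have "\<dots> = L ^ 4" using L1 by simp
      finally have "jap k = L * L ^ 3" by (simp add: power_numeral_reduce)
      moreover have "7 ^ 3 \<le> L ^ 3" using L7 by (intro power_mono) auto
      then have "L * 343 \<le> L * L ^ 3" using L1 by (intro mult_left_mono) auto
      ultimately have "L * 343 \<le> jap k" by simp
      moreover have "6000 \<le> ?k" using k6 by linarith
      ultimately show ?thesis using L1 by (simp add: jap_def)
    qed
    have pw: "jap k powr (-s) / jap k \<le> jap k powr (-s - 1/16)"
    proof -
      have "jap k powr (-s) / jap k = jap k powr (-s - 1)" by (simp add: powr_diff)
      also have "\<dots> \<le> jap k powr (-s - 1/16)" by (intro powr_mono) auto
      finally show ?thesis .
    qed
    have "norm (\<Sum>(m, n)\<in>nonres \<inter> low_pairs L k. raman_coeff g1 g2 G k n *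
        integral {0..T} (\<lambda>t. cis (freq k m n * t) * (E k t * w (k+m) (k+m+n) (k+n) t)))
      \<le> (\<Sum>p\<in>nonres \<inter> low_pairs L k. ?D * (jap k powr (-s) / jap k))"
    proof (rule sum_norm_le)
      fix p assume "p \<in> nonres \<inter> low_pairs L k"
      then show "norm (case p of (m, n) \<Rightarrow> raman_coeff g1 g2 G k n *
        integral {0..T} (\<lambda>t. cis (freq k m n * t) * (E k t * w (k+m) (k+m+n) (k+n) t))) \<le> ?D * (jap k powr (-s) / jap k)"
        using low_integral_bound[OF k1 k2 L6 L1 c(2) c(1), of "fst p" "snd p"] by (simp add: case_prod_unfold)
    qed
    also have "\<dots> = real (card (nonres \<inter> low_pairs L k)) * (?D * (jap k powr (-s) / jap k))" by simp
    also have "\<dots> \<le> (12 * L\<^sup>2) * (?D * (jap k powr (-s) / jap k))"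
    proof (rule mult_right_mono)
      have "real (card (nonres \<inter> low_pairs L k)) \<le> real (card (low_pairs L k))"
        by (intro of_nat_mono card_mono) auto
      with card_low_pairs[OF L1, of k] show "real (card (nonres \<inter> low_pairs L k)) \<le> 12 * L\<^sup>2" by linarith
    qed (rule mult_nonneg_nonneg[OF D], simp)
    also have "\<dots> = 12 * ?D * (jap k powr (1/2) * (jap k powr (-s) / jap k))"
      using powr_powr[of "jap k" "1/4" 2] by (simp add: L_def)
    also have "jap k powr (1/2) * (jap k powr (-s) / jap k) = jap k powr (1/2 + (-s) - 1)"
      by (simp only: powr_diff powr_add powr_one[OF jap_nonneg] times_divide_eq_right)
    also have "12 * ?D * \<dots> \<le> 12 * ?D * jap k powr (-s - 1/16)"
      using D by (intro mult_left_mono powr_mono) auto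
    finally have low: "norm (\<Sum>(m, n)\<in>nonres \<inter> low_pairs L k. raman_coeff g1 g2 G k n *
        integral {0..T} (\<lambda>t. cis (freq k m n * t) * (E k t * w (k+m) (k+m+n) (k+n) t))) \<le> 12 * ?D * jap k powr (-s - 1/16)" .
    have "jap k powr (-s) * L powr (-(1/4)) = jap k powr (-s - 1/16)"
      by (simp add: L_def powr_powr flip: powr_add)
    with tail_integral_bound[OF k1 _, of L] k6 L1
    have tail: "cmod (integral {0..T} (\<lambda>t. E k t * (cis (phase \<alpha>1 \<alpha>2 k * t) * infsum (raman_term g1 g2 G (a t) k) (nonres - low_pairs L k))))
      \<le> 4 * R / (G * M) * jap k powr (-s - 1/16)" by simp
    have "cmod (E k T * v k T) \<le> 4 * B / (G * M * T) * (jap k powr (-s) / jap k)"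
      using k6 by (intro E_T_bound k1) auto
    also have "\<dots> \<le> 4 * B / (G * M * T) * jap k powr (-s - 1/16)"
      using B G M T by (intro mult_left_mono pw) auto
    finally have top: "cmod (E k T * v k T) \<le> 4 * B / (G * M * T) * jap k powr (-s - 1/16)" .
    have "v k 0 = E k T * v k T - (E k T * v k T - v k 0)" by simp
    also have "cmod \<dots> \<le> cmod (E k T * v k T) + cmod (E k T * v k T - v k 0)" by (rule norm_triangle_ineq4)
    also have "\<dots> \<le> 4 * B / (G * M * T) * jap k powr (-s - 1/16) + (12 * ?D * jap k powr (-s - 1/16) + 4 * R / (G * M) * jap k powr (-s - 1/16))"
      unfolding duhamel[of k L] by (intro add_mono top norm_triangle_le low tail)
    finally show ?thesis by (simp add: v_def algebra_simps)
  qed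
  then show ?thesis by blast
qed

end

section \<open>Fourier coefficients of integrable functions\<close>

abbreviation torus :: "real measure" where "torus \<equiv> lebesgue_on {0..2*pi}"

lemma torus_integral_eq: "torus_integral f = integral\<^sup>L torus f"
  unfolding torus_integral_def set_lebesgue_integral_def
  by (subst integral_restrict_space) auto

lemma torus_integrable_iff:
  fixes f :: "real \<Rightarrow> 'b::{banach, second_countable_topology}"
  shows "set_integrable lebesgue {0..2*pi} f \<longleftrightarrow> integrable torus f"
  unfolding set_integrable_def by (simp add: integrable_restrict_space)

lemma finite_measure_torus: "finite_measure torus"
  by (rule finite_measureI) (simp add: emeasure_restrict_space)

lemma continuous_borel_measurable_torus:
  "continuous_on UNIV (f :: real \<Rightarrow> complex) \<Longrightarrow> f \<in> borel_measurable torus"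
  by (intro measurable_restrict_space1 measurable_completion) (simp add: borel_measurable_continuous_onI)

lemma integrable_bounded_mult:
  fixes f g :: "'a \<Rightarrow> complex"
  assumes "integrable N f" "g \<in> borel_measurable N" "AE x in N. cmod (g x) \<le> C"
  shows "integrable N (\<lambda>x. f x * g x)"
proof (rule Bochner_Integration.integrable_bound)
  show "integrable N (\<lambda>x. C * f x)" using assms(1) by simp
  show "(\<lambda>x. f x * g x) \<in> borel_measurable N" using assms by measurable
  show "AE x in N. norm (f x * g x) \<le> norm (C * f x)"
    using assms(3)
  proof eventually_elim
    case (elim x)
    then have "cmod (f x) * cmod (g x) \<le> cmod (f x) * \<bar>C\<bar>" by (intro mult_left_mono) auto
    then show ?case by (simp add: norm_mult mult.commute)
  qed
qed

lemma integrable_torus_bounded: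
  assumes "g \<in> borel_measurable torus" "AE x in torus. cmod (g x) \<le> C"
  shows "integrable torus (g :: real \<Rightarrow> complex)"
  using finite_measure.integrable_const_bound[OF finite_measure_torus assms(2,1)] .

lemma fourier_eq: "fourier f k = 1 / complex_of_real (sqrt (2 * pi)) * integral\<^sup>L torus (\<lambda>x. cis (- (of_int k * x)) * f x)"
  by (simp add: fourier_def torus_integral_eq)

section \<open>Trigonometric polynomials and uniqueness of Fourier coefficients\<close>

inductive trig_poly :: "(real \<Rightarrow> complex) \<Rightarrow> bool" where
  monomial: "trig_poly (\<lambda>x. c * cis (of_int k * x))"
| add: "trig_poly f \<Longrightarrow> trig_poly g \<Longrightarrow> trig_poly (\<lambda>x. f x + g x)"

lemma trig_poly_continuous: "trig_poly f \<Longrightarrow> continuous_on UNIV f"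
  by (induction rule: trig_poly.induct) (auto intro!: continuous_intros)

lemma trig_poly_bounded: "trig_poly f \<Longrightarrow> \<exists>C. \<forall>x. cmod (f x) \<le> C"
proof (induction rule: trig_poly.induct)
  case (monomial c k)
  show ?case by (rule exI[of _ "cmod c"]) (simp add: norm_mult)
next
  case (add f g)
  then obtain C D where "\<And>x. cmod (f x) \<le> C" "\<And>x. cmod (g x) \<le> D" by auto
  then have "\<forall>x. cmod (f x + g x) \<le> C + D" by (meson add_mono norm_triangle_le)
  then show ?case by blast
qed

lemma trig_poly_mult: "trig_poly f \<Longrightarrow> trig_poly g \<Longrightarrow> trig_poly (\<lambda>x. f x * g x)"
proof (induction rule: trig_poly.induct)
  case (monomial c k)
  from \<open>trig_poly g\<close> show ?case
  proof (induction rule: trig_poly.induct)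
    case (monomial d l)
    have "(\<lambda>x. c * cis (of_int k * x) * (d * cis (of_int l * x))) = (\<lambda>x. (c * d) * cis (of_int (k + l) * x))"
      by (auto simp: algebra_simps simp flip: cis_mult)
    then show ?case by (metis trig_poly.monomial)
  next
    case (add f g)
    then show ?case by (simp add: distrib_left trig_poly.add)
  qed
next
  case (add f g)
  then show ?case by (simp add: distrib_right trig_poly.add)
qed

text \<open>A real-linear function of \<open>cis x\<close> is a combination of cos x and sin x,
  hence of \<open>cis x\<close> and \<open>cis (-x)\<close>. This lets polynomial approximation on
  the unit circle act as trigonometric approximation on the torus.\<close>

lemma trig_poly_real_polynomial:
  assumes "real_polynomial_function (p :: complex \<Rightarrow> real)"
  shows "trig_poly (\<lambda>x. complex_of_real (p (cis x)))"
  using assms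
proof (induction rule: real_polynomial_function.induct)
  case (linear f)
  interpret bounded_linear f by fact
  have "complex_of_real (f (cis x)) = of_real (f 1) * ((cis x + cis (-x)) / 2) + of_real (f \<i>) * ((cis x - cis (-x)) / (2 * \<i>))" for x
  proof -
    have "cis x = cos x *\<^sub>R 1 + sin x *\<^sub>R \<i>" by (simp add: complex_eq_iff)
    then have "f (cis x) = f (cos x *\<^sub>R 1 + sin x *\<^sub>R \<i>)" by (rule arg_cong)
    also have "\<dots> = cos x * f 1 + sin x * f \<i>" by (simp add: add scale)
    finally show ?thesis by (simp add: complex_eq_iff)
  qed
  then have *: "(\<lambda>x. complex_of_real (f (cis x))) = (\<lambda>x. (of_real (f 1) / 2 + of_real (f \<i>) / (2 * \<i>)) * cis (of_int 1 * x)
     + (of_real (f 1) / 2 - of_real (f \<i>) / (2 * \<i>)) * cis (of_int (-1) * x))"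
    by (auto simp: algebra_simps add_divide_distrib diff_divide_distrib)
  show ?case unfolding * by (intro trig_poly.intros)
next
  case (const c)
  show ?case using trig_poly.monomial[of "of_real c" 0] by simp
next
  case (add f g)
  then show ?case by (simp add: trig_poly.add)
next
  case (mult f g)
  then show ?case by (simp add: trig_poly_mult)
qed

text \<open>\<open>Arg2pi\<close> jumps at 1, which the equal endpoint values of \<open>h\<close>
  repair. The preimage of a closed set is the image under \<open>cis\<close> of a compact subset of
  [0, 2 pi], hence closed.\<close>

lemma continuous_on_circle_Arg2pi:
  fixes h :: "real \<Rightarrow> real"
  assumes h: "continuous_on {0..2*pi} h" "h 0 = h (2*pi)"
  shows "continuous_on (sphere 0 1) (\<lambda>z::complex. h (Arg2pi z))"
proof -
  let ?H = "\<lambda>z. h (Arg2pi z)"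
  have H: "?H (cis x) = h x" if "x \<in> {0..2*pi}" for x
  proof (cases "x = 2 * pi")
    case True
    then show ?thesis using h(2) Arg2pi_of_real[of 1] by (simp del: Arg2pi_of_real)
  next
    case False
    then have "Arg2pi (cis x) = x"
      using that by (intro Arg2pi_unique[of 1]) (auto simp: cis_conv_exp)
    then show ?thesis by simp
  qed
  have "closed (?H -` C \<inter> sphere 0 1)" if C: "closed C" for C
  proof -
    have "?H -` C \<inter> sphere 0 1 = cis ` (h -` C \<inter> {0..2*pi})"
    proof (intro equalityI subsetI)
      fix z assume z: "z \<in> ?H -` C \<inter> sphere 0 1"
      then have "z = cis (Arg2pi z)" using complex_norm_eq_1_exp[of z] by (simp add: cis_conv_exp)
      then show "z \<in> cis ` (h -` C \<inter> {0..2*pi})"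
        using z Arg2pi[of z] by (intro image_eqI[of _ _ "Arg2pi z"]) auto
    next
      fix z assume "z \<in> cis ` (h -` C \<inter> {0..2*pi})"
      then show "z \<in> ?H -` C \<inter> sphere 0 1" using H by auto
    qed
    moreover have "compact (h -` C \<inter> {0..2*pi})"
    proof -
      have "closed (h -` C \<inter> {0..2*pi})"
        using h(1) C by (subst (asm) continuous_on_closed_vimage) auto
      then have "compact ({0..2*pi} \<inter> (h -` C \<inter> {0..2*pi}))" by (intro compact_Int_closed) auto
      then show ?thesis by (simp add: Int_commute Int_left_commute Int_assoc)
    qed
    then have "compact (cis ` (h -` C \<inter> {0..2*pi}))"
      by (intro compact_continuous_image continuous_intros)
    ultimately show ?thesis by (simp add: compact_imp_closed)
  qed
  then show ?thesis by (subst continuous_on_closed_vimage) auto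
qed

context
  fixes f :: "real \<Rightarrow> complex"
  assumes f: "integrable torus f" and zero: "\<And>k. fourier f k = 0"
begin

lemma integral_trig_poly_zero: "trig_poly p \<Longrightarrow> integral\<^sup>L torus (\<lambda>x. f x * p x) = 0"
proof (induction rule: trig_poly.induct)
  case (monomial c k)
  have "integral\<^sup>L torus (\<lambda>x. f x * (c * cis (of_int k * x))) = c * integral\<^sup>L torus (\<lambda>x. cis (- (of_int (-k) * x)) * f x)"
    by (subst integral_mult_right_zero[symmetric]) (simp add: mult_ac)
  also have "integral\<^sup>L torus (\<lambda>x. cis (- (of_int (-k) * x)) * f x) = 0"
    using zero[of "-k"] by (simp add: fourier_eq)
  finally show ?case by simp
next
  case (add p q)
  have i: "integrable torus (\<lambda>x. f x * p x)" if "trig_poly p" for p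
    using trig_poly_bounded[OF that] trig_poly_continuous[OF that]
    by (auto intro!: integrable_bounded_mult f continuous_borel_measurable_torus)
  show ?case using add i by (simp add: distrib_left)
qed

text \<open>By Stone-Weierstrass on the circle, \<open>h\<close> is uniformly close to a
  trigonometric polynomial, against which \<open>f\<close> integrates to zero; the error is at most
  \<open>d\<close> times the L^1 norm of \<open>f\<close>.\<close>

lemma integral_continuous_real_zero:
  fixes h :: "real \<Rightarrow> real"
  assumes h: "continuous_on UNIV h" "h 0 = h (2*pi)"
  shows "integral\<^sup>L torus (\<lambda>x. f x * of_real (h x)) = 0"
proof -
  have hc: "continuous_on UNIV (\<lambda>x. complex_of_real (h x))" by (intro continuous_intros h)
  define I where "I = integral\<^sup>L torus (\<lambda>x. cmod (f x))"
  have "cmod (integral\<^sup>L torus (\<lambda>x. f x * of_real (h x))) \<le> 0 + e" if "e > 0" for e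
  proof -
    define d where "d = e / (I + 1)"
    have I: "0 \<le> I" by (simp add: I_def)
    have d: "d > 0" using that I by (simp add: d_def)
    have "continuous_on (sphere 0 1) (\<lambda>z::complex. h (Arg2pi z))"
      by (rule continuous_on_circle_Arg2pi[OF continuous_on_subset[OF h(1)] h(2)]) simp
    then obtain p where p: "real_polynomial_function p" "\<And>z. z \<in> sphere (0::complex) 1 \<Longrightarrow> \<bar>h (Arg2pi z) - p z\<bar> < d"
      using Stone_Weierstrass_real_polynomial_function[of "sphere (0::complex) 1" _ d] d by (metis compact_sphere)
    note tp = trig_poly_real_polynomial[OF p(1)]
    have ap: "\<bar>h x - p (cis x)\<bar> \<le> d" if x: "x \<in> {0..2*pi}" for x
    proof -
      have "h (Arg2pi (cis x)) = h x"
      proof (cases "x = 2 * pi")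
        case True
        then show ?thesis using h(2) Arg2pi_of_real[of 1] by (simp del: Arg2pi_of_real)
      next
        case False
        then have "Arg2pi (cis x) = x"
          using x by (intro Arg2pi_unique[of 1]) (auto simp: cis_conv_exp)
        then show ?thesis by simp
      qed
      then show ?thesis using p(2)[of "cis x"] by simp
    qed
    have ihp: "integrable torus (\<lambda>x. f x * of_real (h x - p (cis x)))"
    proof (rule integrable_bounded_mult[OF f])
      show "(\<lambda>x. complex_of_real (h x - p (cis x))) \<in> borel_measurable torus"
        unfolding of_real_diff by (intro continuous_borel_measurable_torus continuous_intros hc trig_poly_continuous tp)
      show "AE x in torus. cmod (of_real (h x - p (cis x))) \<le> d"
        by (rule AE_I2) (use ap in \<open>auto simp: space_restrict_space simp del: of_real_diff\<close>)
    qed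
    obtain C where "\<And>x. cmod (of_real (p (cis x))) \<le> C" using trig_poly_bounded[OF tp] by blast
    then have ip: "integrable torus (\<lambda>x. f x * of_real (p (cis x)))"
      by (intro integrable_bounded_mult[where C=C] f continuous_borel_measurable_torus trig_poly_continuous tp) auto
    have "integral\<^sup>L torus (\<lambda>x. f x * of_real (h x)) = integral\<^sup>L torus (\<lambda>x. f x * of_real (h x - p (cis x)) + f x * of_real (p (cis x)))"
      by (simp add: algebra_simps)
    also have "\<dots> = integral\<^sup>L torus (\<lambda>x. f x * of_real (h x - p (cis x)))"
      by (subst Bochner_Integration.integral_add[OF ihp ip]) (simp add: integral_trig_poly_zero[OF tp])
    also have "cmod \<dots> \<le> integral\<^sup>L torus (\<lambda>x. cmod (f x * of_real (h x - p (cis x))))"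
      by (rule integral_norm_bound)
    also have "\<dots> \<le> integral\<^sup>L torus (\<lambda>x. d * cmod (f x))"
    proof (rule integral_mono)
      show "integrable torus (\<lambda>x. cmod (f x * complex_of_real (h x - p (cis x))))" using ihp by (rule integrable_norm)
      show "integrable torus (\<lambda>x. d * cmod (f x))" using f by simp
      show "cmod (f x * complex_of_real (h x - p (cis x))) \<le> d * cmod (f x)" if "x \<in> space torus" for x
        using mult_left_mono[OF ap[of x], of "cmod (f x)"] that
        by (simp add: norm_mult space_restrict_space mult_ac del: of_real_diff)
    qed
    also have "\<dots> = d * I" by (simp add: I_def)
    also have "\<dots> \<le> e" using I that by (simp add: d_def field_simps)
    finally show ?thesis by simp
  qed
  then show ?thesis using field_le_epsilon[of "cmod (integral\<^sup>L torus (\<lambda>x. f x * of_real (h x)))" 0] by auto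
qed

lemma integral_continuous_zero:
  fixes h :: "real \<Rightarrow> complex"
  assumes h: "continuous_on UNIV h" "h 0 = h (2*pi)"
    and hb: "\<And>x. cmod (h x) \<le> C"
  shows "integral\<^sup>L torus (\<lambda>x. f x * h x) = 0"
proof -
  have i: "integrable torus (\<lambda>x. f x * of_real (Re (h x)))" "integrable torus (\<lambda>x. f x * of_real (Im (h x)))"
    using order_trans[OF abs_Re_le_cmod hb] order_trans[OF abs_Im_le_cmod hb]
    by (auto intro!: integrable_bounded_mult[OF f, where C=C] continuous_borel_measurable_torus continuous_intros h)
  have "(\<lambda>x. f x * h x) = (\<lambda>x. f x * of_real (Re (h x)) + (f x * of_real (Im (h x))) * \<i>)"
    by (auto simp: complex_eq_iff)
  then have "integral\<^sup>L torus (\<lambda>x. f x * h x) = integral\<^sup>L torus (\<lambda>x. f x * of_real (Re (h x)) + (f x * of_real (Im (h x))) * \<i>)"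
    by (rule arg_cong)
  also have "\<dots> = 0"
    using i h by (simp add: integral_continuous_real_zero continuous_intros)
  finally show ?thesis .
qed

text \<open>Test against continuous approximations of \<open>cnj f / (1 + \<bar>f\<bar>)\<close>, cut off near the endpoints.\<close>

lemma fourier_zero_imp_AE_zero: "AE x in torus. f x = 0"
proof -
  let ?I = "{0..2*pi}"
  have "f \<in> borel_measurable (lebesgue_on ?I)" using f by (rule borel_measurable_integrable)
  then have "f measurable_on ?I" by (simp add: measurable_on_iff_borel_measurable)
  then obtain N g where N: "negligible N" and g: "\<And>n. continuous_on UNIV (g n)"
    and lim: "\<And>x. x \<notin> N \<Longrightarrow> (\<lambda>n. g n x) \<longlonglongrightarrow> (if x \<in> ?I then f x else 0)"
    unfolding measurable_on_def by metis
  define \<theta> where "\<theta> n x = max 0 (min 1 (real n * (x * (2*pi - x))))" for n x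
  define h where "h n x = cnj (g n x) / of_real (1 + cmod (g n x)) * of_real (\<theta> n x)" for n :: nat and x
  have nz: "1 + cmod z \<noteq> 0" for z by (metis add_nonneg_eq_0_iff norm_ge_zero zero_le_one zero_neq_one)
  have nz': "complex_of_real (1 + cmod z) \<noteq> 0" for z using nz[of z] by (simp only: of_real_eq_0_iff not_False_eq_True)
  have hcont: "continuous_on UNIV (h n)" for n
    unfolding h_def \<theta>_def using nz' by (intro continuous_intros g) auto
  have h0: "h n 0 = h n (2*pi)" for n by (simp add: h_def \<theta>_def)
  have hb: "cmod (h n x) \<le> 1" for n x
  proof -
    have "\<bar>\<theta> n x\<bar> \<le> 1" by (simp add: \<theta>_def)
    moreover have "cmod (g n x) / \<bar>1 + cmod (g n x)\<bar> \<le> 1" by (simp add: divide_le_eq not_less)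
    ultimately have "(cmod (g n x) / \<bar>1 + cmod (g n x)\<bar>) * \<bar>\<theta> n x\<bar> \<le> 1 * 1" by (intro mult_mono) auto
    then show ?thesis by (simp add: h_def norm_mult norm_divide del: of_real_add of_real_1)
  qed
  let ?l = "\<lambda>x. f x * (cnj (f x) / of_real (1 + cmod (f x)))"
  have fm: "f \<in> borel_measurable torus" using f by simp
  have "continuous_on UNIV (\<lambda>z::complex. z * (cnj z / of_real (1 + cmod z)))"
    using nz' by (intro continuous_intros) auto
  from borel_measurable_continuous_on[OF this fm] have lm: "?l \<in> borel_measurable torus" .
  have "negligible (N \<union> {0, 2*pi})" using N by (intro negligible_Un) auto
  then have "AE x in lebesgue. x \<notin> N \<union> {0, 2*pi}" by (intro AE_not_in) (simp only: negligible_iff_null_sets)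
  then have ae: "AE x in torus. x \<notin> N \<union> {0, 2*pi}" by (subst AE_restrict_space_iff) auto
  have hl: "(\<lambda>n. f x * h n x) \<longlonglongrightarrow> ?l x" if x: "x \<in> space torus" "x \<notin> N \<union> {0, 2*pi}" for x
  proof -
    have xI: "x \<in> ?I" "0 < x" "x < 2*pi" using x by (auto simp: space_restrict_space)
    have "(\<lambda>n. g n x) \<longlonglongrightarrow> f x" using lim[of x] x xI by auto
    moreover have "(\<lambda>n. \<theta> n x) \<longlonglongrightarrow> 1"
    proof (rule tendsto_eventually)
      have p: "0 < x * (2*pi - x)" using xI by simp
      have "\<forall>\<^sub>F n in sequentially. 1 / (x * (2*pi - x)) \<le> real n"
        by (rule eventually_ge_at_top[THEN filterlim_real_sequentially[unfolded filterlim_def, THEN filter_leD, unfolded eventually_filtermap]])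
      then show "\<forall>\<^sub>F n in sequentially. \<theta> n x = 1"
      proof eventually_elim
        case (elim n)
        then have "1 \<le> real n * (x * (2*pi - x))" using p by (simp add: pos_divide_le_eq)
        then show ?case by (simp add: \<theta>_def)
      qed
    qed
    moreover note nz'[of "f x"]
    ultimately have "(\<lambda>n. f x * h n x) \<longlonglongrightarrow> f x * (cnj (f x) / of_real (1 + cmod (f x)) * of_real 1)"
      unfolding h_def by (intro tendsto_intros) 
    then show ?thesis by simp
  qed
  have "(\<lambda>n. integral\<^sup>L torus (\<lambda>x. f x * h n x)) \<longlonglongrightarrow> integral\<^sup>L torus ?l"
  proof (rule integral_dominated_convergence[where w = "\<lambda>x. cmod (f x)"])
    show "AE x in torus. (\<lambda>n. f x * h n x) \<longlonglongrightarrow> ?l x"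
      using ae by (rule AE_mp) (rule AE_I2, use hl in auto)
    show "AE x in torus. norm (f x * h n x) \<le> cmod (f x)" for n
      using hb by (intro AE_I2) (auto simp: norm_mult mult_left_le)
    show "(\<lambda>x. f x * h n x) \<in> borel_measurable torus" for n
      using fm continuous_borel_measurable_torus[OF hcont] by measurable
  qed (use lm f in auto)
  moreover have "integral\<^sup>L torus (\<lambda>x. f x * h n x) = 0" for n
    by (rule integral_continuous_zero[OF hcont h0 hb])
  ultimately have l0: "integral\<^sup>L torus ?l = 0" by (simp add: LIMSEQ_const_iff)
  \<comment> \<open>This function is nonnegative, bounded by |f|, and zero only where
    \<open>f\<close> is; the denominator makes it integrable although |f|^2 need not be.\<close>
  let ?r = "\<lambda>x. (cmod (f x))\<^sup>2 / (1 + cmod (f x))"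
  have eq: "?l x = of_real (?r x)" for x
    using complex_norm_square[of "f x"] by simp
  have "integral\<^sup>L torus (\<lambda>x. complex_of_real (?r x)) = 0" using l0 by (simp only: eq)
  then have "integral\<^sup>L torus ?r = 0" by (simp only: integral_complex_of_real of_real_eq_0_iff)
  moreover have "integrable torus ?r"
  proof (rule Bochner_Integration.integrable_bound[OF integrable_norm[OF f]])
    show "?r \<in> borel_measurable torus" using fm by measurable
    have "(cmod z)\<^sup>2 / (1 + cmod z) \<le> cmod z" for z
      by (simp add: divide_le_eq power2_eq_square algebra_simps add_pos_nonneg)
    then show "AE x in torus. norm (?r x) \<le> norm (cmod (f x))" by simp
  qed
  ultimately have "AE x in torus. ?r x = 0"
    by (subst (asm) integral_nonneg_eq_0_iff_AE) auto
  then show ?thesis by eventually_elim (use nz in auto)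
qed

end

section \<open>Absolutely convergent trigonometric series and products\<close>

lemma has_sum_int_limit:
  assumes "(f has_sum S) (UNIV :: int set)"
  shows "(\<lambda>n. \<Sum>k\<in>{- int n..int n}. f k) \<longlonglongrightarrow> S"
proof -
  have "filterlim (\<lambda>n. {- int n..int n}) (finite_subsets_at_top UNIV) sequentially"
    unfolding filterlim_finite_subsets_at_top
  proof (intro allI impI)
    fix X :: "int set" assume X: "finite X \<and> X \<subseteq> UNIV"
    then obtain N where N: "\<And>x. x \<in> X \<Longrightarrow> nat \<bar>x\<bar> \<le> N"
      using finite_nat_set_iff_bounded_le[of "(\<lambda>x. nat \<bar>x\<bar>) ` X"] by auto
    have "\<forall>\<^sub>F n in sequentially. N \<le> n" by (rule eventually_ge_at_top)
    then show "\<forall>\<^sub>F n in sequentially. finite {- int n..int n} \<and> X \<subseteq> {- int n..int n} \<and> {- int n..int n} \<subseteq> UNIV"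
    proof eventually_elim
      case (elim n)
      have "x \<in> {- int n..int n}" if "x \<in> X" for x using N[OF that] elim by auto
      then show ?case by blast
    qed
  qed
  from filterlim_compose[OF assms[unfolded has_sum_def] this] show ?thesis .
qed

definition trig_series :: "(int \<Rightarrow> complex) \<Rightarrow> real \<Rightarrow> complex" where
  "trig_series c x = infsum (\<lambda>k. c k * cis (of_int k * x)) UNIV"

lemma trig_series_has_sum:
  assumes "(\<lambda>k. cmod (c k)) summable_on UNIV"
  shows "((\<lambda>k. c k * cis (of_int k * x)) has_sum trig_series c x) UNIV"
proof -
  have "(\<lambda>k. norm (c k * cis (of_int k * x))) summable_on UNIV"
    using assms by (simp add: norm_mult)
  from has_sum_infsum[OF abs_summable_summable[OF this]] show ?thesis unfolding trig_series_def .
qed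

lemma trig_series_periodic: "torus_periodic (trig_series c)"
  unfolding torus_periodic_def trig_series_def
proof (intro allI infsum_cong)
  fix x k
  have "cis (of_int k * (x + 2 * pi)) = cis (of_int k * x) * cis (2 * pi * of_int k)"
    unfolding cis_mult by (simp add: algebra_simps)
  then show "c k * cis (of_int k * (x + 2 * pi)) = c k * cis (of_int k * x)" by simp
qed

lemma norm_trig_sum:
  assumes "(\<lambda>k. cmod (c k)) summable_on UNIV" "finite F"
  shows "cmod (\<Sum>k\<in>F. c k * cis (of_int k * x)) \<le> infsum (\<lambda>k. cmod (c k)) UNIV"
proof -
  have "cmod (\<Sum>k\<in>F. c k * cis (of_int k * x)) \<le> (\<Sum>k\<in>F. cmod (c k))"
    by (rule sum_norm_le) (simp add: norm_mult)
  also have "\<dots> \<le> infsum (\<lambda>k. cmod (c k)) UNIV"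
    using assms by (intro finite_sum_le_infsum) auto
  finally show ?thesis .
qed

lemma norm_trig_series:
  assumes "(\<lambda>k. cmod (c k)) summable_on UNIV"
  shows "cmod (trig_series c x) \<le> infsum (\<lambda>k. cmod (c k)) UNIV"
proof (rule tendsto_upperbound[OF tendsto_norm[OF has_sum_int_limit[OF trig_series_has_sum[OF assms]]]])
  show "\<forall>\<^sub>F n in sequentially. cmod (\<Sum>k\<in>{- int n..int n}. c k * cis (of_int k * x)) \<le> infsum (\<lambda>k. cmod (c k)) UNIV"
    by (intro always_eventually allI norm_trig_sum[OF assms]) simp
qed simp

lemma trig_series_measurable:
  assumes "(\<lambda>k. cmod (c k)) summable_on UNIV"
  shows "trig_series c \<in> borel_measurable torus"
proof (rule borel_measurable_LIMSEQ_metric)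
  show "(\<lambda>x. \<Sum>k\<in>{- int n..int n}. c k * cis (of_int k * x)) \<in> borel_measurable torus" for n
    by (intro continuous_borel_measurable_torus continuous_intros)
  show "(\<lambda>n. \<Sum>k\<in>{- int n..int n}. c k * cis (of_int k * x)) \<longlonglongrightarrow> trig_series c x" for x
    by (rule has_sum_int_limit[OF trig_series_has_sum[OF assms]])
qed

lemma integrable_trig_series_mult:
  assumes "(\<lambda>k. cmod (c k)) summable_on UNIV" and "integrable torus V"
  shows "integrable torus (\<lambda>x. V x * trig_series c x)"
  using norm_trig_series[OF assms(1)]
  by (intro integrable_bounded_mult[OF assms(2) trig_series_measurable[OF assms(1)]]) auto

text \<open>Dominated convergence along the symmetric partial sums, with the sum of the
  \<open>cmod (c k)\<close> times |V| as majorant, moves the integral inside the series.\<close>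

lemma integral_trig_series_mult:
  assumes c: "(\<lambda>k. cmod (c k)) summable_on UNIV" and V: "integrable torus V"
  shows "integral\<^sup>L torus (\<lambda>x. V x * trig_series c x)
    = infsum (\<lambda>k. c k * integral\<^sup>L torus (\<lambda>x. cis (of_int k * x) * V x)) UNIV"
proof -
  let ?C = "infsum (\<lambda>k. cmod (c k)) UNIV" and ?I = "\<lambda>k. integral\<^sup>L torus (\<lambda>x. cis (of_int k * x) * V x)"
  have Vm: "V \<in> borel_measurable torus" using V by simp
  have cm: "(\<lambda>x. cis (of_int k * x)) \<in> borel_measurable torus" for k :: int
    by (intro continuous_borel_measurable_torus continuous_intros)
  have iV: "integrable torus (\<lambda>x. cis (of_int k * x) * V x)" for k :: int
    using integrable_bounded_mult[OF V cm[of k], of 1] by (simp add: mult.commute)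
  have lim: "(\<lambda>n. integral\<^sup>L torus (\<lambda>x. V x * (\<Sum>k\<in>{- int n..int n}. c k * cis (of_int k * x)))) \<longlonglongrightarrow>
     integral\<^sup>L torus (\<lambda>x. V x * trig_series c x)"
  proof (rule integral_dominated_convergence[where w = "\<lambda>x. ?C * cmod (V x)"])
    show "(\<lambda>x. V x * trig_series c x) \<in> borel_measurable torus"
      using Vm trig_series_measurable[OF c] by measurable
    have "(\<lambda>x. \<Sum>k\<in>{- int n..int n}. c k * cis (of_int k * x)) \<in> borel_measurable torus" for n
      by (intro continuous_borel_measurable_torus continuous_intros)
    then show "(\<lambda>x. V x * (\<Sum>k\<in>{- int n..int n}. c k * cis (of_int k * x))) \<in> borel_measurable torus" for n
      using Vm by (intro borel_measurable_times)
    show "integrable torus (\<lambda>x. ?C * cmod (V x))" using V by simp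
    show "AE x in torus. (\<lambda>n. V x * (\<Sum>k\<in>{- int n..int n}. c k * cis (of_int k * x))) \<longlonglongrightarrow> V x * trig_series c x"
      by (intro AE_I2 tendsto_intros has_sum_int_limit[OF trig_series_has_sum[OF c]])
    show "AE x in torus. norm (V x * (\<Sum>k\<in>{- int n..int n}. c k * cis (of_int k * x))) \<le> ?C * cmod (V x)" for n
      unfolding norm_mult using mult_right_mono[OF norm_trig_sum[OF c]] by (intro AE_I2) (simp add: mult.commute)
  qed
  have eq: "integral\<^sup>L torus (\<lambda>x. V x * (\<Sum>k\<in>{- int n..int n}. c k * cis (of_int k * x))) = (\<Sum>k\<in>{- int n..int n}. c k * ?I k)" for n
  proof -
    have "integral\<^sup>L torus (\<lambda>x. V x * (\<Sum>k\<in>{- int n..int n}. c k * cis (of_int k * x)))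
      = integral\<^sup>L torus (\<lambda>x. \<Sum>k\<in>{- int n..int n}. c k * (cis (of_int k * x) * V x))"
      by (simp add: sum_distrib_left mult_ac)
    also have "\<dots> = (\<Sum>k\<in>{- int n..int n}. c k * ?I k)"
      using iV by (subst Bochner_Integration.integral_sum) auto
    finally show ?thesis .
  qed
  have "(\<lambda>k. c k * ?I k) summable_on UNIV"
  proof (rule abs_summable_summable, rule Infinite_Sum.abs_summable_on_comparison_test')
    show "(\<lambda>k. integral\<^sup>L torus (\<lambda>x. cmod (V x)) * cmod (c k)) summable_on UNIV"
      using c by (rule summable_on_cmult_right)
    have "cmod (?I k) \<le> integral\<^sup>L torus (\<lambda>x. cmod (V x))" for k
      using integral_norm_bound[of torus "\<lambda>x. cis (of_int k * x) * V x"] by (simp add: norm_mult)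
    then show "norm (c k * ?I k) \<le> integral\<^sup>L torus (\<lambda>x. cmod (V x)) * cmod (c k)" for k
      unfolding norm_mult by (simp add: mult.commute mult_left_mono)
  qed
  then have "(\<lambda>n. \<Sum>k\<in>{- int n..int n}. c k * ?I k) \<longlonglongrightarrow> infsum (\<lambda>k. c k * ?I k) UNIV"
    by (intro has_sum_int_limit has_sum_infsum)
  with lim[unfolded eq] show ?thesis by (rule LIMSEQ_unique)
qed

lemma fourier_trig_series_mult:
  assumes c: "(\<lambda>k. cmod (c k)) summable_on UNIV" and V: "integrable torus V"
  shows "fourier (\<lambda>x. V x * trig_series c x) k = infsum (\<lambda>j. c j * fourier V (k - j)) UNIV"
proof -
  let ?W = "\<lambda>x. cis (- (of_int k * x)) * V x"
  have W: "integrable torus ?W"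
    using integrable_bounded_mult[OF V continuous_borel_measurable_torus, of "\<lambda>x. cis (- (of_int k * x))" 1]
    by (simp add: mult.commute continuous_intros)
  have "fourier (\<lambda>x. V x * trig_series c x) k = 1 / complex_of_real (sqrt (2 * pi)) * integral\<^sup>L torus (\<lambda>x. ?W x * trig_series c x)"
    by (simp add: fourier_eq mult_ac)
  also have "integral\<^sup>L torus (\<lambda>x. ?W x * trig_series c x) = infsum (\<lambda>j. c j * integral\<^sup>L torus (\<lambda>x. cis (of_int j * x) * ?W x)) UNIV"
    by (rule integral_trig_series_mult[OF c W])
  also have "(\<lambda>j x. cis (of_int j * x) * ?W x) = (\<lambda>j x. cis (- (of_int (k - j) * x)) * V x)"
    unfolding mult.assoc[symmetric] cis_mult by (intro ext) (simp add: left_diff_distrib)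
  also have "1 / complex_of_real (sqrt (2 * pi)) * infsum (\<lambda>j. c j * integral\<^sup>L torus (\<lambda>x. cis (- (of_int (k - j) * x)) * V x)) UNIV
     = infsum (\<lambda>j. c j * fourier V (k - j)) UNIV"
    by (subst infsum_cmult_right'[symmetric]) (simp add: fourier_eq mult_ac)
  finally show ?thesis .
qed

lemma integrable_torus_const: "integrable torus (\<lambda>x. c :: complex)"
  by (rule integrable_torus_bounded[of _ "cmod c"]) auto

lemma fourier_one: "fourier (\<lambda>x. 1) k = (if k = 0 then complex_of_real (sqrt (2 * pi)) else 0)"
proof -
  have "integral\<^sup>L torus (\<lambda>x. cis (- (of_int k * x)) * 1) = integral {0..2*pi} (\<lambda>x. cis (- (of_int k * x)))"
  proof (subst lebesgue_integral_eq_integral)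
    show "integrable torus (\<lambda>x. cis (- (of_int k * x)) * 1)"
      by (intro integrable_torus_bounded[of _ 1] continuous_borel_measurable_torus continuous_intros) auto
  qed auto
  also have "\<dots> = (if k = 0 then 2 * pi else 0)"
  proof (cases "k = 0")
    case False
    have "((\<lambda>x. cis (- of_int k * x)) has_integral (cis (- of_int k * (2*pi)) / (- \<i> * of_int k) - cis (- of_int k * 0) / (- \<i> * of_int k))) {0..2*pi}"
    proof (rule fundamental_theorem_of_calculus)
      fix x
      show "((\<lambda>x. cis (- of_int k * x) / (- \<i> * of_int k)) has_vector_derivative cis (- of_int k * x)) (at x within {0..2*pi})"
        by (rule has_vector_derivative_eq_rhs[OF has_vector_derivative_divide[OF has_vector_derivative_cis]]) (use False in simp)
    qed simp
    moreover have "cis (- of_int k * (2*pi)) = 1"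
      using cis_multiple_2pi[of "of_int (-k)"] by (simp add: mult_ac)
    ultimately show ?thesis using False by (simp add: integral_unique)
  qed (simp add: scaleR_conv_of_real)
  finally show ?thesis
    by (simp add: fourier_eq real_div_sqrt flip: of_real_divide)
qed

lemma fourier_trig_series:
  assumes c: "(\<lambda>k. cmod (c k)) summable_on UNIV"
  shows "fourier (trig_series c) k = complex_of_real (sqrt (2 * pi)) * c k"
proof -
  have "fourier (\<lambda>x. 1 * trig_series c x) k = infsum (\<lambda>j. c j * fourier (\<lambda>x. 1) (k - j)) UNIV"
    by (rule fourier_trig_series_mult[OF c integrable_torus_const])
  also have "\<dots> = infsum (\<lambda>j. c j * fourier (\<lambda>x. 1) (k - j)) {k}"
    by (rule infsum_cong_neutral) (auto simp: fourier_one)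
  also have "\<dots> = complex_of_real (sqrt (2 * pi)) * c k" by (simp add: fourier_one)
  finally show ?thesis by simp
qed

lemma fourier_cmult: "fourier (\<lambda>x. c * f x) k = c * fourier f k"
  by (simp add: fourier_eq mult.left_commute[of _ c])

lemma integrable_cis_mult: "integrable torus f \<Longrightarrow> integrable torus (\<lambda>x. cis (r * x) * f x)"
  using integrable_bounded_mult[OF _ continuous_borel_measurable_torus, of f "\<lambda>x. cis (r * x)" 1]
  by (simp add: mult.commute continuous_intros)

lemma fourier_diff:
  assumes "integrable torus f" "integrable torus g"
  shows "fourier (\<lambda>x. f x - g x) k = fourier f k - fourier g k"
  using integrable_cis_mult[OF assms(1), of "- of_int k"] integrable_cis_mult[OF assms(2), of "- of_int k"]
  by (simp add: fourier_eq right_diff_distrib)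

text \<open>Both sides are integrable with the same Fourier coefficients, so their difference
  vanishes almost everywhere.\<close>

lemma AE_eq_trig_series:
  assumes f: "integrable torus f" and c: "(\<lambda>k. cmod (fourier f k)) summable_on UNIV"
  shows "AE x in torus. f x = trig_series (fourier f) x / complex_of_real (sqrt (2 * pi))"
proof -
  let ?S = "trig_series (fourier f)" and ?r = "1 / complex_of_real (sqrt (2 * pi))"
  have S: "integrable torus (\<lambda>x. ?r * ?S x)"
    using integrable_trig_series_mult[OF c integrable_torus_const] .
  have "fourier (\<lambda>x. f x - ?r * ?S x) k = 0" for k
    by (simp only: fourier_diff[OF f S] fourier_cmult fourier_trig_series[OF c]) simp
  then have "AE x in torus. f x - ?r * ?S x = 0"
    using f S by (intro fourier_zero_imp_AE_zero) auto
  then show ?thesis by eventually_elim simp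
qed

text \<open>Replacing \<open>f\<close> by its bounded series makes the product with a merely
  integrable \<open>V\<close> meaningful and its coefficients a convolution. Applied with V =
  \<open>cnj f\<close> and then with V = |f|^2, this reaches the cubic term.\<close>

lemma
  assumes f: "integrable torus f" and c: "(\<lambda>k. cmod (fourier f k)) summable_on UNIV" and V: "integrable torus V"
  shows integrable_mult_series: "integrable torus (\<lambda>x. V x * f x)"
    and fourier_mult: "fourier (\<lambda>x. V x * f x) k = 1 / complex_of_real (sqrt (2 * pi)) * infsum (\<lambda>j. fourier f j * fourier V (k - j)) UNIV"
proof -
  let ?S = "trig_series (fourier f)" and ?r = "1 / complex_of_real (sqrt (2 * pi))"
  note ae = AE_eq_trig_series[OF f c]
  have i: "integrable torus (\<lambda>x. ?r * (V x * ?S x))"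
    using integrable_trig_series_mult[OF c V] by (rule integrable_mult_right)
  have m: "(\<lambda>x. V x * f x) \<in> borel_measurable torus"
    using f V by (intro borel_measurable_times) auto
  have ae': "AE x in torus. ?r * (V x * ?S x) = V x * f x" using ae by eventually_elim simp
  show "integrable torus (\<lambda>x. V x * f x)"
    by (rule integrable_cong_AE_imp[OF i m]) (use ae' in eventually_elim, simp)
  have cm: "(\<lambda>x. cis (- (of_int k * x))) \<in> borel_measurable torus"
    by (intro continuous_borel_measurable_torus continuous_intros)
  have "AE x in torus. cis (- (of_int k * x)) * (V x * f x) = cis (- (of_int k * x)) * (?r * (V x * ?S x))"
    using ae' by eventually_elim simp
  then have "integral\<^sup>L torus (\<lambda>x. cis (- (of_int k * x)) * (V x * f x)) = integral\<^sup>L torus (\<lambda>x. cis (- (of_int k * x)) * (?r * (V x * ?S x)))"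
    by (rule integral_cong_AE[OF borel_measurable_times[OF cm m] borel_measurable_times[OF cm borel_measurable_integrable[OF i]]])
  then have "fourier (\<lambda>x. V x * f x) k = fourier (\<lambda>x. ?r * (V x * ?S x)) k"
    unfolding fourier_eq by (rule arg_cong)
  then show "fourier (\<lambda>x. V x * f x) k = ?r * infsum (\<lambda>j. fourier f j * fourier V (k - j)) UNIV"
    by (simp only: fourier_cmult fourier_trig_series_mult[OF c V])
qed

lemma fourier_cnj: "fourier (\<lambda>x. cnj (f x)) k = cnj (fourier f (- k))"
proof -
  have "integral\<^sup>L torus (\<lambda>x. cis (- (of_int k * x)) * cnj (f x)) = cnj (integral\<^sup>L torus (\<lambda>x. cis (- (of_int (-k) * x)) * f x))"
    using Bochner_Integration.integral_cnj[of torus "\<lambda>x. cis (- (of_int (-k) * x)) * f x"] by (simp add: cis_cnj)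
  then show ?thesis by (simp add: fourier_eq)
qed

section \<open>The nonlinearity in Fourier coefficients\<close>

lemma jap_powr_summable:
  assumes "r < -1" shows "(\<lambda>k. jap k powr r) summable_on UNIV"
proof -
  have "summable (\<lambda>n. of_nat (Suc n) powr r)"
    using assms by (subst summable_Suc_iff) (simp add: summable_real_powr_iff)
  then have "(\<lambda>n. real (Suc n) powr r) summable_on UNIV"
    by (subst summable_on_UNIV_nonneg_real_iff) auto
  then have 1: "(\<lambda>n. jap (int n) powr r) summable_on UNIV" "(\<lambda>n. jap (- int n) powr r) summable_on UNIV"
    by (simp_all add: jap_def add.commute)
  have "(\<lambda>k. jap k powr r) summable_on range int"
    by (subst summable_on_reindex) (use 1(1) in \<open>simp_all only: inj_on_of_nat o_def\<close>)
  moreover have "(\<lambda>k. jap k powr r) summable_on range (\<lambda>n. - int n)"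
    by (subst summable_on_reindex) (use 1(2) in \<open>simp_all only: o_def\<close>, simp add: inj_on_def)
  ultimately have "(\<lambda>k. jap k powr r) summable_on (range int \<union> range (\<lambda>n. - int n))"
    by (rule summable_on_union)
  moreover have "k \<in> range int \<union> range (\<lambda>n. - int n)" for k
    by (cases k rule: int_cases2) auto
  then have "range int \<union> range (\<lambda>n. - int n) = UNIV" by blast
  ultimately show ?thesis by simp
qed

text \<open>The weight factors as x y with x = \<open>jap k powr s * cmod (a k)\<close> and y =
  \<open>jap k powr (1/4 - s)\<close>, and x y \<le> x^2 + y^2, where y^2 is at most
  \<open>jap k powr (-3/2)\<close> by s \<ge> 1. The summand 1 in the constant serves the pointwise
  bound, through x \<le> x^2 + 1.\<close>

lemma sobolev_decaying:
  assumes s: "s \<ge> 1" and su: "sobolev_summable s a"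
    and Q: "(\<Sum>\<^sub>\<infinity>k. (jap k powr s * cmod (a k))\<^sup>2) \<le> Q"
  shows "decaying s (Q + 1 + (\<Sum>\<^sub>\<infinity>k. jap k powr (-3/2))) a"
  unfolding decaying_def
proof (intro conjI allI)
  let ?x = "\<lambda>k. jap k powr s * cmod (a k)" and ?Z = "\<Sum>\<^sub>\<infinity>k. jap k powr (-3/2)"
  have sx: "(\<lambda>k. (?x k)\<^sup>2) summable_on UNIV" using su by (simp add: sobolev_summable_def)
  have sz: "(\<lambda>k. jap k powr (-3/2)) summable_on UNIV" by (rule jap_powr_summable) simp
  have Z: "0 \<le> ?Z" by (intro infsum_nonneg) auto
  have le: "wt a k \<le> (?x k)\<^sup>2 + jap k powr (-3/2)" for k
  proof -
    let ?y = "jap k powr (1/4 - s)"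
    have "wt a k = ?x k * ?y" by (simp add: wt_def powr_diff)
    also have "\<dots> \<le> (?x k)\<^sup>2 + ?y\<^sup>2"
    proof -
      have "0 \<le> ?x k * ?y" by simp
      then show ?thesis using sum_squares_bound[of "?x k" ?y] by linarith
    qed
    also have "?y\<^sup>2 = jap k powr (1/2 - 2 * s)"
      by (simp add: power2_eq_square flip: powr_add)
    also have "\<dots> \<le> jap k powr (-3/2)" using s by (intro powr_mono) auto
    finally show ?thesis by simp
  qed
  have ssum: "(\<lambda>k. (?x k)\<^sup>2 + jap k powr (-3/2)) summable_on UNIV" by (intro summable_on_add sx sz)
  show wts: "wt a summable_on UNIV"
    by (rule summable_on_comparison_test[OF ssum]) (use le in auto)
  have "infsum (wt a) UNIV \<le> (\<Sum>\<^sub>\<infinity>k. (?x k)\<^sup>2 + jap k powr (-3/2))"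
    by (rule infsum_mono[OF wts ssum le])
  also have "\<dots> \<le> Q + ?Z" unfolding infsum_add[OF sx sz] using Q by (rule add_right_mono)
  finally show "infsum (wt a) UNIV \<le> Q + 1 + ?Z" by simp
  fix k
  have "(?x k)\<^sup>2 = (\<Sum>k\<in>{k}. (?x k)\<^sup>2)" by simp
  also have "\<dots> \<le> (\<Sum>\<^sub>\<infinity>k. (?x k)\<^sup>2)" by (intro finite_sum_le_infsum sx) auto
  finally have "(?x k)\<^sup>2 \<le> Q" using Q by simp
  moreover have "?x k \<le> (?x k)\<^sup>2 + 1"
  proof -
    have "0 \<le> ?x k" by simp
    then show ?thesis using sum_squares_bound[of "?x k" 1] unfolding power_one mult_1_right by linarith
  qed
  ultimately show "?x k \<le> Q + 1 + ?Z" using Z by simp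
qed

lemma decaying_norm_summable:
  assumes "decaying s B a" shows "(\<lambda>k. cmod (a k)) summable_on UNIV"
  by (rule summable_on_comparison_test[OF decayingD(2)[OF assms]]) (auto simp: norm_le_wt)

lemma infsum_shift: "infsum (\<lambda>n. f (k + n)) (UNIV :: int set) = infsum f UNIV"
  by (rule infsum_reindex_bij_witness[of _ "\<lambda>j. j - k" "\<lambda>n. k + n"]) auto

lemma infsum_neg: "infsum (\<lambda>n. f (- n)) (UNIV :: int set) = infsum f UNIV"
  by (rule infsum_reindex_bij_witness[of _ uminus uminus]) auto

abbreviation abs_sq :: "(real \<Rightarrow> complex) \<Rightarrow> real \<Rightarrow> complex" where
  "abs_sq f \<equiv> \<lambda>x. complex_of_real ((cmod (f x))\<^sup>2)"

lemma abs_sq_eq: "abs_sq f = (\<lambda>x. cnj (f x) * f x)"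
  unfolding complex_norm_square by (simp add: mult.commute)

lemma xderiv_cis: "xderiv (\<lambda>x. cis (- (of_int k * x))) = (\<lambda>x. - \<i> * of_int k * cis (- (of_int k * x)))"
proof
  fix x :: real
  have "((\<lambda>x. cis (- of_int k * x)) has_vector_derivative \<i> * of_real (- of_int k) * cis (- of_int k * x)) (at x)"
    by (rule has_vector_derivative_cis)
  then show "xderiv (\<lambda>x. cis (- (of_int k * x))) x = - \<i> * of_int k * cis (- (of_int k * x))"
    unfolding xderiv_def by (intro vector_derivative_at) simp
qed

lemma distr_fourier_dx_abs_sq: "distr_fourier (dx_abs_sq f) j = \<i> * of_int j * fourier (abs_sq f) j"
proof -
  have "torus_integral (\<lambda>x. abs_sq f x * (- \<i> * of_int j * cis (- (of_int j * x))))
     = - \<i> * of_int j * torus_integral (\<lambda>x. cis (- (of_int j * x)) * abs_sq f x)"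
    unfolding torus_integral_eq by (subst integral_mult_right_zero[symmetric]) (simp add: mult_ac del: of_real_power)
  then show ?thesis
    unfolding distr_fourier_def dx_abs_sq_def distr_deriv_def distr_of_def xderiv_cis fourier_def
    by (simp del: of_real_power)
qed

lemma fourier_modulate: "fourier (\<lambda>x. f x * cis (- (of_int k * x))) j = fourier f (k + j)"
proof -
  have "cis (- (of_int j * x)) * (f x * cis (- (of_int k * x))) = cis (- (of_int (k + j) * x)) * f x" for x
    by (simp add: mult.commute[of "f x"] mult.assoc[symmetric] cis_mult) (simp add: distrib_right add.commute)
  then show ?thesis unfolding fourier_eq by (simp only:)
qed

lemma pairing_dx_abs_sq:
  "pairing (dx_abs_sq f) (\<lambda>x. f x * cis (- (of_int k * x)))
    = infsum (\<lambda>n. - \<i> * of_int n * (fourier f (k + n) * fourier (abs_sq f) (- n))) UNIV"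
proof -
  have "pairing (dx_abs_sq f) (\<lambda>x. f x * cis (- (of_int k * x)))
    = infsum (\<lambda>j. \<i> * of_int j * fourier (abs_sq f) j * fourier f (k + - j)) UNIV"
    unfolding pairing_def distr_fourier_dx_abs_sq fourier_modulate ..
  also have "\<dots> = infsum (\<lambda>n. \<i> * of_int (- n) * fourier (abs_sq f) (- n) * fourier f (k + - (- n))) UNIV"
    by (rule infsum_neg[where f = "\<lambda>j. \<i> * of_int j * fourier (abs_sq f) j * fourier f (k + - j)", symmetric])
  finally show ?thesis by (simp add: mult_ac del: of_real_power)
qed

context
  fixes f :: "real \<Rightarrow> complex" and s B :: real
  assumes f: "integrable torus f" and a: "decaying s B (fourier f)" and s: "s \<ge> 1"
begin

lemma integrable_abs_sq: "integrable torus (abs_sq f)"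
  and integrable_cubic: "integrable torus (\<lambda>x. abs_sq f x * f x)"
proof -
  note su = decaying_norm_summable[OF a]
  have "integrable torus (\<lambda>x. cnj (f x))" using f by simp
  then show *: "integrable torus (abs_sq f)" unfolding abs_sq_eq by (rule integrable_mult_series[OF f su])
  show "integrable torus (\<lambda>x. abs_sq f x * f x)" by (rule integrable_mult_series[OF f su *])
qed

lemma fourier_abs_sq: "complex_of_real (sqrt (2 * pi)) * fourier (abs_sq f) (- n) = infsum (\<lambda>m. fourier f (k + m) * cnj (fourier f (k + m + n))) UNIV"
proof -
  have i: "integrable torus (\<lambda>x. cnj (f x))" using f by simp
  have "complex_of_real (sqrt (2 * pi)) * fourier (abs_sq f) (- n) = infsum (\<lambda>j. fourier f j * fourier (\<lambda>x. cnj (f x)) (- n - j)) UNIV"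
    unfolding abs_sq_eq fourier_mult[OF f decaying_norm_summable[OF a] i] by simp
  also have "\<dots> = infsum (\<lambda>j. fourier f j * cnj (fourier f (j + n))) UNIV"
    by (simp add: fourier_cnj)
  also have "\<dots> = infsum (\<lambda>m. fourier f (k + m) * cnj (fourier f (k + m + n))) UNIV"
    by (rule infsum_shift[where f = "\<lambda>j. fourier f j * cnj (fourier f (j + n))", symmetric])
  finally show ?thesis .
qed

text \<open>For fixed \<open>n\<close> the coefficient does not depend on \<open>m\<close>, and the
  sum over \<open>m\<close> is the convolution giving the coefficient of |f|^2 at - n. Absolute
  convergence permits this order of summation.\<close>

lemma raman_sum_iterated:
  "infsum (raman_term g1 g2 G (fourier f) k) UNIV =
    complex_of_real (sqrt (2 * pi)) * infsum (\<lambda>n. raman_coeff g1 g2 G k n * (fourier f (k + n) * fourier (abs_sq f) (- n))) UNIV"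
proof -
  let ?a = "fourier f" and ?t = "raman_term g1 g2 G (fourier f) k"
  have "(\<lambda>(n, m). ?t (m, n)) summable_on UNIV"
    using raman_term_summable[OF a s, of g1 g2 G k UNIV]
    by (subst summable_on_reindex_bij_witness[of _ prod.swap prod.swap UNIV ?t]) auto
  then have "infsum (\<lambda>n. infsum (\<lambda>m. ?t (m, n)) UNIV) UNIV = infsum (\<lambda>(n, m). ?t (m, n)) (Sigma UNIV (\<lambda>_. UNIV))"
    by (intro infsum_Sigma'_banach) simp
  also have "\<dots> = infsum ?t UNIV"
    by (rule infsum_reindex_bij_witness[of _ prod.swap prod.swap]) auto
  finally have "infsum ?t UNIV = infsum (\<lambda>n. infsum (\<lambda>m. ?t (m, n)) UNIV) UNIV" ..
  also have "\<dots> = infsum (\<lambda>n. complex_of_real (sqrt (2 * pi)) * (raman_coeff g1 g2 G k n * (?a (k + n) * fourier (abs_sq f) (- n)))) UNIV"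
  proof (rule infsum_cong)
    fix n
    have "infsum (\<lambda>m. ?t (m, n)) UNIV = infsum (\<lambda>m. (raman_coeff g1 g2 G k n * ?a (k + n)) * (?a (k + m) * cnj (?a (k + m + n)))) UNIV"
      by (simp add: raman_term_def mult_ac)
    also have "\<dots> = (raman_coeff g1 g2 G k n * ?a (k + n)) * (complex_of_real (sqrt (2 * pi)) * fourier (abs_sq f) (- n))"
      unfolding infsum_cmult_right' fourier_abs_sq[of n k] ..
    finally show "infsum (\<lambda>m. ?t (m, n)) UNIV = complex_of_real (sqrt (2 * pi)) * (raman_coeff g1 g2 G k n * (?a (k + n) * fourier (abs_sq f) (- n)))"
      by (simp add: mult_ac del: of_real_power)
  qed
  finally show ?thesis unfolding infsum_cmult_right' .
qed

text \<open>Every product of functions brings a factor 1 / sqrt (2 pi) to the coefficients, and a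
  cubic term contains two products; hence the division by 2 pi. The pairing already contains one of
  these factors, while the other stays visible in front of it.\<close>

lemma raman_sum_fourier:
  "infsum (raman_term (\<gamma>1 / (2*pi)) (\<gamma>2 / (2*pi)) (\<Gamma> / (2*pi)) (fourier f) k) UNIV
   = \<i> * of_real (\<gamma>1 + \<gamma>2 * of_int k) * fourier (\<lambda>x. abs_sq f x * f x) k
     - \<i> * of_real \<Gamma> / of_real (sqrt (2 * pi)) * pairing (dx_abs_sq f) (\<lambda>x. f x * cis (- (of_int k * x)))"
proof -
  let ?a = "fourier f" and ?r = "complex_of_real (sqrt (2 * pi))"
  let ?g1 = "\<gamma>1 / (2*pi)" and ?g2 = "\<gamma>2 / (2*pi)" and ?G = "\<Gamma> / (2*pi)"
  let ?F = "fourier (abs_sq f)"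
  have rr: "?r * ?r = of_real (2 * pi)" by (simp flip: of_real_mult)
  have r0: "?r \<noteq> 0" by simp
  have "raman_term ?g1 ?g2 ?G ?a k = (\<lambda>p. raman_term ?g1 ?g2 0 ?a k p + raman_term 0 0 ?G ?a k p)"
    by (auto simp: raman_term_def raman_coeff_def Complex_eq algebra_simps)
  then have "infsum (raman_term ?g1 ?g2 ?G ?a k) UNIV = infsum (raman_term ?g1 ?g2 0 ?a k) UNIV + infsum (raman_term 0 0 ?G ?a k) UNIV"
    by (simp add: infsum_add raman_term_summable[OF a s])
  also have "infsum (raman_term ?g1 ?g2 0 ?a k) UNIV = ?r * ((\<i> * of_real (?g1 + ?g2 * of_int k)) * infsum (\<lambda>n. ?a (k + n) * ?F (- n)) UNIV)"
    unfolding raman_sum_iterated infsum_cmult_right'[symmetric] by (simp add: raman_coeff_def Complex_eq del: of_real_power)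
  also have "infsum (\<lambda>n. ?a (k + n) * ?F (- n)) UNIV = infsum (\<lambda>n. ?a (k + n) * ?F (k - (k + n))) UNIV" by simp
  also have "\<dots> = infsum (\<lambda>j. ?a j * ?F (k - j)) UNIV"
    by (rule infsum_shift[where f = "\<lambda>j. ?a j * ?F (k - j)"])
  also have "\<dots> = ?r * fourier (\<lambda>x. abs_sq f x * f x) k"
    by (subst fourier_mult[OF f decaying_norm_summable[OF a] integrable_abs_sq]) simp
  also have "?r * ((\<i> * of_real (?g1 + ?g2 * of_int k)) * (?r * fourier (\<lambda>x. abs_sq f x * f x) k))
     = (?r * ?r) * (\<i> * of_real (?g1 + ?g2 * of_int k)) * fourier (\<lambda>x. abs_sq f x * f x) k" by (simp only: mult_ac)
  also have "(?r * ?r) * (\<i> * of_real (?g1 + ?g2 * of_int k)) = \<i> * of_real (\<gamma>1 + \<gamma>2 * of_int k)"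
  proof -
    have "complex_of_real (?g1 + ?g2 * of_int k) = of_real (\<gamma>1 + \<gamma>2 * of_int k) / of_real (2 * pi)"
      by (simp add: add_divide_distrib)
    then show ?thesis unfolding rr by simp
  qed
  also have "infsum (raman_term 0 0 ?G ?a k) UNIV = ?r * infsum (\<lambda>n. (- \<i> * of_real ?G) * (- \<i> * of_int n * (?a (k + n) * ?F (- n)))) UNIV"
    unfolding raman_sum_iterated by (intro arg_cong[where f = "(*) ?r"] infsum_cong) (simp add: raman_coeff_def Complex_eq mult_ac del: of_real_power)
  also have "\<dots> = ?r * (- \<i> * of_real ?G) * pairing (dx_abs_sq f) (\<lambda>x. f x * cis (- (of_int k * x)))"
    unfolding infsum_cmult_right' pairing_dx_abs_sq by (simp only: mult.assoc)
  also have "?r * (- \<i> * of_real ?G) = - (\<i> * of_real \<Gamma> / ?r)"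
    using rr r0 by (simp add: field_simps)
  finally show ?thesis by simp
qed

end

section \<open>From the weak formulation to ordinary differential equations\<close>

text \<open>The case \<open>p\<close> = 1 is the cutoff proper. The polynomial is carried along
  because all derivatives are again of this form, which makes smoothness an induction over arbitrary
  \<open>p\<close>.\<close>

definition cutoff :: "real \<Rightarrow> real \<Rightarrow> real poly \<Rightarrow> real \<Rightarrow> real" where
  "cutoff e b p t = (if t < b then poly p (1 / (b - t)) * exp (- e / (b - t)) else 0)"

text \<open>With x = 1 / (b - t), whose derivative is x^2, the derivative of p(x) exp(- e x) is x^2
  (p'(x) - e p(x)) exp(- e x).\<close>

definition cutoff_deriv :: "real \<Rightarrow> real poly \<Rightarrow> real poly" where
  "cutoff_deriv e p = [:0, 0, 1:] * (pderiv p - smult e p)"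

lemma poly_exp_decay:
  assumes "e > 0" shows "((\<lambda>x. poly p x * exp (- e * x)) \<longlongrightarrow> (0::real)) at_top"
proof -
  have mono: "((\<lambda>x. x ^ k * exp (- e * x)) \<longlongrightarrow> 0) at_top" for k
  proof -
    have "filterlim (\<lambda>x. e * x) at_top at_top"
      using assms by (intro filterlim_tendsto_pos_mult_at_top[OF tendsto_const] filterlim_ident) auto
    then have "((\<lambda>x. (e * x) ^ k / exp (e * x)) \<longlongrightarrow> 0) at_top"
      by (rule filterlim_compose[OF tendsto_power_div_exp_0])
    then have "((\<lambda>x. (1 / e ^ k) * ((e * x) ^ k / exp (e * x))) \<longlongrightarrow> 0) at_top"
      by (rule tendsto_mult_right_zero)
    then show ?thesis using assms by (simp add: power_mult_distrib exp_minus field_simps)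
  qed
  have "((\<lambda>x. \<Sum>k\<le>degree p. coeff p k * (x ^ k * exp (- e * x))) \<longlongrightarrow> (\<Sum>k\<le>degree p. coeff p k * 0)) at_top"
    by (intro tendsto_intros mono)
  then show ?thesis by (simp add: poly_altdef sum_distrib_right mult.assoc)
qed

lemma cutoff_has_derivative:
  assumes e: "e > 0"
  shows "(cutoff e b p has_real_derivative cutoff e b (cutoff_deriv e p) t) (at t)"
proof -
  consider "t < b" | "t > b" | "t = b" by linarith
  then show ?thesis
  proof cases
    case 1
    let ?x = "1 / (b - t)"
    have x: "((\<lambda>t. 1 / (b - t)) has_real_derivative ?x\<^sup>2) (at t)"
      using 1 by (auto intro!: derivative_eq_intros simp: power2_eq_square)
    have "((\<lambda>t. poly p (1 / (b - t))) has_real_derivative poly (pderiv p) ?x * ?x\<^sup>2) (at t)"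
      by (rule DERIV_chain2[OF poly_DERIV x])
    moreover have "((\<lambda>t. exp (- e * (1 / (b - t)))) has_real_derivative exp (- e * ?x) * (- e * ?x\<^sup>2)) (at t)"
      by (intro DERIV_chain2[OF DERIV_exp] DERIV_cmult x)
    ultimately have "((\<lambda>t. poly p (1 / (b - t)) * exp (- e * (1 / (b - t)))) has_real_derivative
      poly (pderiv p) ?x * ?x\<^sup>2 * exp (- e * ?x) + exp (- e * ?x) * (- e * ?x\<^sup>2) * poly p ?x) (at t)"
      by (rule DERIV_mult)
    moreover have "poly (pderiv p) ?x * ?x\<^sup>2 * exp (- e * ?x) + exp (- e * ?x) * (- e * ?x\<^sup>2) * poly p ?x
      = poly (cutoff_deriv e p) ?x * exp (- e * ?x)"
      unfolding cutoff_deriv_def poly_mult poly_diff poly_smult poly_pCons poly_0 by (simp only: algebra_simps power2_eq_square mult_zero_right add_0_left add_0_right mult_1_right)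
    ultimately have "((\<lambda>t. poly p (1 / (b - t)) * exp (- e / (b - t))) has_real_derivative
      cutoff e b (cutoff_deriv e p) t) (at t)"
      using 1 by (simp add: cutoff_def)
    then show ?thesis
      by (rule has_field_derivative_transform_within_open[of _ _ _ "{..<b}"]) (use 1 in \<open>auto simp: cutoff_def\<close>)
  next
    case 2
    have "((\<lambda>t. 0) has_real_derivative 0) (at t)" by simp
    then have "(cutoff e b p has_real_derivative 0) (at t)"
      by (rule has_field_derivative_transform_within_open[of _ _ _ "{b<..}"]) (use 2 in \<open>auto simp: cutoff_def\<close>)
    then show ?thesis using 2 by (simp add: cutoff_def)
  next
    case 3
    have "((\<lambda>h. (cutoff e b p (b + h) - cutoff e b p b) / h) \<longlongrightarrow> 0) (at 0)"
    proof (rule filterlim_split_at_real)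
      have "filterlim (\<lambda>h::real. inverse (- h)) at_top (at_left 0)"
        unfolding filterlim_at_left_to_right using filterlim_inverse_at_top_right by simp
      \<comment> \<open>With x = - 1/h for h < 0, division of the increment by \<open>h\<close> is
        multiplication by - x, hence the polynomial - x p(x).\<close>
      from filterlim_compose[OF poly_exp_decay[OF e, of "- [:0, 1:] * p"] this]
      have "((\<lambda>h. poly (- [:0, 1:] * p) (inverse (- h)) * exp (- e * inverse (- h))) \<longlongrightarrow> 0) (at_left 0)" .
      moreover have "\<forall>\<^sub>F h in at_left 0. poly (- [:0, 1:] * p) (inverse (- h)) * exp (- e * inverse (- h)) = (cutoff e b p (b + h) - cutoff e b p b) / h"
        unfolding eventually_at_filter by (intro always_eventually) (auto simp: cutoff_def divide_inverse)
      ultimately show "((\<lambda>h. (cutoff e b p (b + h) - cutoff e b p b) / h) \<longlongrightarrow> 0) (at_left 0)"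
        by (rule Lim_transform_eventually)
      show "((\<lambda>h. (cutoff e b p (b + h) - cutoff e b p b) / h) \<longlongrightarrow> 0) (at_right 0)"
        by (rule tendsto_eventually) (auto simp: eventually_at_filter cutoff_def intro!: always_eventually)
    qed
    then have "(cutoff e b p has_real_derivative 0) (at b)" by (simp add: DERIV_def)
    then show ?thesis using 3 by (simp add: cutoff_def)
  qed
qed

lemma continuous_on_cutoff: "e > 0 \<Longrightarrow> continuous_on S (cutoff e b p)"
  using cutoff_has_derivative by (meson DERIV_isCont continuous_at_imp_continuous_on)

lemma cutoff_smult: "cutoff e b (smult c p) t = c * cutoff e b p t"
  by (simp add: cutoff_def)

text \<open>Derivatives in \<open>t\<close> change only \<open>p\<close> and derivatives in
  \<open>x\<close> only \<open>c\<close>, so this class of functions is closed under both;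
  \<open>\<sigma>\<close> is the direction of time. The cutoff is one-sided, since a test function
  is constrained only inside \<open>J\<close>, where 0 is the closed end.\<close>

definition wave :: "real \<Rightarrow> real \<Rightarrow> real \<Rightarrow> int \<Rightarrow> real poly \<Rightarrow> complex \<Rightarrow> real \<Rightarrow> real \<Rightarrow> complex" where
  "wave e b \<sigma> k p c t x = of_real (cutoff e b p (\<sigma> * t)) * (c * cis (- (of_int k * x)))"

context
  fixes e b \<sigma> :: real and k :: int
  assumes e: "e > 0"
begin

lemma wave_t_derivative:
  "((\<lambda>t. wave e b \<sigma> k p c t x) has_vector_derivative wave e b \<sigma> k (smult \<sigma> (cutoff_deriv e p)) c t x) (at t)"
proof -
  have "((\<lambda>t. cutoff e b p (\<sigma> * t)) has_real_derivative cutoff e b (cutoff_deriv e p) (\<sigma> * t) * \<sigma>) (at t)"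
    by (rule DERIV_chain2[OF cutoff_has_derivative[OF e]]) (auto intro!: derivative_eq_intros)
  then have "((\<lambda>t. complex_of_real (cutoff e b p (\<sigma> * t)) * (c * cis (- (of_int k * x)))) has_vector_derivative
    complex_of_real (cutoff e b (cutoff_deriv e p) (\<sigma> * t) * \<sigma>) * (c * cis (- (of_int k * x)))) (at t)"
    by (intro has_vector_derivative_mult_left has_vector_derivative_of_real)
       (simp add: has_real_derivative_iff_has_vector_derivative)
  then show ?thesis by (simp add: wave_def cutoff_smult mult_ac)
qed

lemma wave_x_derivative:
  "(wave e b \<sigma> k p c t has_vector_derivative wave e b \<sigma> k p (- \<i> * of_int k * c) t x) (at x)"
proof -
  have "((\<lambda>x. (of_real (cutoff e b p (\<sigma> * t)) * c) * cis (- of_int k * x)) has_vector_derivative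
    (of_real (cutoff e b p (\<sigma> * t)) * c) * (\<i> * of_real (- of_int k) * cis (- of_int k * x))) (at x)"
    by (intro has_vector_derivative_mult_right has_vector_derivative_cis)
  then show ?thesis by (simp add: wave_def[abs_def] mult_ac)
qed

lemma tderiv_wave: "tderiv (wave e b \<sigma> k p c) = wave e b \<sigma> k (smult \<sigma> (cutoff_deriv e p)) c"
  unfolding tderiv_def by (intro ext vector_derivative_at wave_t_derivative)

lemma xderiv_wave: "xderiv (wave e b \<sigma> k p c t) = wave e b \<sigma> k p (- \<i> * of_int k * c) t"
  unfolding xderiv_def by (intro ext vector_derivative_at wave_x_derivative)

lemma xderiv_wave_iterated: "(xderiv ^^ n) (wave e b \<sigma> k p c t) = wave e b \<sigma> k p ((- \<i> * of_int k) ^ n * c) t"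
  by (induction n) (simp_all add: xderiv_wave mult.assoc)

lemma continuous_wave: "continuous_on UNIV (\<lambda>(t, x). wave e b \<sigma> k p c t x)"
  unfolding wave_def case_prod_unfold
  by (intro continuous_intros continuous_on_compose2[OF continuous_on_cutoff[OF e, of UNIV]]) auto

lemma Ck_wave: "Ck n (wave e b \<sigma> k p c)"
proof (induction n arbitrary: p c)
  case 0
  show ?case using continuous_wave by simp
next
  case (Suc n)
  have "(\<lambda>\<tau>. wave e b \<sigma> k p c \<tau> x) differentiable at t" "wave e b \<sigma> k p c t differentiable at x" for t x
    by (rule differentiableI_vector[OF wave_t_derivative], rule differentiableI_vector[OF wave_x_derivative])
  then show ?case
    using Suc continuous_wave by (simp add: tderiv_wave xderiv_wave)
qed

lemma torus_periodic_wave: "torus_periodic (wave e b \<sigma> k p c t)"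
proof -
  have 1: "cis (2 * pi * of_int (- k)) = 1" by (rule cis_multiple_2pi) simp
  have "cis (- (of_int k * (x + 2 * pi))) = cis (- (of_int k * x)) * cis (2 * pi * of_int (- k))" for x
    unfolding cis_mult by (simp add: algebra_simps)
  then show ?thesis unfolding torus_periodic_def wave_def 1 by (simp only: mult_1_right simp_thms)
qed

lemma wave_test_function:
  assumes "compact K" "K \<subseteq> J" "\<And>t. t \<in> J - K \<Longrightarrow> b \<le> \<sigma> * t"
  shows "wave e b \<sigma> k p c \<in> test_functions J"
proof -
  have "\<forall>t\<in>J - K. \<forall>x. wave e b \<sigma> k p c t x = 0"
    using assms(3) by (auto simp: wave_def cutoff_def not_less[symmetric])
  with assms(1,2) Ck_wave torus_periodic_wave show ?thesis unfolding test_functions_def by blast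
qed

end

text \<open>The functions \<open>exp (- e / (b - t))\<close> increase to the indicator of \<open>t < b\<close> as \<open>e \<rightarrow> 0\<close>.\<close>

lemma weak_ode_limit:
  fixes y H :: "real \<Rightarrow> complex"
  assumes b: "b > 0" and y: "continuous_on {0..b} y" and H: "continuous_on {0..b} H"
    and weak: "\<And>e. e > 0 \<Longrightarrow> integral {0..b} (\<lambda>t. of_real (cutoff e b (cutoff_deriv e 1) t) * y t)
       + of_real (cutoff e b 1 0) * y0 + integral {0..b} (\<lambda>t. of_real (cutoff e b 1 t) * H t) = 0"
  shows "y b = y0 + integral {0..b} H"
proof -
  \<comment> \<open>The defect of the integrated equation. Integration by parts turns the weak
    identity into the vanishing of its integral against every \<open>?c' e\<close>; the goal is
    \<open>d b = 0\<close>.\<close>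
  define d where "d t = y t - (y0 + integral {0..t} H)" for t
  have zd: "((\<lambda>t. y0 + integral {0..t} H) has_vector_derivative H t) (at t within {0..b})" if "t \<in> {0..b}" for t
    using has_vector_derivative_add[OF has_vector_derivative_const integral_has_vector_derivative[OF H that]] by simp
  then have zc: "continuous_on {0..b} (\<lambda>t. y0 + integral {0..t} H)"
    by (meson continuous_on_eq_continuous_within has_vector_derivative_continuous)
  have dc: "continuous_on {0..b} d" unfolding d_def by (intro continuous_intros y zc)
  let ?c = "\<lambda>e. cutoff e b 1" and ?c' = "\<lambda>e. cutoff e b (cutoff_deriv e 1)"
  have cd: "((\<lambda>t. complex_of_real (?c e t)) has_vector_derivative of_real (?c' e t)) (at t within {0..b})" if "e > 0" for e t
    using cutoff_has_derivative[OF that, of b 1 t]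
    by (intro has_vector_derivative_of_real has_vector_derivative_at_within)
       (simp add: has_real_derivative_iff_has_vector_derivative)
  have cb: "?c e b = 0" for e by (simp add: cutoff_def)
  have dint: "integral {0..b} (\<lambda>t. of_real (?c' e t) * d t) = 0" if e: "e > 0" for e
  proof -
    note cc = continuous_on_cutoff[OF e]
    have i: "(\<lambda>t. of_real (?c' e t) * y t) integrable_on {0..b}" "(\<lambda>t. of_real (?c e t) * H t) integrable_on {0..b}"
      "(\<lambda>t. complex_of_real (?c' e t) * (y0 + integral {0..t} H)) integrable_on {0..b}"
      by (intro integrable_continuous_interval continuous_intros cc y H zc)+
    have "((\<lambda>t. of_real (?c e t) * H t + of_real (?c' e t) * (y0 + integral {0..t} H)) has_integral
       (of_real (?c e b) * (y0 + integral {0..b} H) - of_real (?c e 0) * (y0 + integral {0..0} H))) {0..b}"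
      using b e by (intro fundamental_theorem_of_calculus has_vector_derivative_mult cd zd) auto
    then have "integral {0..b} (\<lambda>t. of_real (?c e t) * H t + of_real (?c' e t) * (y0 + integral {0..t} H)) = - (of_real (?c e 0) * y0)"
      by (simp add: cb integral_unique)
    then have 1: "integral {0..b} (\<lambda>t. of_real (?c e t) * H t) + integral {0..b} (\<lambda>t. of_real (?c' e t) * (y0 + integral {0..t} H)) = - (of_real (?c e 0) * y0)"
      by (subst integral_add[OF i(2,3), symmetric])
    have alg: "A - Z = 0" if "A + u + C = 0" "C + Z = - u" for A Z u C :: complex using that by algebra
    have "integral {0..b} (\<lambda>t. of_real (?c' e t) * d t) = integral {0..b} (\<lambda>t. of_real (?c' e t) * y t) - integral {0..b} (\<lambda>t. of_real (?c' e t) * (y0 + integral {0..t} H))"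
      unfolding d_def right_diff_distrib using i by (intro integral_diff) auto
    also have "\<dots> = 0" by (rule alg[OF weak[OF e] 1])
    finally show ?thesis .
  qed
  \<comment> \<open>The kernel \<open>- ?c' e\<close> is nonnegative with total mass
    \<open>?c e 0\<close>, which tends to 1. Its first moment about \<open>b\<close> has the
    integrand x exp(- x) with x = e / (b - t), bounded by 1 and vanishing in the limit, so the
    kernel concentrates at \<open>b\<close>.\<close>
  let ?\<psi> = "\<lambda>e t. - ?c' e t * (b - t)"
  have c'_neg: "?c' e t \<le> 0" if "e > 0" for e t
    using that by (simp add: cutoff_def cutoff_deriv_def mult_nonneg_nonpos2 mult_nonpos_nonneg)
  have cont': "continuous_on S (?c' e)" if "e > 0" for e S using that by (rule continuous_on_cutoff)
  have "(\<lambda>n. integral {0..b} (?\<psi> (1 / real (Suc n)))) \<longlonglongrightarrow> integral {0..b} (\<lambda>t. 0)"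
  proof (rule dominated_convergence[where h = "\<lambda>t. 1"])
    show "?\<psi> (1 / real (Suc n)) integrable_on {0..b}" for n
      by (intro integrable_continuous_interval continuous_intros cont') simp
    have \<psi>: "?\<psi> e t = (if t < b then e / (b - t) * exp (- (e / (b - t))) else 0)" for e t
      by (simp add: cutoff_def cutoff_deriv_def)
    have x: "x * exp (- x) \<le> 1" for x :: real
    proof -
      have "x * exp (- x) \<le> exp x * exp (- x)"
        by (rule mult_right_mono) (use exp_ge_add_one_self[of x] in linarith, simp)
      then show ?thesis by (simp flip: exp_add)
    qed
    show "norm (?\<psi> (1 / real (Suc n)) t) \<le> 1" if "t \<in> {0..b}" for n t
      unfolding \<psi> using x[of "1 / real (Suc n) / (b - t)"] by auto
    show "(\<lambda>n. ?\<psi> (1 / real (Suc n)) t) \<longlonglongrightarrow> 0" if "t \<in> {0..b}" for t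
    proof (cases "t < b")
      case True
      have L: "(\<lambda>n. 1 / real (Suc n) / (b - t)) \<longlonglongrightarrow> 0 / (b - t)"
        using True by (intro tendsto_intros LIMSEQ_Suc lim_const_over_n) auto
      then have "(\<lambda>n. 1 / real (Suc n) / (b - t) * exp (- (1 / real (Suc n) / (b - t)))) \<longlonglongrightarrow> 0 / (b - t) * exp (- (0 / (b - t)))"
        by (intro tendsto_mult tendsto_exp tendsto_minus L)
      then show ?thesis unfolding \<psi> using True by simp
    qed (simp add: cutoff_def)
  qed (auto intro!: integrable_const_ivl)
  then have \<psi>0: "(\<lambda>n. integral {0..b} (?\<psi> (1 / real (Suc n)))) \<longlonglongrightarrow> 0" by simp
  have c0: "(\<lambda>n. ?c (1 / real (Suc n)) 0) \<longlonglongrightarrow> 1"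
  proof -
    have "(\<lambda>n. exp (- (1 / real (Suc n)) / b)) \<longlonglongrightarrow> exp (- 0 / b)"
      using b by (intro tendsto_intros LIMSEQ_Suc lim_const_over_n) auto
    then show ?thesis using b by (simp add: cutoff_def)
  qed
  have "cmod (d b) \<le> 0 + \<eta>" if \<eta>: "\<eta> > 0" for \<eta>
  proof -
    obtain \<delta> where \<delta>: "\<delta> > 0" "\<And>t. t \<in> {0..b} \<Longrightarrow> dist t b < \<delta> \<Longrightarrow> dist (d t) (d b) < \<eta>"
      using dc[unfolded continuous_on_iff, rule_format, of b \<eta>] b \<eta> by auto
    have "compact (d ` {0..b})" by (intro compact_continuous_image dc) simp
    from compact_imp_bounded[OF this] obtain D where D: "\<And>t. t \<in> {0..b} \<Longrightarrow> cmod (d t) \<le> D"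
      unfolding bounded_iff by blast
    have D0: "0 \<le> D" by (rule order_trans[OF norm_ge_zero D[of b]]) (use b in simp)
    \<comment> \<open>Near \<open>b\<close> continuity gives \<open>\<eta>\<close>; at distance at
      least \<open>\<delta>\<close> the linear term alone exceeds the crude bound 2 D. The linear
      term is what the first moment controls.\<close>
    have osc: "cmod (d t - d b) \<le> \<eta> + 2 * D / \<delta> * (b - t)" if t: "t \<in> {0..b}" for t
    proof (cases "dist t b < \<delta>")
      case True
      have "0 \<le> 2 * D / \<delta> * (b - t)" using t D0 \<delta>(1) by (intro mult_nonneg_nonneg) auto
      then show ?thesis using \<delta>(2)[OF t True] by (simp add: dist_norm)
    next
      case False
      have "cmod (d t - d b) \<le> D + D" using D[OF t] D[of b] b by (intro norm_triangle_le_diff) auto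
      also have "\<dots> = 2 * D / \<delta> * \<delta>" using \<delta>(1) by simp
      also have "\<dots> \<le> 2 * D / \<delta> * (b - t)"
        using False t D0 \<delta>(1) by (intro mult_left_mono) (auto simp: dist_real_def)
      finally show ?thesis using \<eta> by simp
    qed
    have bound: "?c e 0 * cmod (d b) \<le> \<eta> * ?c e 0 + 2 * D / \<delta> * integral {0..b} (?\<psi> e)" if e: "e > 0" for e
    proof -
      have "((\<lambda>t. - ?c' e t) has_integral (- ?c e b - - ?c e 0)) {0..b}"
      proof (rule fundamental_theorem_of_calculus)
        fix t
        have "(cutoff e b 1 has_vector_derivative ?c' e t) (at t)"
          using cutoff_has_derivative[OF e, of b 1 t] by (simp add: has_real_derivative_iff_has_vector_derivative)
        then show "((\<lambda>t. - ?c e t) has_vector_derivative - ?c' e t) (at t within {0..b})"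
          by (rule has_vector_derivative_minus[OF has_vector_derivative_at_within])
      qed (use b in simp)
      then have hi: "((\<lambda>t. - ?c' e t) has_integral ?c e 0) {0..b}" unfolding cb by simp
      have ii: "((\<lambda>t. complex_of_real (- ?c' e t) * d b) has_integral of_real (?c e 0) * d b) {0..b}"
        using has_integral_scaleR_left[OF hi, of "d b"] by (simp only: scaleR_conv_of_real)
      have di: "(\<lambda>t. of_real (?c' e t) * d t) integrable_on {0..b}"
        by (intro integrable_continuous_interval continuous_intros cont' e dc)
      have sp: "(\<lambda>t. of_real (?c' e t) * (d t - d b)) = (\<lambda>t. of_real (?c' e t) * d t + of_real (- ?c' e t) * d b)"
        by (rule ext) (simp add: algebra_simps)
      have "integral {0..b} (\<lambda>t. of_real (?c' e t) * (d t - d b)) = of_real (?c e 0) * d b"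
        unfolding sp integral_add[OF di has_integral_integrable[OF ii]] dint[OF e] integral_unique[OF ii] by simp
      then have "cmod (of_real (?c e 0) * d b) = cmod (integral {0..b} (\<lambda>t. of_real (?c' e t) * (d t - d b)))" by simp
      also have "\<dots> \<le> integral {0..b} (\<lambda>t. \<eta> * - ?c' e t + 2 * D / \<delta> * ?\<psi> e t)"
      proof (rule integral_norm_bound_integral)
        show "(\<lambda>t. of_real (?c' e t) * (d t - d b)) integrable_on {0..b}" "(\<lambda>t. \<eta> * - ?c' e t + 2 * D / \<delta> * ?\<psi> e t) integrable_on {0..b}"
          by (intro integrable_continuous_interval continuous_intros cont' e dc)+
        fix t assume t: "t \<in> {0..b}"
        have "cmod (of_real (?c' e t) * (d t - d b)) = - ?c' e t * cmod (d t - d b)"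
          using c'_neg[OF e, of t] by (simp add: norm_mult)
        also have "\<dots> \<le> - ?c' e t * (\<eta> + 2 * D / \<delta> * (b - t))"
          using c'_neg[OF e, of t] osc[OF t] by (intro mult_left_mono) auto
        also have "\<dots> = \<eta> * - ?c' e t + 2 * D / \<delta> * ?\<psi> e t"
          by (simp only: distrib_left mult_ac)
        finally show "cmod (of_real (?c' e t) * (d t - d b)) \<le> \<eta> * - ?c' e t + 2 * D / \<delta> * ?\<psi> e t" .
      qed
      also have "\<dots> = \<eta> * ?c e 0 + 2 * D / \<delta> * integral {0..b} (?\<psi> e)"
      proof -
        have "(\<lambda>t. \<eta> * - ?c' e t) integrable_on {0..b}" "(\<lambda>t. 2 * D / \<delta> * ?\<psi> e t) integrable_on {0..b}"
          by (intro integrable_continuous_interval continuous_intros cont' e)+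
        then have "integral {0..b} (\<lambda>t. \<eta> * - ?c' e t + 2 * D / \<delta> * ?\<psi> e t) = integral {0..b} (\<lambda>t. \<eta> * - ?c' e t) + integral {0..b} (\<lambda>t. 2 * D / \<delta> * ?\<psi> e t)"
          by (rule integral_add)
        then show ?thesis by (simp only: integral_mult_right integral_unique[OF hi])
      qed
      finally show ?thesis by (simp add: norm_mult cutoff_def)
    qed
    have lim2: "(\<lambda>n. \<eta> * ?c (1 / real (Suc n)) 0 + 2 * D / \<delta> * integral {0..b} (?\<psi> (1 / real (Suc n)))) \<longlonglongrightarrow> \<eta> * 1 + 2 * D / \<delta> * 0"
      by (intro tendsto_intros c0 \<psi>0)
    have lim1: "(\<lambda>n. ?c (1 / real (Suc n)) 0 * cmod (d b)) \<longlonglongrightarrow> 1 * cmod (d b)"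
      by (intro tendsto_intros c0)
    have "\<exists>N. \<forall>n\<ge>N. ?c (1 / real (Suc n)) 0 * cmod (d b) \<le> \<eta> * ?c (1 / real (Suc n)) 0 + 2 * D / \<delta> * integral {0..b} (?\<psi> (1 / real (Suc n)))"
      by (intro exI allI impI bound) simp
    from LIMSEQ_le[OF lim1 lim2 this] have "1 * cmod (d b) \<le> \<eta> * 1 + 2 * D / \<delta> * 0" .
    then show ?thesis by simp
  qed
  then have "cmod (d b) \<le> 0" by (rule field_le_epsilon)
  then show ?thesis by (simp add: d_def)
qed

section \<open>The weak identity tested on waves\<close>

lemma set_integral_eq_integral:
  fixes g h :: "real \<Rightarrow> complex"
  assumes "{p..q} \<subseteq> J" "\<And>t. t \<in> J - {p..q} \<Longrightarrow> g t = 0" "\<And>t. t \<in> {p..q} \<Longrightarrow> g t = h t"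
    and h: "continuous_on {p..q} h"
  shows "(LINT t:J|lebesgue. g t) = integral {p..q} h"
proof -
  have "(LINT t:J|lebesgue. g t) = (LINT t:{p..q}|lebesgue. h t)"
    unfolding set_lebesgue_integral_def
    by (intro Bochner_Integration.integral_cong refl) (use assms in \<open>auto simp: indicator_def\<close>)
  also have "\<dots> = integral {p..q} h"
    by (intro set_lebesgue_integral_eq_integral absolutely_integrable_continuous_real h)
  finally show ?thesis .
qed

lemma integral_signed_interval:
  fixes h :: "real \<Rightarrow> complex"
  assumes "\<sigma> \<in> {1, -1}" "0 \<le> b"
  shows "integral {min 0 (\<sigma> * b)..max 0 (\<sigma> * b)} h = integral {0..b} (\<lambda>t. h (\<sigma> * t))"
  using assms Henstock_Kurzweil_Integration.integral_reflect_real[of b 0 "\<lambda>t. h (- t)"] by (auto simp: min_def max_def)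

lemma torus_integral_wave: "torus_integral (\<lambda>x. g x * wave e b \<sigma> k p c t x)
  = of_real (cutoff e b p (\<sigma> * t)) * (c * (of_real (sqrt (2 * pi)) * fourier g k))"
proof -
  have "torus_integral (\<lambda>x. g x * wave e b \<sigma> k p c t x) =
     torus_integral (\<lambda>x. (of_real (cutoff e b p (\<sigma> * t)) * c) * (cis (- (of_int k * x)) * g x))"
    by (simp add: wave_def mult_ac)
  also have "\<dots> = (of_real (cutoff e b p (\<sigma> * t)) * c) * torus_integral (\<lambda>x. cis (- (of_int k * x)) * g x)"
    unfolding torus_integral_eq by (rule integral_mult_right_zero)
  finally show ?thesis by (simp add: fourier_def mult_ac)
qed

lemma pairing_wave: "pairing F (\<lambda>x. g x * wave e b \<sigma> k p 1 t x)
  = of_real (cutoff e b p (\<sigma> * t)) * pairing F (\<lambda>x. g x * cis (- (of_int k * x)))"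
proof -
  have "(\<lambda>x. g x * wave e b \<sigma> k p 1 t x) = (\<lambda>x. of_real (cutoff e b p (\<sigma> * t)) * (g x * cis (- (of_int k * x))))"
    by (simp add: wave_def mult_ac)
  then have "pairing F (\<lambda>x. g x * wave e b \<sigma> k p 1 t x) = infsum (\<lambda>j. of_real (cutoff e b p (\<sigma> * t)) * (distr_fourier F j * fourier (\<lambda>x. g x * cis (- (of_int k * x))) (- j))) UNIV"
    unfolding pairing_def by (simp only: fourier_cmult mult.left_commute[of "distr_fourier F _"])
  then show ?thesis unfolding pairing_def infsum_cmult_right' .
qed

context
  fixes f :: "real \<Rightarrow> complex" and s B :: real and k :: int
  assumes f: "integrable torus f" and a: "decaying s B (fourier f)" and s: "s \<ge> 1"
begin

text \<open>On a wave, the linear operator is multiplication by - i \<open>phase\<close>. The cubic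
  terms without \<Gamma> form the sum with G = 0; the remaining part of the cubic sum comes from the
  pairing, and the two are added later.\<close>

lemma spatial_part:
  assumes e: "e > 0"
  shows "torus_integral (\<lambda>x.
           f x * (- complex_of_real \<alpha>1 * (xderiv ^^ 3) (wave e b \<sigma> k p 1 t) x
                    + \<i> * complex_of_real \<alpha>2 * (xderiv ^^ 2) (wave e b \<sigma> k p 1 t) x)
         + complex_of_real ((cmod (f x))\<^sup>2) * f x *
             (\<i> * complex_of_real \<gamma>1 * wave e b \<sigma> k p 1 t x - complex_of_real \<gamma>2 * xderiv (wave e b \<sigma> k p 1 t) x))
    = of_real (sqrt (2 * pi)) * (of_real (cutoff e b p (\<sigma> * t)) * (- \<i> * of_real (phase \<alpha>1 \<alpha>2 k) * fourier f k
       + infsum (raman_term (\<gamma>1 / (2*pi)) (\<gamma>2 / (2*pi)) 0 (fourier f) k) UNIV))"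
proof -
  let ?w = "\<lambda>c. wave e b \<sigma> k p c t" and ?h = "\<lambda>x. abs_sq f x * f x"
  have w: "?w c x = c * ?w 1 x" for c x by (simp add: wave_def)
  have e3: "- complex_of_real \<alpha>1 * (xderiv ^^ 3) (?w 1) x + \<i> * complex_of_real \<alpha>2 * (xderiv ^^ 2) (?w 1) x
     = ?w (- \<i> * of_real (phase \<alpha>1 \<alpha>2 k)) x" for x
    unfolding xderiv_wave_iterated[OF e] w[of "(- \<i> * of_int k) ^ _ * 1"] w[of "- \<i> * of_real (phase \<alpha>1 \<alpha>2 k)"]
    by (simp add: phase_def power3_eq_cube power2_eq_square algebra_simps)
  have e1: "\<i> * complex_of_real \<gamma>1 * ?w 1 x - complex_of_real \<gamma>2 * xderiv (?w 1) x = ?w (\<i> * of_real (\<gamma>1 + \<gamma>2 * of_int k)) x" for x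
    unfolding xderiv_wave[OF e] w[of "- \<i> * of_int k * 1"] w[of "\<i> * of_real (\<gamma>1 + \<gamma>2 * of_int k)"]
    by (simp add: algebra_simps)
  have i: "integrable torus (\<lambda>x. g x * ?w c x)" if "integrable torus g" for g c
  proof -
    have "integrable torus (\<lambda>x. (of_real (cutoff e b p (\<sigma> * t)) * c) * (cis (- of_int k * x) * g x))"
      by (intro integrable_mult_right integrable_cis_mult that)
    then show ?thesis by (simp add: wave_def mult_ac)
  qed
  have "torus_integral (\<lambda>x. f x * ?w (- \<i> * of_real (phase \<alpha>1 \<alpha>2 k)) x + ?h x * ?w (\<i> * of_real (\<gamma>1 + \<gamma>2 * of_int k)) x)
    = torus_integral (\<lambda>x. f x * ?w (- \<i> * of_real (phase \<alpha>1 \<alpha>2 k)) x) + torus_integral (\<lambda>x. ?h x * ?w (\<i> * of_real (\<gamma>1 + \<gamma>2 * of_int k)) x)"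
    unfolding torus_integral_eq by (intro Bochner_Integration.integral_add i f integrable_cubic[OF f a s])
  also have "\<dots> = of_real (sqrt (2 * pi)) * (of_real (cutoff e b p (\<sigma> * t)) * (- \<i> * of_real (phase \<alpha>1 \<alpha>2 k) * fourier f k
       + \<i> * of_real (\<gamma>1 + \<gamma>2 * of_int k) * fourier ?h k))"
    unfolding torus_integral_wave by (simp only: distrib_left mult_ac)
  also have "\<i> * of_real (\<gamma>1 + \<gamma>2 * of_int k) * fourier ?h k = infsum (raman_term (\<gamma>1 / (2*pi)) (\<gamma>2 / (2*pi)) 0 (fourier f) k) UNIV"
    using raman_sum_fourier[OF f a s, of \<gamma>1 \<gamma>2 0 k] by (simp del: of_real_power)
  finally show ?thesis unfolding e3 e1 .
qed

lemma pairing_part: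
  "- \<i> * complex_of_real \<Gamma> * pairing (dx_abs_sq f) (\<lambda>x. f x * wave e b \<sigma> k p 1 t x)
    = of_real (sqrt (2 * pi)) * (of_real (cutoff e b p (\<sigma> * t)) * infsum (raman_term 0 0 (\<Gamma> / (2*pi)) (fourier f) k) UNIV)"
proof -
  have "infsum (raman_term 0 0 (\<Gamma> / (2*pi)) (fourier f) k) UNIV = - \<i> * of_real \<Gamma> / of_real (sqrt (2 * pi)) * pairing (dx_abs_sq f) (\<lambda>x. f x * cis (- (of_int k * x)))"
    using raman_sum_fourier[OF f a s, of 0 0 \<Gamma> k] by (simp del: of_real_power)
  then show ?thesis unfolding pairing_wave by simp
qed

end

text \<open>Forward (\<open>\<sigma> = 1\<close>) and backward (\<open>\<sigma> = -1\<close>) solutions are treated simultaneously.\<close>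

lemma weak_identity_integrated:
  fixes u :: "real \<Rightarrow> real \<Rightarrow> complex" and s B b \<sigma> :: real and k :: int
  assumes \<sigma>: "\<sigma> \<in> {1, -1}" and s: "s \<ge> 1" and b: "b > 0"
    and J: "\<And>t. t \<in> {0..b} \<Longrightarrow> \<sigma> * t \<in> J" "\<And>t. t \<in> J \<Longrightarrow> 0 \<le> \<sigma> * t"
    and weak: "\<And>\<phi>. \<phi> \<in> test_functions J \<Longrightarrow> weak_identity \<alpha>1 \<alpha>2 \<gamma>1 \<gamma>2 \<Gamma> J (of_real (- \<sigma>)) u0 u \<phi>"
    and int: "\<And>t. t \<in> {0..b} \<Longrightarrow> integrable torus (u (\<sigma> * t))"
    and dec: "\<And>t. t \<in> {0..b} \<Longrightarrow> decaying s B (fourier (u (\<sigma> * t)))"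
    and cont: "\<And>k. continuous_on {0..b} (\<lambda>t. fourier (u (\<sigma> * t)) k)"
  shows "fourier (u (\<sigma> * b)) k = fourier u0 k + integral {0..b} (\<lambda>t. of_real \<sigma> *
    (- \<i> * of_real (phase \<alpha>1 \<alpha>2 k) * fourier (u (\<sigma> * t)) k
      + infsum (raman_term (\<gamma>1 / (2*pi)) (\<gamma>2 / (2*pi)) (\<Gamma> / (2*pi)) (fourier (u (\<sigma> * t))) k) UNIV))"
proof (rule weak_ode_limit[OF b cont])
  let ?a = "\<lambda>t. fourier (u (\<sigma> * t))" and ?r = "complex_of_real (sqrt (2 * pi))"
  let ?S1 = "\<lambda>t. - \<i> * of_real (phase \<alpha>1 \<alpha>2 k) * ?a t k + infsum (raman_term (\<gamma>1 / (2*pi)) (\<gamma>2 / (2*pi)) 0 (?a t) k) UNIV"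
  let ?S2 = "\<lambda>t. infsum (raman_term 0 0 (\<Gamma> / (2*pi)) (?a t) k) UNIV"
  let ?S = "\<lambda>t. infsum (raman_term (\<gamma>1 / (2*pi)) (\<gamma>2 / (2*pi)) (\<Gamma> / (2*pi)) (?a t) k) UNIV"
  have cs: "continuous_on {0..b} (\<lambda>t. infsum (raman_term g1 g2 G (?a t) k) UNIV)" for g1 g2 G
    by (rule continuous_on_raman_sum[OF dec s cont])
  show "continuous_on {0..b} (\<lambda>t. of_real \<sigma> * (- \<i> * of_real (phase \<alpha>1 \<alpha>2 k) * ?a t k + ?S t))"
    by (intro continuous_intros cs cont)
  fix e :: real assume e: "e > 0"
  let ?\<phi> = "wave e b \<sigma> k 1 1" and ?c = "\<lambda>t. complex_of_real (cutoff e b 1 t)" and ?c' = "\<lambda>t. complex_of_real (cutoff e b (cutoff_deriv e 1) t)"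
  \<comment> \<open>The segment between 0 and \<open>\<sigma> * b\<close> in either orientation; the
    substitution by \<open>\<sigma>\<close>, which is its own inverse, carries all time integrals to
    \<open>{0..b}\<close>.\<close>
  define p q where "p = min 0 (\<sigma> * b)" and "q = max 0 (\<sigma> * b)"
  have \<sigma>2: "\<sigma> * \<sigma> = 1" using \<sigma> by auto
  have pq: "t \<in> {p..q} \<longleftrightarrow> \<sigma> * t \<in> {0..b}" for t using \<sigma> b by (auto simp: p_def q_def min_def max_def)
  have sub: "{p..q} \<subseteq> J"
  proof
    fix t assume "t \<in> {p..q}"
    then have "\<sigma> * (\<sigma> * t) \<in> J" using pq J(1) by blast
    then show "t \<in> J" by (simp add: mult.assoc[symmetric] \<sigma>2)
  qed
  have out: "b \<le> \<sigma> * t" if "t \<in> J - {p..q}" for t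
    using that J(2)[of t] pq[of t] by auto
  have tf: "?\<phi> \<in> test_functions J"
    by (rule wave_test_function[OF e _ sub out]) auto
  have vanish: "cutoff e b pp (\<sigma> * t) = 0" if "t \<in> J - {p..q}" for t pp
    using out[OF that] by (simp add: cutoff_def)
  have conv: "(LINT t:J|lebesgue. g t) = integral {0..b} h"
    if g0: "\<And>t. t \<in> J - {p..q} \<Longrightarrow> g t = 0" and gh: "\<And>t. t \<in> {0..b} \<Longrightarrow> g (\<sigma> * t) = h t" and h: "continuous_on {0..b} h"
    for g h :: "real \<Rightarrow> complex"
  proof -
    have "(LINT t:J|lebesgue. g t) = integral {p..q} (\<lambda>t. h (\<sigma> * t))"
    proof (rule set_integral_eq_integral[OF sub g0])
      show "g t = h (\<sigma> * t)" if "t \<in> {p..q}" for t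
        using gh[of "\<sigma> * t"] that pq by (simp add: mult.assoc[symmetric] \<sigma>2)
      show "continuous_on {p..q} (\<lambda>t. h (\<sigma> * t))"
        by (rule continuous_on_compose2[OF h]) (use pq in \<open>auto intro!: continuous_intros\<close>)
    qed
    also have "\<dots> = integral {0..b} (\<lambda>t. h (\<sigma> * (\<sigma> * t)))"
      unfolding p_def q_def using \<sigma> b by (intro integral_signed_interval) auto
    finally show ?thesis by (simp add: mult.assoc[symmetric] \<sigma>2)
  qed
  note cc = continuous_on_of_real[OF continuous_on_cutoff[OF e]]
  have I1: "(LINT t:J|lebesgue. torus_integral (\<lambda>x. u t x * tderiv ?\<phi> t x)) = integral {0..b} (\<lambda>t. (of_real \<sigma> * ?r) * (?c' t * ?a t k))"
    unfolding tderiv_wave[OF e] torus_integral_wave cutoff_smult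
    by (rule conv) (auto simp: vanish mult.assoc[symmetric] \<sigma>2 intro!: continuous_intros cc cont)
  have I2: "(LINT t:J|lebesgue. torus_integral (\<lambda>x.
           u t x * (- complex_of_real \<alpha>1 * (xderiv ^^ 3) (?\<phi> t) x + \<i> * complex_of_real \<alpha>2 * (xderiv ^^ 2) (?\<phi> t) x)
         + complex_of_real ((cmod (u t x))\<^sup>2) * u t x *
             (\<i> * complex_of_real \<gamma>1 * ?\<phi> t x - complex_of_real \<gamma>2 * xderiv (?\<phi> t) x))) = integral {0..b} (\<lambda>t. ?r * (?c t * ?S1 t))"
  proof (rule conv)
    fix t assume "t \<in> J - {p..q}"
    then have "wave e b \<sigma> k 1 c t x = 0" for c x by (simp add: wave_def vanish)
    then show "torus_integral (\<lambda>x.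
           u t x * (- complex_of_real \<alpha>1 * (xderiv ^^ 3) (?\<phi> t) x + \<i> * complex_of_real \<alpha>2 * (xderiv ^^ 2) (?\<phi> t) x)
         + complex_of_real ((cmod (u t x))\<^sup>2) * u t x *
             (\<i> * complex_of_real \<gamma>1 * ?\<phi> t x - complex_of_real \<gamma>2 * xderiv (?\<phi> t) x)) = 0"
      unfolding xderiv_wave_iterated[OF e] xderiv_wave[OF e] by (simp add: torus_integral_def)
  next
    fix t assume t: "t \<in> {0..b}"
    show "torus_integral (\<lambda>x.
           u (\<sigma> * t) x * (- complex_of_real \<alpha>1 * (xderiv ^^ 3) (?\<phi> (\<sigma> * t)) x + \<i> * complex_of_real \<alpha>2 * (xderiv ^^ 2) (?\<phi> (\<sigma> * t)) x)
         + complex_of_real ((cmod (u (\<sigma> * t) x))\<^sup>2) * u (\<sigma> * t) x *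
             (\<i> * complex_of_real \<gamma>1 * ?\<phi> (\<sigma> * t) x - complex_of_real \<gamma>2 * xderiv (?\<phi> (\<sigma> * t)) x)) = ?r * (?c t * ?S1 t)"
      unfolding spatial_part[OF int[OF t] dec[OF t] s e] by (simp only: mult.assoc[symmetric] \<sigma>2 mult_1_left)
  qed (intro continuous_intros cc cont cs)
  have I3: "(LINT t:J|lebesgue. pairing (dx_abs_sq (u t)) (\<lambda>x. u t x * ?\<phi> t x)) = integral {0..b} (\<lambda>t. \<i> / of_real \<Gamma> * (?r * (?c t * ?S2 t)))" if \<Gamma>: "\<Gamma> \<noteq> 0"
  proof (rule conv)
    fix t assume "t \<in> J - {p..q}"
    then show "pairing (dx_abs_sq (u t)) (\<lambda>x. u t x * ?\<phi> t x) = 0" unfolding pairing_wave by (simp add: vanish)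
  next
    fix t assume t: "t \<in> {0..b}"
    have "pairing (dx_abs_sq (u (\<sigma> * t))) (\<lambda>x. u (\<sigma> * t) x * ?\<phi> (\<sigma> * t) x)
      = \<i> / of_real \<Gamma> * (- \<i> * of_real \<Gamma> * pairing (dx_abs_sq (u (\<sigma> * t))) (\<lambda>x. u (\<sigma> * t) x * ?\<phi> (\<sigma> * t) x))"
      using \<Gamma> by simp
    also have "\<dots> = \<i> / of_real \<Gamma> * (?r * (?c t * ?S2 t))"
      unfolding pairing_part[OF int[OF t] dec[OF t] s] by (simp only: mult.assoc[symmetric, of \<sigma>] \<sigma>2 mult_1_left)
    finally show "pairing (dx_abs_sq (u (\<sigma> * t))) (\<lambda>x. u (\<sigma> * t) x * ?\<phi> (\<sigma> * t) x) = \<i> / of_real \<Gamma> * (?r * (?c t * ?S2 t))" .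
  qed (intro continuous_intros cc cont cs)
  have I3': "- \<i> * of_real \<Gamma> * (LINT t:J|lebesgue. pairing (dx_abs_sq (u t)) (\<lambda>x. u t x * ?\<phi> t x)) = integral {0..b} (\<lambda>t. ?r * (?c t * ?S2 t))"
  \<comment> \<open>\<open>I3\<close> was obtained by dividing by \<Gamma>; for \<Gamma> = 0 both
    sides are zero.\<close>
  proof (cases "\<Gamma> = 0")
    case True
    have "raman_term 0 0 0 c k = (\<lambda>_. 0)" for c
      by (rule ext) (simp add: raman_term_def raman_coeff_def Complex_eq case_prod_unfold)
    with True show ?thesis by simp
  next
    case False
    then show ?thesis unfolding I3[OF False] integral_mult_right by (simp add: mult.assoc[symmetric])
  qed
  have S: "?S t = infsum (raman_term (\<gamma>1 / (2*pi)) (\<gamma>2 / (2*pi)) 0 (?a t) k) UNIV + ?S2 t" if t: "t \<in> {0..b}" for t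
    unfolding infsum_add[OF raman_term_summable[OF dec[OF t] s] raman_term_summable[OF dec[OF t] s], symmetric]
    by (rule infsum_cong) (auto simp: raman_term_def raman_coeff_def Complex_eq algebra_simps)
  have T0: "torus_integral (\<lambda>x. u0 x * ?\<phi> 0 x) = ?c 0 * (?r * fourier u0 k)"
    unfolding torus_integral_wave by simp
  have "- (of_real \<sigma> * ?r * integral {0..b} (\<lambda>t. ?c' t * ?a t k)) + of_real (- \<sigma>) * (?c 0 * (?r * fourier u0 k))
     = integral {0..b} (\<lambda>t. ?r * (?c t * ?S1 t))
       - \<i> * of_real \<Gamma> * (LINT t:J|lebesgue. pairing (dx_abs_sq (u t)) (\<lambda>x. u t x * ?\<phi> t x))"
    using weak[OF tf] unfolding weak_identity_def I1 I2 T0 by (simp only: integral_mult_right)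
  also have "\<dots> = integral {0..b} (\<lambda>t. ?r * (?c t * ?S1 t))
       + (- \<i> * of_real \<Gamma> * (LINT t:J|lebesgue. pairing (dx_abs_sq (u t)) (\<lambda>x. u t x * ?\<phi> t x)))"
    by simp
  also have "\<dots> = integral {0..b} (\<lambda>t. ?r * (?c t * ?S1 t)) + integral {0..b} (\<lambda>t. ?r * (?c t * ?S2 t))"
    unfolding I3' ..
  also have "\<dots> = integral {0..b} (\<lambda>t. ?r * (?c t * ?S1 t) + ?r * (?c t * ?S2 t))"
    by (intro integral_add[symmetric] integrable_continuous_interval continuous_intros cc cont cs)
  also have "\<dots> = integral {0..b} (\<lambda>t. (of_real \<sigma> * ?r) * (?c t * (of_real \<sigma> * (- \<i> * of_real (phase \<alpha>1 \<alpha>2 k) * ?a t k + ?S t))))"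
  proof (rule integral_cong)
    fix t assume t: "t \<in> {0..b}"
    have "complex_of_real \<sigma> * of_real \<sigma> = 1" using \<sigma>2 by (simp flip: of_real_mult)
    then show "?r * (?c t * ?S1 t) + ?r * (?c t * ?S2 t) = (of_real \<sigma> * ?r) * (?c t * (of_real \<sigma> * (- \<i> * of_real (phase \<alpha>1 \<alpha>2 k) * ?a t k + ?S t)))"
      unfolding S[OF t] by algebra
  qed
  also have "\<dots> = of_real \<sigma> * ?r * integral {0..b} (\<lambda>t. ?c t * (of_real \<sigma> * (- \<i> * of_real (phase \<alpha>1 \<alpha>2 k) * ?a t k + ?S t)))"
    by (rule integral_mult_right)
  finally have "(of_real \<sigma> * ?r) * (integral {0..b} (\<lambda>t. ?c' t * ?a t k) + ?c 0 * fourier u0 k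
     + integral {0..b} (\<lambda>t. ?c t * (of_real \<sigma> * (- \<i> * of_real (phase \<alpha>1 \<alpha>2 k) * ?a t k + ?S t)))) = 0"
    by (simp add: distrib_left mult_ac) algebra
  moreover have "of_real \<sigma> * ?r \<noteq> 0" using \<sigma> by auto
  ultimately show "integral {0..b} (\<lambda>t. ?c' t * ?a t k) + ?c 0 * fourier u0 k
     + integral {0..b} (\<lambda>t. ?c t * (of_real \<sigma> * (- \<i> * of_real (phase \<alpha>1 \<alpha>2 k) * ?a t k + ?S t))) = 0"
    by (simp only: mult_eq_0_iff simp_thms)
qed

section \<open>Nonexistence\<close>

lemma HsD:
  assumes "f \<in> Hs s" shows "integrable torus f" "sobolev_summable s (fourier f)"
  using assms by (auto simp: Hs_def torus_integrable_iff)

lemma sq_weighted_le: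
  fixes a b :: complex
  assumes "0 \<le> w" shows "(w * cmod a)\<^sup>2 \<le> 2 * (w * cmod (a - b))\<^sup>2 + 2 * (w * cmod b)\<^sup>2"
proof -
  have "w * cmod a \<le> w * (cmod (a - b) + cmod b)"
    using assms norm_triangle_sub[of a b] by (intro mult_left_mono) (auto simp: add.commute)
  then have "w * cmod a \<le> w * cmod (a - b) + w * cmod b" by (simp add: distrib_left)
  then have "(w * cmod a)\<^sup>2 \<le> (w * cmod (a - b) + w * cmod b)\<^sup>2"
    using assms by (intro power_mono) auto
  also have "\<dots> \<le> 2 * (w * cmod (a - b))\<^sup>2 + 2 * (w * cmod b)\<^sup>2"
    using sum_squares_bound[of "w * cmod (a - b)" "w * cmod b"] by (simp add: power2_sum)
  finally show ?thesis .
qed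

lemma sobolev_summable_diff:
  assumes "sobolev_summable s a" "sobolev_summable s b"
  shows "sobolev_summable s (\<lambda>k. a k - b k)"
  unfolding sobolev_summable_def
proof (rule summable_on_comparison_test)
  show "(\<lambda>k. 2 * (jap k powr s * cmod (a k))\<^sup>2 + 2 * (jap k powr s * cmod (b k))\<^sup>2) summable_on UNIV"
    using assms unfolding sobolev_summable_def by (intro summable_on_add summable_on_cmult_right)
  show "(jap k powr s * cmod (a k - b k))\<^sup>2 \<le> 2 * (jap k powr s * cmod (a k))\<^sup>2 + 2 * (jap k powr s * cmod (b k))\<^sup>2" for k
    using sq_weighted_le[of "jap k powr s" "a k - b k" "- b k"] by simp
qed simp

text \<open>A triangle inequality for squared norms, summed from (x + y)^2 \<le> 2 x^2 + 2 y^2. It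
  turns closeness to the initial value into a bound uniform in time.\<close>

lemma infsum_sobolev_le:
  assumes a: "sobolev_summable s a" and b: "sobolev_summable s b"
  shows "(\<Sum>\<^sub>\<infinity>k. (jap k powr s * cmod (a k))\<^sup>2) \<le>
    2 * (\<Sum>\<^sub>\<infinity>k. (jap k powr s * cmod (a k - b k))\<^sup>2) + 2 * (\<Sum>\<^sub>\<infinity>k. (jap k powr s * cmod (b k))\<^sup>2)"
proof -
  note d = sobolev_summable_diff[OF a b]
  have "(\<Sum>\<^sub>\<infinity>k. (jap k powr s * cmod (a k))\<^sup>2) \<le> (\<Sum>\<^sub>\<infinity>k. 2 * (jap k powr s * cmod (a k - b k))\<^sup>2 + 2 * (jap k powr s * cmod (b k))\<^sup>2)"
    using a b d unfolding sobolev_summable_def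
    by (intro infsum_mono summable_on_add summable_on_cmult_right sq_weighted_le) auto
  also have "\<dots> = 2 * (\<Sum>\<^sub>\<infinity>k. (jap k powr s * cmod (a k - b k))\<^sup>2) + 2 * (\<Sum>\<^sub>\<infinity>k. (jap k powr s * cmod (b k))\<^sup>2)"
    using b d unfolding sobolev_summable_def
    by (subst infsum_add) (auto intro!: summable_on_cmult_right simp: infsum_cmult_right')
  finally show ?thesis .
qed

lemma norm_le_sobolev_norm:
  assumes a: "sobolev_summable s a" and s: "s \<ge> 0"
  shows "cmod (a k) \<le> sobolev_norm s a"
proof -
  have "1 * cmod (a k) \<le> jap k powr s * cmod (a k)"
    using s by (intro mult_right_mono) (auto simp: ge_one_powr_ge_zero)
  then have "(cmod (a k))\<^sup>2 \<le> (\<Sum>k\<in>{k}. (jap k powr s * cmod (a k))\<^sup>2)" by (simp add: power_mono)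
  also have "\<dots> \<le> (\<Sum>\<^sub>\<infinity>k. (jap k powr s * cmod (a k))\<^sup>2)"
    using a unfolding sobolev_summable_def by (intro finite_sum_le_infsum) auto
  finally show ?thesis unfolding sobolev_norm_def by (rule real_le_rsqrt)
qed

lemma C_Hs_fourier_diff:
  assumes u: "u \<in> C_Hs I s" and t: "t \<in> I" "t0 \<in> I"
  shows "fourier (\<lambda>x. u t x - u t0 x) = (\<lambda>k. fourier (u t) k - fourier (u t0) k)"
  by (rule ext, rule fourier_diff) (use u t in \<open>auto simp: C_Hs_def intro: HsD\<close>)

lemma C_Hs_fourier_continuous:
  assumes u: "u \<in> C_Hs I s" and s: "s \<ge> 0"
  shows "continuous_on I (\<lambda>t. fourier (u t) k)"
  unfolding continuous_on_def
proof
  fix t0 assume t0: "t0 \<in> I"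
  have lim: "((\<lambda>t. sobolev_norm s (fourier (\<lambda>x. u t x - u t0 x))) \<longlongrightarrow> 0) (at t0 within I)"
    using u t0 by (auto simp: C_Hs_def)
  have "((\<lambda>t. fourier (u t) k - fourier (u t0) k) \<longlongrightarrow> 0) (at t0 within I)"
  proof (rule Lim_null_comparison[OF _ lim])
    show "\<forall>\<^sub>F t in at t0 within I. norm (fourier (u t) k - fourier (u t0) k) \<le> sobolev_norm s (fourier (\<lambda>x. u t x - u t0 x))"
      unfolding eventually_at_filter
    proof (intro always_eventually allI impI)
      fix t assume t: "t \<in> I"
      have "sobolev_summable s (\<lambda>k. fourier (u t) k - fourier (u t0) k)"
        using u t t0 by (intro sobolev_summable_diff HsD) (auto simp: C_Hs_def)
      from norm_le_sobolev_norm[OF this s]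
      show "norm (fourier (u t) k - fourier (u t0) k) \<le> sobolev_norm s (fourier (\<lambda>x. u t x - u t0 x))"
        unfolding C_Hs_fourier_diff[OF u t t0] .
    qed
  qed
  then show "((\<lambda>t. fourier (u t) k) \<longlongrightarrow> fourier (u t0) k) (at t0 within I)"
    by (rule LIM_zero_cancel)
qed

text \<open>The sign from time reversal is absorbed by the parts of the coefficient that are linear
  in \<open>k\<close> or \<open>n\<close>, whereas the constant part \<open>g1\<close> changes sign.
  That \<open>G\<close> is kept is what makes the reflected flow grow forward at positive
  frequencies as well.\<close>

lemma raman_sum_reflect:
  assumes j: "j \<in> {1, -1 :: int}"
  shows "of_int j * infsum (raman_term g1 g2 G a (j * k)) UNIV
    = infsum (raman_term (of_int j * g1) g2 G (\<lambda>l. a (j * l)) k) UNIV"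
proof -
  have jj: "j * (j * x) = x" for x using j by auto
  have "of_int j * infsum (raman_term g1 g2 G a (j * k)) UNIV = infsum (\<lambda>p. of_int j * raman_term g1 g2 G a (j * k) p) UNIV"
    by (rule infsum_cmult_right'[symmetric])
  also have "\<dots> = infsum (raman_term (of_int j * g1) g2 G (\<lambda>l. a (j * l)) k) UNIV"
  proof (rule infsum_reindex_bij_witness[of _ "\<lambda>(m, n). (j * m, j * n)" "\<lambda>(m, n). (j * m, j * n)"])
    fix p :: "int \<times> int"
    obtain m n where p: "p = (m, n)" by force
    have "of_int j * raman_coeff g1 g2 G (j * k) n = raman_coeff (of_int j * g1) g2 G k (j * n)"
      using j by (auto simp: raman_coeff_def complex_eq_iff)
    moreover have "j * (k + j * m) = j * k + m" "j * (k + j * m + j * n) = j * k + m + n" "j * (k + j * n) = j * k + n"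
      by (simp_all add: distrib_left jj)
    ultimately show "raman_term (of_int j * g1) g2 G (\<lambda>l. a (j * l)) k (case p of (m, n) \<Rightarrow> (j * m, j * n)) = of_int j * raman_term g1 g2 G a (j * k) p"
      by (simp add: raman_term_def p mult.assoc[symmetric])
  qed (auto simp: jj)
  finally show ?thesis .
qed

text \<open>The cubic part is odd and the quadratic part even, so only \<alpha>2 changes sign; the
  nonresonance condition is invariant under that change.\<close>

lemma phase_reflect:
  "j \<in> {1, -1 :: int} \<Longrightarrow> of_int j * phase \<alpha>1 \<alpha>2 (j * k) = phase \<alpha>1 (of_int j * \<alpha>2) k"
  by (auto simp: phase_def power3_eq_cube)

lemma initial_fourier_gain:
  fixes j :: int
  assumes j: "j \<in> {1, -1}" and s: "s \<ge> 1" and T: "T > 0"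
    and \<alpha>: "\<alpha>1 \<noteq> 0" "2 * \<alpha>2 / (3 * \<alpha>1) \<notin> \<int>" and \<Gamma>: "\<Gamma> > 0"
    and I: "\<And>t. t \<in> I \<longleftrightarrow> of_int j * t \<in> {0..T}" and J: "\<And>t. t \<in> J \<longleftrightarrow> of_int j * t \<in> {0..<T}"
    and u: "u \<in> C_Hs I s"
    and weak: "\<And>\<phi>. \<phi> \<in> test_functions J \<Longrightarrow> weak_identity \<alpha>1 \<alpha>2 \<gamma>1 \<gamma>2 \<Gamma> J (of_real (- of_int j)) u0 u \<phi>"
    and nz: "fourier u0 l \<noteq> 0"
  shows "\<exists>C k0. \<forall>k\<ge>k0. cmod (fourier u0 (j * k)) \<le> C * jap k powr (- s - 1/16)"
proof -
  define \<sigma> :: real where "\<sigma> = of_int j"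
  have \<sigma>: "\<sigma> \<in> {1, -1}" using j by (auto simp: \<sigma>_def)
  have \<sigma>2: "\<sigma> * (\<sigma> * t) = t" for t using \<sigma> by auto
  define y where "y t = fourier (u (\<sigma> * t))" for t
  have inI: "\<sigma> * t \<in> I" if "t \<in> {0..T}" for t using that I[of "\<sigma> * t"] unfolding \<sigma>_def[symmetric] \<sigma>2 by simp
  have hs: "u (\<sigma> * t) \<in> Hs s" if "t \<in> {0..T}" for t using u inI[OF that] by (auto simp: C_Hs_def)
  have ycont: "continuous_on {0..T} (\<lambda>t. y t k)" for k
    unfolding y_def using s inI
    by (intro continuous_on_compose2[OF C_Hs_fourier_continuous[OF u]] continuous_intros) auto
  have "((\<lambda>t. sobolev_norm s (fourier (\<lambda>x. u t x - u 0 x))) \<longlongrightarrow> 0) (at 0 within I)"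
    using u inI[of 0] T by (auto simp: C_Hs_def)
  then have "\<forall>\<^sub>F t in at 0 within I. sobolev_norm s (fourier (\<lambda>x. u t x - u 0 x)) < 1"
    by (rule order_tendstoD) simp
  then obtain d where d: "d > 0" "\<And>t. t \<in> I \<Longrightarrow> t \<noteq> 0 \<Longrightarrow> dist t 0 < d \<Longrightarrow> sobolev_norm s (fourier (\<lambda>x. u t x - u 0 x)) < 1"
    unfolding eventually_at by blast
  \<comment> \<open>Strictly below \<open>T\<close>, so that all times up to \<open>T1\<close>
    correspond to points of the half-open \<open>J\<close>; below \<open>d\<close>, so that the
    solution stays within Sobolev distance 1 of its initial value.\<close>
  define T1 where "T1 = min (T / 2) (d / 2)"
  have T1: "0 < T1" "T1 < T" "T1 < d" using T d(1) by (auto simp: T1_def)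
  have small: "(\<Sum>\<^sub>\<infinity>k. (jap k powr s * cmod (y t k - y 0 k))\<^sup>2) \<le> 1" if t: "t \<in> {0..T1}" for t
  proof (cases "t = 0")
    case False
    have tI: "\<sigma> * t \<in> I" "0 \<in> I" using inI[of t] inI[of 0] t T1 T by auto
    have "\<sigma> * t \<noteq> 0" "dist (\<sigma> * t) 0 < d" using False t T1 \<sigma> by auto
    then have "sobolev_norm s (fourier (\<lambda>x. u (\<sigma> * t) x - u 0 x)) < 1" using d(2) tI by blast
    then have "sqrt (\<Sum>\<^sub>\<infinity>k. (jap k powr s * cmod (y t k - y 0 k))\<^sup>2) < 1"
      unfolding C_Hs_fourier_diff[OF u tI] by (simp add: sobolev_norm_def y_def)
    then show ?thesis by (simp add: less_imp_le)
  qed simp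
  define B where "B = (2 + 2 * (\<Sum>\<^sub>\<infinity>k. (jap k powr s * cmod (y 0 k))\<^sup>2)) + 1 + (\<Sum>\<^sub>\<infinity>k. jap k powr (-3/2))"
  have dec: "decaying s B (y t)" if t: "t \<in> {0..T1}" for t
    unfolding B_def
  proof (rule sobolev_decaying[OF s])
    show st: "sobolev_summable s (y t)" unfolding y_def by (rule HsD[OF hs]) (use t T1 in auto)
    have s0: "sobolev_summable s (y 0)" unfolding y_def by (rule HsD[OF hs]) (use T in auto)
    show "(\<Sum>\<^sub>\<infinity>k. (jap k powr s * cmod (y t k))\<^sup>2) \<le> 2 + 2 * (\<Sum>\<^sub>\<infinity>k. (jap k powr s * cmod (y 0 k))\<^sup>2)"
      using infsum_sobolev_le[OF st s0] small[OF t] by linarith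
  qed
  have ycont1: "continuous_on {0..T1} (\<lambda>t. y t k)" for k
    by (rule continuous_on_subset[OF ycont]) (use T1 in auto)
  define g1 g2 G where "g1 = \<gamma>1 / (2*pi)" and "g2 = \<gamma>2 / (2*pi)" and "G = \<Gamma> / (2*pi)"
  define F where "F k t = of_real \<sigma> * (- \<i> * of_real (phase \<alpha>1 \<alpha>2 k) * y t k + infsum (raman_term g1 g2 G (y t) k) UNIV)" for k t
  have Fcont: "continuous_on {0..T1} (F k)" for k
    unfolding F_def by (intro continuous_intros ycont1 continuous_on_raman_sum[OF dec s ycont1])
  have "y b k = fourier u0 k + integral {0..b} (F k)" if b: "b \<in> {0<..T1}" for b k
    unfolding y_def F_def[abs_def] g1_def g2_def G_def
  proof (rule weak_identity_integrated[OF \<sigma> s, where J = J and B = B])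
    show "0 < b" using b by simp
    show "\<sigma> * t \<in> J" if "t \<in> {0..b}" for t using that b T1 J[of "\<sigma> * t"] unfolding \<sigma>_def[symmetric] \<sigma>2 by simp
    show "0 \<le> \<sigma> * t" if "t \<in> J" for t using that J[of t] by (simp add: \<sigma>_def)
    show "weak_identity \<alpha>1 \<alpha>2 \<gamma>1 \<gamma>2 \<Gamma> J (of_real (- \<sigma>)) u0 u \<phi>" if "\<phi> \<in> test_functions J" for \<phi>
      using weak[OF that] by (simp add: \<sigma>_def)
    show "integrable torus (u (\<sigma> * t))" if "t \<in> {0..b}" for t
      by (rule HsD[OF hs]) (use that b T1 in auto)
    show "decaying s B (fourier (u (\<sigma> * t)))" if "t \<in> {0..b}" for t
      using dec[of t] that b unfolding y_def by auto
    show "continuous_on {0..b} (\<lambda>t. fourier (u (\<sigma> * t)) k)" for k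
      by (rule continuous_on_subset[OF ycont1[of k, unfolded y_def]]) (use b in auto)
  qed
  note integ = this
  define z where "z k t = fourier u0 k + integral {0..t} (F k)" for k t
  have zd: "(z k has_vector_derivative F k t) (at t within {0..T1})" if "t \<in> {0..T1}" for k t
    unfolding z_def
    using has_vector_derivative_add[OF has_vector_derivative_const integral_has_vector_derivative[OF Fcont that]] by simp
  then have zc: "continuous_on {0..T1} (z k)" for k
    by (meson continuous_on_eq_continuous_within has_vector_derivative_continuous)
  \<comment> \<open>The integrated identity is available only at positive times. Continuity of both
    sides extends it to 0, and this is how the initial value of \<open>u\<close> is identified with
    \<open>u0\<close>.\<close>
  have y0: "y 0 k = z k 0" for k
  proof -
    have "(y t k - z k t) = 0" if "t \<in> {0..T1}" for t
    proof (rule continuous_constant_on_closure[of "{0<..<T1}" "\<lambda>t. y t k - z k t"])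
      show "continuous_on (closure {0<..<T1}) (\<lambda>t. y t k - z k t)"
        using T1 by (simp add: continuous_on_diff ycont1 zc)
      show "y t k - z k t = 0" if "t \<in> {0<..<T1}" for t using integ[of t k] that by (simp add: z_def)
      show "t \<in> closure {0<..<T1}" using that T1 by simp
    qed
    from this[of 0] show ?thesis using T1 by simp
  qed
  have yz: "y t k = z k t" if "t \<in> {0..T1}" for t k
    using integ[of t k] y0[of k] that by (cases "t = 0") (auto simp: z_def)
  have y_init: "y 0 k = fourier u0 k" for k using y0[of k] by (simp add: z_def)
  have yd: "((\<lambda>t. y t k) has_vector_derivative F k t) (at t within {0..T1})" if t: "t \<in> {0..T1}" for t k
    by (rule has_vector_derivative_transform[OF t _ zd[OF t]]) (simp add: yz)
  \<comment> \<open>Half of the initial mass leaves room for continuity to keep the mass above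
    \<open>M\<close> on a short interval; positivity comes from the nonzero coefficient at
    \<open>l\<close>.\<close>
  define M where "M = mass (y 0) / 2"
  have dec0: "decaying s B (y 0)" using dec[of 0] T1 by simp
  have M: "M > 0"
  proof -
    have "0 < (cmod (y 0 l))\<^sup>2" using nz by (simp add: y_init)
    also have "\<dots> = (\<Sum>k\<in>{l}. (cmod (y 0 k))\<^sup>2)" by simp
    also have "\<dots> \<le> mass (y 0)"
      unfolding mass_def by (intro finite_sum_le_infsum has_sum_imp_summable[OF mass_has_sum[OF dec0 s]]) auto
    finally show ?thesis by (simp add: M_def)
  qed
  have "continuous_on {0..T1} (\<lambda>t. mass (y t))"
    using continuous_on_quadratic_sum[OF dec s _ ycont1, of "\<lambda>_. 1"] by (simp add: mass_def)
  then obtain d' where d': "d' > 0" "\<And>t. t \<in> {0..T1} \<Longrightarrow> dist t 0 < d' \<Longrightarrow> dist (mass (y t)) (mass (y 0)) < M"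
    using M T1 unfolding continuous_on_iff by (metis atLeastAtMost_iff less_imp_le order_refl)
  define T2 where "T2 = min T1 (d' / 2)"
  have T2: "0 < T2" "T2 \<le> T1" "T2 < d'" using T1 d'(1) by (auto simp: T2_def)
  \<comment> \<open>Time was already reversed in \<open>y\<close>; reversing the index completes the
    reflection in space and time when j = -1.\<close>
  define a where "a t k = y t (j * k)" for t k
  have bij: "bij (\<lambda>k. j * k)" by (rule bij_betw_byWitness[where f' = "\<lambda>k. j * k"]) (use j in auto)
  have japj: "jap (j * k) = jap k" for k using j by auto
  interpret raman_flow \<alpha>1 "of_int j * \<alpha>2" "of_int j * g1" g2 G s B T2 M a
  proof
    show "G > 0" using \<Gamma> by (simp add: G_def)
    show "2 * (of_int j * \<alpha>2) / (3 * \<alpha>1) \<notin> \<int>" using j \<alpha>(2) minus_in_Ints_iff[of "2 * \<alpha>2 / (3 * \<alpha>1)"] by auto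
    fix t assume t: "t \<in> {0..T2}"
    then have t1: "t \<in> {0..T1}" using T2 by auto
    have wa: "wt (a t) = (\<lambda>k. wt (y t) (j * k))" by (rule ext) (simp add: wt_def a_def japj)
    show "decaying s B (a t)"
      unfolding decaying_def
    proof (intro conjI allI)
      show "jap k powr s * cmod (a t k) \<le> B" for k
        using decayingD(1)[OF dec[OF t1], of "j * k"] by (simp add: a_def japj)
      show "wt (a t) summable_on UNIV"
        unfolding wa using decayingD(2)[OF dec[OF t1]] summable_on_reindex_bij_betw[OF bij, of "wt (y t)"] by simp
      show "infsum (wt (a t)) UNIV \<le> B"
        unfolding wa using decayingD(3)[OF dec[OF t1]] infsum_reindex_bij_betw[OF bij, of "wt (y t)"] by simp
    qed
    have "mass (a t) = mass (y t)"
      unfolding mass_def a_def using infsum_reindex_bij_betw[OF bij, of "\<lambda>k. (cmod (y t k))\<^sup>2"] by simp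
    moreover have "dist t 0 < d'" using t T2 by simp
    then have "dist (mass (y t)) (mass (y 0)) < M" using d'(2)[OF t1] by blast
    ultimately show "M \<le> mass (a t)" unfolding M_def dist_real_def by linarith
    fix k
    have "F (j * k) t = - \<i> * of_real (of_int j * phase \<alpha>1 \<alpha>2 (j * k)) * y t (j * k) + of_int j * infsum (raman_term g1 g2 G (y t) (j * k)) UNIV"
      by (simp add: F_def \<sigma>_def algebra_simps)
    also have "\<dots> = - \<i> * of_real (phase \<alpha>1 (of_int j * \<alpha>2) k) * a t k + infsum (raman_term (of_int j * g1) g2 G (a t) k) UNIV"
      unfolding phase_reflect[OF j] raman_sum_reflect[OF j] by (simp add: a_def[abs_def])
    finally show "((\<lambda>t. a t k) has_vector_derivative
      (- \<i> * of_real (phase \<alpha>1 (of_int j * \<alpha>2) k) * a t k + infsum (raman_term (of_int j * g1) g2 G (a t) k) UNIV)) (at t within {0..T2})"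
      using has_vector_derivative_within_subset[OF yd[OF t1, of "j * k"], of "{0..T2}"] T2 by (simp add: a_def)
  qed (use \<alpha> s T2 M in auto)
  show ?thesis using initial_gain by (simp add: a_def y_init)
qed

section \<open>Lacunary initial data\<close>

lemma jap_powr_summable_dyadic:
  assumes r: "r < 0"
  shows "(\<lambda>k. jap k powr r) summable_on {k. \<exists>n. \<bar>k\<bar> = 2 ^ n}"
proof -
  have "(\<lambda>n. jap (2 ^ n) powr r) summable_on (UNIV :: nat set)"
  proof (rule summable_on_comparison_test)
    have "norm (2 powr r) < 1" using r by (simp add: powr_less_one)
    then have "summable (\<lambda>n. (2 powr r) ^ n)" by (rule summable_geometric)
    then show "(\<lambda>n. (2 powr r) ^ n) summable_on (UNIV :: nat set)"
      by (subst summable_on_UNIV_nonneg_real_iff) auto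
    fix n :: nat
    have "jap (2 ^ n) powr r \<le> (2 ^ n) powr r"
      using r by (intro powr_mono2') (auto simp: jap_def)
    also have "\<dots> = (2 powr r) ^ n"
      by (simp add: powr_powr mult.commute flip: powr_realpow)
    finally show "jap (2 ^ n) powr r \<le> (2 powr r) ^ n" .
  qed simp
  then have 1: "(\<lambda>n. jap (2 ^ n) powr r) summable_on (UNIV :: nat set)" "(\<lambda>n. jap (- (2 ^ n)) powr r) summable_on (UNIV :: nat set)"
    by simp_all
  have "(\<lambda>k. jap k powr r) summable_on range (\<lambda>n. 2 ^ n)"
    by (subst summable_on_reindex) (use 1(1) in \<open>simp_all add: o_def inj_on_def\<close>)
  moreover have "(\<lambda>k. jap k powr r) summable_on range (\<lambda>n. - (2 ^ n))"
    by (subst summable_on_reindex) (use 1(2) in \<open>simp_all add: o_def inj_on_def\<close>)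
  ultimately have "(\<lambda>k. jap k powr r) summable_on (range (\<lambda>n. 2 ^ n) \<union> range (\<lambda>n. - (2 ^ n)))"
    by (rule summable_on_union)
  moreover have "range (\<lambda>n. 2 ^ n) \<union> range (\<lambda>n. - (2 ^ n)) = {k::int. \<exists>n. \<bar>k\<bar> = 2 ^ n}"
    by (auto simp: abs_if image_iff split: if_splits) (metis minus_minus)
  ultimately show ?thesis by simp
qed

text \<open>The surplus 1/32 is half of the forced gain 1/16: on dyadic frequencies the squared H^s
  norm is comparable to the geometric sum of 2^(-n/16), yet the coefficients exceed any multiple of
  k^(-s-1/16). Both signs of \<open>k\<close> occur, so one datum excludes both time
  directions.\<close>

definition lacunary :: "real \<Rightarrow> int \<Rightarrow> complex" where
  "lacunary s k = (if \<exists>n. \<bar>k\<bar> = 2 ^ n then of_real (jap k powr (- s - 1/32)) else 0)"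

lemma sobolev_summable_lacunary: "sobolev_summable s (lacunary s)"
proof -
  have "(jap k powr s * cmod (lacunary s k))\<^sup>2 = jap k powr (- 1/16)" if "\<exists>n. \<bar>k\<bar> = 2 ^ n" for k
    using that by (simp add: lacunary_def power2_eq_square flip: powr_add)
  then show ?thesis
    unfolding sobolev_summable_def using jap_powr_summable_dyadic[of "- 1/16"]
    by (subst summable_on_cong_neutral[where T = "{k. \<exists>n. \<bar>k\<bar> = 2 ^ n}"]) (auto simp: lacunary_def)
qed

lemma sobolev_function_exists:
  assumes s: "s \<ge> 1" and c: "sobolev_summable s c"
  obtains f where "f \<in> Hs s" "fourier f = c"
proof -
  have su: "(\<lambda>k. cmod (c k)) summable_on UNIV"
    by (rule decaying_norm_summable[OF sobolev_decaying[OF s c order_refl]])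
  let ?f = "\<lambda>x. 1 / complex_of_real (sqrt (2 * pi)) * trig_series c x"
  have "fourier ?f k = c k" for k
    by (simp only: fourier_cmult fourier_trig_series[OF su]) simp
  then have F: "fourier ?f = c" by (rule ext)
  have "integrable torus ?f" by (rule integrable_trig_series_mult[OF su integrable_torus_const])
  moreover have "torus_periodic ?f" using trig_series_periodic[of c] by (simp add: torus_periodic_def)
  ultimately have "?f \<in> Hs s" using c by (simp only: Hs_def mem_Collect_eq F torus_integrable_iff simp_thms)
  then show ?thesis using F that by blast
qed

lemma lacunary_no_gain:
  assumes "j \<in> {1, -1 :: int}"
  shows "\<not> (\<exists>C k0. \<forall>k\<ge>k0. cmod (lacunary s (j * k)) \<le> C * jap k powr (- s - 1/16))"
proof
  assume "\<exists>C k0. \<forall>k\<ge>k0. cmod (lacunary s (j * k)) \<le> C * jap k powr (- s - 1/16)"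
  then obtain C k0 where *: "\<And>k. k \<ge> k0 \<Longrightarrow> cmod (lacunary s (j * k)) \<le> C * jap k powr (- s - 1/16)" by blast
  \<comment> \<open>As 2^n > n, this choice already places the dyadic frequency 2^n beyond
    \<open>k0\<close> and makes the 1/32 power of its weight exceed \<open>C\<close>.\<close>
  obtain n :: nat where n: "max (real_of_int k0) ((\<bar>C\<bar> + 1) powr 32) < real n"
    using reals_Archimedean2 by blast
  have "C < \<bar>C\<bar> + 1" by linarith
  also have "\<dots> = ((\<bar>C\<bar> + 1) powr 32) powr (1/32)" by (simp only: powr_powr) simp
  also have "\<dots> \<le> real n powr (1/32)" using n by (intro powr_mono2) auto
  finally have Cn: "C < real n powr (1/32)" .
  let ?k = "2 ^ n :: int"
  have nk: "int n \<le> ?k" using of_nat_less_two_power[of n, where ?'a = int] by simp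
  then have "k0 \<le> ?k" using n by linarith
  then have "cmod (lacunary s (j * ?k)) \<le> C * jap ?k powr (- s - 1/16)" by (rule *)
  moreover have "lacunary s (j * ?k) = of_real (jap ?k powr (- s - 1/32))"
    using assms by (auto simp: lacunary_def)
  ultimately have "jap ?k powr (- s - 1/32) \<le> C * jap ?k powr (- s - 1/16)" by simp
  moreover have "jap ?k powr (- s - 1/32) = jap ?k powr (1/32) * jap ?k powr (- s - 1/16)"
    unfolding powr_add[symmetric] by (rule arg_cong[where f = "(powr) _"]) simp
  ultimately have "jap ?k powr (1/32) \<le> C" by (simp add: mult_le_cancel_right)
  moreover have "real n < 2 ^ n" by (rule of_nat_less_two_power)
  then have "real n \<le> 1 + 2 ^ n" by linarith
  then have "real n \<le> jap ?k" by (simp add: jap_def)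
  then have "real n powr (1/32) \<le> jap ?k powr (1/32)" by (intro powr_mono2) auto
  ultimately show False using Cn by linarith
qed

theorem theorem1p3:
  fixes \<alpha>1 \<alpha>2 \<gamma>1 \<gamma>2 \<Gamma> s :: real
  assumes "\<Gamma> > 0" and "\<alpha>1 \<noteq> 0" and "2 * \<alpha>2 / (3 * \<alpha>1) \<notin> \<int>" and "s \<ge> 1"
  shows "\<exists>u0\<in>Hs s.
    (\<forall>T>0. \<not> (\<exists>u. u \<in> C_Hs {0..T} s \<and> solution_forward \<alpha>1 \<alpha>2 \<gamma>1 \<gamma>2 \<Gamma> T u0 u)) \<and>
    (\<forall>T>0. \<not> (\<exists>u. u \<in> C_Hs {-T..0} s \<and> solution_backward \<alpha>1 \<alpha>2 \<gamma>1 \<gamma>2 \<Gamma> T u0 u))"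
proof -
  obtain u0 where u0: "u0 \<in> Hs s" "fourier u0 = lacunary s"
    using sobolev_function_exists[OF assms(4) sobolev_summable_lacunary] by blast
  \<comment> \<open>The frequency 1 = 2^0 is lacunary; its coefficient makes the initial mass, and
    with it the growth rate, positive.\<close>
  have nz: "fourier u0 1 \<noteq> 0"
    by (auto simp: u0(2) lacunary_def intro: exI[of _ 0])
  have contradiction: False
    if j: "j \<in> {1, -1}" and T: "T > 0"
      and I: "\<And>t. t \<in> I \<longleftrightarrow> of_int j * t \<in> {0..T}" and J: "\<And>t. t \<in> J \<longleftrightarrow> of_int j * t \<in> {0..<T}"
      and u: "u \<in> C_Hs I s"
      and weak: "\<And>\<phi>. \<phi> \<in> test_functions J \<Longrightarrow> weak_identity \<alpha>1 \<alpha>2 \<gamma>1 \<gamma>2 \<Gamma> J (of_real (- of_int j)) u0 u \<phi>"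
    for j :: int and T I J u
    using initial_fourier_gain[OF j assms(4) T assms(2,3,1) I J u weak nz] lacunary_no_gain[OF j, of s]
    unfolding u0(2) by blast
  show ?thesis
  proof (intro bexI[OF _ u0(1)] conjI allI impI notI; elim exE conjE)
    fix T :: real and u
    assume "T > 0" "u \<in> C_Hs {0..T} s" "solution_forward \<alpha>1 \<alpha>2 \<gamma>1 \<gamma>2 \<Gamma> T u0 u"
    then show False
      by (intro contradiction[of 1 T "{0..T}" "{0..<T}" u]) (auto simp: solution_forward_def solution_def)
  next
    fix T :: real and u
    assume "T > 0" "u \<in> C_Hs {-T..0} s" "solution_backward \<alpha>1 \<alpha>2 \<gamma>1 \<gamma>2 \<Gamma> T u0 u"
    then show False
      by (intro contradiction[of "-1" T "{-T..0}" "{-T<..0}" u]) (auto simp: solution_backward_def solution_def)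
  qed
qed

end
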